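(* Let $\mathcal{L}$ be a second-order linear operator on $\mathbb{R}^N$ satisfying assumptions (H1), (H2), (H3), (FS), (G), (L), (D) stated in the context. An open set $\Omega\subseteq\mathbb{R}^N$ is a maximum principle set for $\mathcal{L}$ if one of the following (sufficient) conditions is satisfied: (i) $\mathbb{R}^N\setminus\Omega$ is $\mathcal{L}$-large at infinity (this condition is also necessary); (ii) $\mathbb{R}^N\setminus\Omega$ is $p_{\mathcal{L}}$-unbounded for some $p>1$; (iii) $\mathbb{R}^N\setminus\Omega$ contains a $\Gamma$-cone.
   Context: Operator: $\mathcal{L}=\frac{1}{V(x)}\sum_{i=1}^N\frac{\partial}{\partial x_i}\Big(\sum_{j=1}^N V(x)a_{i,j}(x)\frac{\partial}{\partial x_j}\Big)$ on $\mathbb{R}^N$, where: (H1) $V,a_{i,j}\in C^\infty(\mathbb{R}^N,\mathbb{R})$ for all $i,j$ and $V>0$ on $\mathbb{R}^N$; (H2) the matrix $A(x)=(a_{i,j}(x))_{i,j}$ is symmetric, positive semi-definite and $\mathrm{trace}(A(x))>0$ for every $x\in\mathbb{R}^N$; (H3) there is $\varepsilon>0$ such that both $\mathcal{L}$ and $\mathcal{L}-\varepsilon$ are $C^\infty$-hypoelliptic in every open subset of $\mathbb{R}^N$ (an operator $P$ is $C^\infty$-hypoelliptic in $\Omega$ if every distributional solution $u$ of $Pu=f$ is smooth in $\Omega$ whenever $f$ is smooth). (FS) There is a function $\Gamma:\{(x,y)\in\mathbb{R}^N\times\mathbb{R}^N:x\ne y\}\to\mathbb{R}$ which is $C^\infty$,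 strictly positive and symmetric, such that for every $x\in\mathbb{R}^N$: $\Gamma(x,\cdot)\in L^1_{\mathrm{loc}}(\mathbb{R}^N)$ and $\int_{\mathbb{R}^N}\Gamma(x,y)\,\mathcal{L}\varphi(y)\,V(y)\,dy=-\varphi(x)$ for all $\varphi\in C_0^\infty(\mathbb{R}^N,\mathbb{R})$; $\lim_{y\to x}\Gamma(x,y)=\infty$; $\lim_{\|y\|\to\infty}\Gamma(x,y)=0$. Set $\gamma(x,y)=1/\Gamma(x,y)$ for $x\neq y$, $\gamma(x,x)=0$, and define the $\Gamma$-ball $\Omega(x,r)=\{y\in\mathbb{R}^N:\gamma(x,y)<r\}$ for $x\in\mathbb{R}^N$, $r>0$. (G) There is $\theta\in(0,1)$ such that $x\notin\Omega(y,r)$ implies $\Omega(x,\theta r)\cap\Omega(y,\theta r)=\varnothing$, for all $x,y\in\mathbb{R}^N$, $r>0$. (L) Every $\mathcal{L}$-harmonic function on $\mathbb{R}^N$ which is bounded from above (or from below) is constant. (D) There are constants $2<\alpha'<\alpha''$ such that $\alpha'|\Omega(x,r)|\le|\Omega(x,2r)|\le\alpha''|\Omega(x,r)|$ for every $x\in\mathbb{R}^N$, $r>0$, where $|\cdot|$ is Lebesgue measure. Potential theory: a function is $\mathcal{L}$-harmonic in an open set if it is a smooth solution of $\mathcal{L}u=0$ there. For $\Omega\subseteq\mathbb{R}^N$ open, an upper semicontinuous function $u:\Omega\to[-\infty,\infty)$ is $\mathcal{L}$-subharmonic in $\Omega$ if (i) $\{x\in\Omega:u(x)>-\infty\}$ is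 dense in $\Omega$; (ii) for every bounded open set $W$ with $\overline W\subseteq\Omega$ and every $h$ that is $\mathcal{L}$-harmonic in $W$, continuous up to $\partial W$ and satisfies $u\le h$ on $\partial W$, one has $u\le h$ in $W$. $\underline{\mathcal{L}}_b(\Omega)$ denotes the set of $\mathcal{L}$-subharmonic functions in $\Omega$ that are bounded above. Maximum principle set: an open set $\Omega\subseteq\mathbb{R}^N$ is a maximum principle set for $\mathcal{L}$ if every $u\in\underline{\mathcal{L}}_b(\Omega)$ such that $\limsup_{x\to\xi}u(x)\le 0$ for every $\xi\in\partial\Omega$ satisfies $u\le 0$ in $\Omega$. Thin/large sets: an unbounded set $F\subseteq\mathbb{R}^N$ is $\mathcal{L}$-thin at infinity if there is $u\in\underline{\mathcal{L}}_b(\mathbb{R}^N)$ with $\limsup_{x\to\infty,\,x\in F}u(x)<\limsup_{x\to\infty}u(x)$. A bounded set $F$ (possibly empty) is $\mathcal{L}$-thin at infinity if there is $u\in\underline{\mathcal{L}}_b(\mathbb{R}^N)$ with $\sup_F u<\sup_{\mathbb{R}^N}u$ (where $\sup_\varnothing u=-\infty$). $F$ is $\mathcal{L}$-large at infinity if it is not $\mathcal{L}$-thin at infinity. $p_{\mathcal{L}}$-boundedness: for $p\in(1,\infty)$, $F\subseteq\mathbb{R}^N$ is $p_{\mathcal{L}}$-bounded if there is a countable family $\{\Omega(x_n,r_n)\}_{n\in J}$ of $\Gamma$-balls such that $F\subseteq\bigcup_{n\in J}\Omega(x_n,r_n)$ and $\sum_{n\in J}\big(r_n/\gamma(0,x_n)\big)^p<\infty$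 (a term with $x_n=0$ counts as $+\infty$). $F$ is $p_{\mathcal{L}}$-unbounded if it is not $p_{\mathcal{L}}$-bounded. $\Gamma$-cone: a set $K\subseteq\mathbb{R}^N$ is a $\Gamma$-cone if there is a sequence of $\Gamma$-balls $\{\Omega(z_j,R_j)\}_{j\in\mathbb{N}}$, all contained in $K$, such that $\|z_j\|\to\infty$ as $j\to\infty$ and $\liminf_{j\to\infty}R_j/\gamma(0,z_j)>0$. *)

theory Defs
  imports "HOL-Analysis.Analysis"
begin

text \<open>The derivative is taken in the full space, so the following notions are meant for open \<open>S\<close>.\<close>

primrec Ck_on :: "nat \<Rightarrow> 'a::euclidean_space set \<Rightarrow> ('a \<Rightarrow> real) \<Rightarrow> bool" where
  "Ck_on 0 S f \<longleftrightarrow> continuous_on S f"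
| "Ck_on (Suc k) S f \<longleftrightarrow> (\<forall>x\<in>S. f differentiable (at x)) \<and>
     (\<forall>b\<in>Basis. Ck_on k S (\<lambda>x. frechet_derivative f (at x) b))"

definition smooth_on :: "'a::euclidean_space set \<Rightarrow> ('a \<Rightarrow> real) \<Rightarrow> bool" where
  "smooth_on S f \<longleftrightarrow> (\<forall>k. Ck_on k S f)"

definition pderiv_at :: "'n \<Rightarrow> (real^'n::finite \<Rightarrow> real) \<Rightarrow> real^'n \<Rightarrow> real" where
  "pderiv_at i f x = frechet_derivative f (at x) (axis i 1)"

definition test_functions :: "(real^'n::finite) set \<Rightarrow> (real^'n \<Rightarrow> real) set" where
  "test_functions \<Omega> = {\<phi>. smooth_on UNIV \<phi> \<and>
     compact (closure {x. \<phi> x \<noteq> 0}) \<and> closure {x. \<phi> x \<noteq> 0} \<subseteq> \<Omega>}"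

definition Lop :: "(real^'n::finite \<Rightarrow> real) \<Rightarrow> (real^'n \<Rightarrow> real^'n^'n) \<Rightarrow>
    (real^'n \<Rightarrow> real) \<Rightarrow> real^'n \<Rightarrow> real" where
  "Lop V A f x = 1 / V x *
     (\<Sum>i\<in>UNIV. pderiv_at i (\<lambda>y. \<Sum>j\<in>UNIV. V y * A y $ i $ j * pderiv_at j f y) x)"

text \<open>
  A distribution on \<open>\<Omega>\<close> is a real linear functional on the test functions of \<open>\<Omega>\<close> that is
  bounded, on the test functions supported in any given compact subset, by finitely many of the
  seminorms \<open>sup \<bar>\<partial>\<^sup>\<alpha>\<phi>\<bar>\<close>. Only its values on \<^term>\<open>test_functions \<Omega>\<close>
  matter. An index list \<open>is\<close> stands for the iterated derivative along its entries.
\<close>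

type_synonym 'n functional = "(real^'n \<Rightarrow> real) \<Rightarrow> real"

definition distribution_on :: "(real^'n::finite) set \<Rightarrow> 'n functional \<Rightarrow> bool" where
  "distribution_on \<Omega> T \<longleftrightarrow>
     (\<forall>\<phi>\<in>test_functions \<Omega>. \<forall>\<psi>\<in>test_functions \<Omega>. T (\<lambda>x. \<phi> x + \<psi> x) = T \<phi> + T \<psi>) \<and>
     (\<forall>\<phi>\<in>test_functions \<Omega>. \<forall>c. T (\<lambda>x. c * \<phi> x) = c * T \<phi>) \<and>
     (\<forall>K. compact K \<and> K \<subseteq> \<Omega> \<longrightarrow>
        (\<exists>C m. \<forall>\<phi>\<in>test_functions K.
           \<bar>T \<phi>\<bar> \<le> C * (\<Sum>is | length is \<le> m. SUP x. \<bar>foldr pderiv_at is \<phi> x\<bar>)))"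

definition dist_mult :: "(real^'n::finite \<Rightarrow> real) \<Rightarrow> 'n functional \<Rightarrow> 'n functional" where
  "dist_mult c T \<phi> = T (\<lambda>x. c x * \<phi> x)"

definition dist_pderiv :: "'n \<Rightarrow> 'n::finite functional \<Rightarrow> 'n functional" where
  "dist_pderiv i T \<phi> = - T (pderiv_at i \<phi>)"

definition dist_Lop :: "(real^'n::finite \<Rightarrow> real) \<Rightarrow> (real^'n \<Rightarrow> real^'n^'n) \<Rightarrow>
    'n functional \<Rightarrow> 'n functional" where
  "dist_Lop V A T = dist_mult (\<lambda>x. 1 / V x)
     (\<lambda>\<phi>. \<Sum>i\<in>UNIV. dist_pderiv i
        (\<lambda>\<psi>. \<Sum>j\<in>UNIV. dist_mult (\<lambda>x. V x * A x $ i $ j) (dist_pderiv j T) \<psi>) \<phi>)"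

text \<open>A function \<open>f\<close> is identified with the distribution \<open>\<phi> \<mapsto> \<integral> f \<phi> dx\<close>.\<close>

definition represented_on :: "(real^'n::finite) set \<Rightarrow> 'n functional \<Rightarrow> (real^'n \<Rightarrow> real) \<Rightarrow> bool" where
  "represented_on \<Omega> T f \<longleftrightarrow> (\<forall>\<phi>\<in>test_functions \<Omega>. T \<phi> = (LINT x|lborel. f x * \<phi> x))"

definition hypoelliptic_in :: "(real^'n::finite) set \<Rightarrow> ('n functional \<Rightarrow> 'n functional) \<Rightarrow> bool" where
  "hypoelliptic_in \<Omega> P \<longleftrightarrow>
     (\<forall>T f. distribution_on \<Omega> T \<and> smooth_on \<Omega> f \<and> represented_on \<Omega> (P T) f \<longrightarrow>
        (\<exists>g. smooth_on \<Omega> g \<and> represented_on \<Omega> T g))"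

definition H1 :: "(real^'n::finite \<Rightarrow> real) \<Rightarrow> (real^'n \<Rightarrow> real^'n^'n) \<Rightarrow> bool" where
  "H1 V A \<longleftrightarrow> smooth_on UNIV V \<and> (\<forall>i j. smooth_on UNIV (\<lambda>x. A x $ i $ j)) \<and> (\<forall>x. V x > 0)"

definition H2 :: "(real^'n::finite \<Rightarrow> real^'n^'n) \<Rightarrow> bool" where
  "H2 A \<longleftrightarrow> (\<forall>x. transpose (A x) = A x \<and> (\<forall>v. v \<bullet> (A x *v v) \<ge> 0) \<and> trace (A x) > 0)"

definition H3 :: "(real^'n::finite \<Rightarrow> real) \<Rightarrow> (real^'n \<Rightarrow> real^'n^'n) \<Rightarrow> bool" where
  "H3 V A \<longleftrightarrow> (\<exists>\<epsilon>>0. \<forall>\<Omega>. open \<Omega> \<longrightarrow>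
     hypoelliptic_in \<Omega> (dist_Lop V A) \<and>
     hypoelliptic_in \<Omega> (\<lambda>T \<phi>. dist_Lop V A T \<phi> - \<epsilon> * T \<phi>))"

text \<open>The values of \<open>\<Gamma>\<close> on the diagonal are irrelevant.\<close>

definition FS :: "(real^'n::finite \<Rightarrow> real) \<Rightarrow> (real^'n \<Rightarrow> real^'n^'n) \<Rightarrow>
    (real^'n \<Rightarrow> real^'n \<Rightarrow> real) \<Rightarrow> bool" where
  "FS V A \<Gamma> \<longleftrightarrow>
     smooth_on {p. fst p \<noteq> snd p} (\<lambda>p. \<Gamma> (fst p) (snd p)) \<and>
     (\<forall>x y. x \<noteq> y \<longrightarrow> \<Gamma> x y > 0 \<and> \<Gamma> x y = \<Gamma> y x) \<and>
     (\<forall>x. (\<forall>K. compact K \<longrightarrow> set_integrable lborel K (\<Gamma> x)) \<and>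
          (\<forall>\<phi>\<in>test_functions UNIV. (LINT y|lborel. \<Gamma> x y * Lop V A \<phi> y * V y) = - \<phi> x) \<and>
          filterlim (\<Gamma> x) at_top (at x) \<and>
          (\<Gamma> x \<longlongrightarrow> 0) at_infinity)"

definition gam :: "(real^'n::finite \<Rightarrow> real^'n \<Rightarrow> real) \<Rightarrow> real^'n \<Rightarrow> real^'n \<Rightarrow> real" where
  "gam \<Gamma> x y = (if x = y then 0 else 1 / \<Gamma> x y)"

definition Gball :: "(real^'n::finite \<Rightarrow> real^'n \<Rightarrow> real) \<Rightarrow> real^'n \<Rightarrow> real \<Rightarrow> (real^'n) set" where
  "Gball \<Gamma> x r = {y. gam \<Gamma> x y < r}"

definition cond_G :: "(real^'n::finite \<Rightarrow> real^'n \<Rightarrow> real) \<Rightarrow> bool" where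
  "cond_G \<Gamma> \<longleftrightarrow> (\<exists>\<theta>. 0 < \<theta> \<and> \<theta> < 1 \<and>
     (\<forall>x y r. r > 0 \<and> x \<notin> Gball \<Gamma> y r \<longrightarrow> Gball \<Gamma> x (\<theta> * r) \<inter> Gball \<Gamma> y (\<theta> * r) = {}))"

text \<open>Harmonicity is meant for open sets.\<close>

definition harmonic_on :: "(real^'n::finite \<Rightarrow> real) \<Rightarrow> (real^'n \<Rightarrow> real^'n^'n) \<Rightarrow>
    (real^'n) set \<Rightarrow> (real^'n \<Rightarrow> real) \<Rightarrow> bool" where
  "harmonic_on V A W u \<longleftrightarrow> smooth_on W u \<and> (\<forall>x\<in>W. Lop V A u x = 0)"

definition cond_L :: "(real^'n::finite \<Rightarrow> real) \<Rightarrow> (real^'n \<Rightarrow> real^'n^'n) \<Rightarrow> bool" where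
  "cond_L V A \<longleftrightarrow> (\<forall>u. harmonic_on V A UNIV u \<and> (bdd_above (range u) \<or> bdd_below (range u)) \<longrightarrow>
     (\<exists>c. \<forall>x. u x = c))"

definition cond_D :: "(real^'n::finite \<Rightarrow> real^'n \<Rightarrow> real) \<Rightarrow> bool" where
  "cond_D \<Gamma> \<longleftrightarrow> (\<exists>\<alpha>1 \<alpha>2. 2 < \<alpha>1 \<and> \<alpha>1 < \<alpha>2 \<and>
     (\<forall>x r. r > 0 \<longrightarrow>
        \<alpha>1 * measure lebesgue (Gball \<Gamma> x r) \<le> measure lebesgue (Gball \<Gamma> x (2 * r)) \<and>
        measure lebesgue (Gball \<Gamma> x (2 * r)) \<le> \<alpha>2 * measure lebesgue (Gball \<Gamma> x r)))"

text \<open>Functions with values in \<open>[-\<infinity>, \<infinity>)\<close> on \<open>\<Omega>\<close> are total functions into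
  \<^typ>\<open>ereal\<close>; the first two conjuncts express the codomain and upper semicontinuity.\<close>

definition subharmonic_on :: "(real^'n::finite \<Rightarrow> real) \<Rightarrow> (real^'n \<Rightarrow> real^'n^'n) \<Rightarrow>
    (real^'n) set \<Rightarrow> (real^'n \<Rightarrow> ereal) \<Rightarrow> bool" where
  "subharmonic_on V A \<Omega> u \<longleftrightarrow>
     (\<forall>x\<in>\<Omega>. u x < \<infinity>) \<and>
     (\<forall>c. openin (top_of_set \<Omega>) {x\<in>\<Omega>. u x < c}) \<and>
     \<Omega> \<subseteq> closure {x\<in>\<Omega>. u x > -\<infinity>} \<and>
     (\<forall>W h. open W \<and> bounded W \<and> closure W \<subseteq> \<Omega> \<and>
        harmonic_on V A W h \<and> continuous_on (closure W) h \<and>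
        (\<forall>x\<in>frontier W. u x \<le> ereal (h x)) \<longrightarrow> (\<forall>x\<in>W. u x \<le> ereal (h x)))"

definition subharm_bdd :: "(real^'n::finite \<Rightarrow> real) \<Rightarrow> (real^'n \<Rightarrow> real^'n^'n) \<Rightarrow>
    (real^'n) set \<Rightarrow> (real^'n \<Rightarrow> ereal) set" where
  "subharm_bdd V A \<Omega> = {u. subharmonic_on V A \<Omega> u \<and> (\<exists>C::real. \<forall>x\<in>\<Omega>. u x \<le> ereal C)}"

definition max_principle_set :: "(real^'n::finite \<Rightarrow> real) \<Rightarrow> (real^'n \<Rightarrow> real^'n^'n) \<Rightarrow>
    (real^'n) set \<Rightarrow> bool" where
  "max_principle_set V A \<Omega> \<longleftrightarrow> open \<Omega> \<and>
     (\<forall>u\<in>subharm_bdd V A \<Omega>.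
        (\<forall>\<xi>\<in>frontier \<Omega>. Limsup (at \<xi> within \<Omega>) u \<le> 0) \<longrightarrow> (\<forall>x\<in>\<Omega>. u x \<le> 0))"

text \<open>In \<^typ>\<open>ereal\<close> the supremum over the empty set is \<open>-\<infinity>\<close>.\<close>

definition thin_at_infinity :: "(real^'n::finite \<Rightarrow> real) \<Rightarrow> (real^'n \<Rightarrow> real^'n^'n) \<Rightarrow>
    (real^'n) set \<Rightarrow> bool" where
  "thin_at_infinity V A F \<longleftrightarrow> (\<exists>u\<in>subharm_bdd V A UNIV.
     if bounded F then (SUP x\<in>F. u x) < (SUP x. u x)
     else Limsup (inf at_infinity (principal F)) u < Limsup at_infinity u)"

definition large_at_infinity :: "(real^'n::finite \<Rightarrow> real) \<Rightarrow> (real^'n \<Rightarrow> real^'n^'n) \<Rightarrow>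
    (real^'n) set \<Rightarrow> bool" where
  "large_at_infinity V A F \<longleftrightarrow> \<not> thin_at_infinity V A F"

definition p_bounded :: "(real^'n::finite \<Rightarrow> real^'n \<Rightarrow> real) \<Rightarrow> real \<Rightarrow> (real^'n) set \<Rightarrow> bool" where
  "p_bounded \<Gamma> p F \<longleftrightarrow> (\<exists>(J::nat set) z r.
     (\<forall>n\<in>J. r n > 0) \<and>
     F \<subseteq> (\<Union>n\<in>J. Gball \<Gamma> (z n) (r n)) \<and>
     (\<Sum>\<^sub>\<infinity>n\<in>J. if z n = 0 then \<infinity> else ennreal ((r n / gam \<Gamma> 0 (z n)) powr p)) < \<infinity>)"

definition p_unbounded :: "(real^'n::finite \<Rightarrow> real^'n \<Rightarrow> real) \<Rightarrow> real \<Rightarrow> (real^'n) set \<Rightarrow> bool" where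
  "p_unbounded \<Gamma> p F \<longleftrightarrow> \<not> p_bounded \<Gamma> p F"

text \<open>The finitely many \<open>j\<close> with \<open>z j = 0\<close>, where \<open>gam \<Gamma> 0 (z j) = 0\<close>, do not affect the
  lower limit.\<close>

definition Gcone :: "(real^'n::finite \<Rightarrow> real^'n \<Rightarrow> real) \<Rightarrow> (real^'n) set \<Rightarrow> bool" where
  "Gcone \<Gamma> K \<longleftrightarrow> (\<exists>(z::nat \<Rightarrow> real^'n) R.
     (\<forall>j. R j > 0 \<and> Gball \<Gamma> (z j) (R j) \<subseteq> K) \<and>
     filterlim (\<lambda>j. norm (z j)) at_top sequentially \<and>
     liminf (\<lambda>j. ereal (R j / gam \<Gamma> 0 (z j))) > 0)"

end

theory Submission
  imports Defs
begin

text \<open>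
  The representation formula shows that a test function \<open>\<phi>\<close> with \<open>Lop V A \<phi> \<ge> 0\<close> is nonpositive.
  Applied to \<open>f \<circ> w\<close> with \<open>w\<close> harmonic and \<open>f\<close> smooth, convex and zero on the negative
  half-line, this gives the weak maximum principle on bounded open sets, and with it the usual
  gluing: if \<open>\<Omega>\<close> is not a maximum principle set, there is a bounded subharmonic
  \<open>w \<ge> 0\<close> on the whole space that vanishes off \<open>\<Omega>\<close> but not identically, so the complement of
  \<open>\<Omega>\<close> is thin. For the converse, a function \<open>u\<close> witnessing thinness of an unbounded complement
  is compared with \<open>c + k \<Gamma>(a, \<cdot>)\<close> for a point \<open>a \<notin> \<Omega>\<close>; the singular term absorbs
  whatever \<open>u\<close> does on a bounded part of the complement.

  For the second condition, take a fine finite net \<open>P\<close> of a bounded piece of the complement and a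
  subset \<open>S\<close> of \<open>P\<close> minimizing a discrete energy. Its \<open>\<Gamma>\<close>-potential \<open>U\<close> is bounded below on
  \<open>P\<close> and, \<open>1/\<Gamma>\<close> being a quasi-metric by (G), bounded above off tiny balls around \<open>S\<close>. Hence
  \<open>w \<le> M - c M U\<close> up to a small error, \<open>M\<close> being the supremum of \<open>w\<close>, so \<open>U\<close> is small at a
  point where \<open>w\<close> is almost maximal, and then also at the origin when \<open>P\<close> is far away. A Vitali
  covering argument turns smallness of \<open>U(0)\<close> into a covering of \<open>P\<close> with small \<open>p\<close>-content.

  Finally, (D) shows by comparison of volumes that a set containing a \<open>\<Gamma>\<close>-cone is
  \<open>p\<close>-unbounded for \<open>p = log 2 \<alpha>'\<close>, which exceeds 1 because \<open>\<alpha>' > 2\<close>.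
\<close>

subsection \<open>Calculus of smooth functions\<close>

lemma frechet_derivative_cong_open:
  assumes "open S" "x \<in> S" "\<And>y. y \<in> S \<Longrightarrow> f y = g y"
  shows "frechet_derivative f (at x) = frechet_derivative g (at x)"
proof -
  have "(f has_derivative D) (at x) \<longleftrightarrow> (g has_derivative D) (at x)" for D
    using assms by (metis has_derivative_transform_within_open)
  then show ?thesis
    unfolding frechet_derivative_def by simp
qed

lemma differentiable_cong_open:
  assumes "open S" "x \<in> S" "\<And>y. y \<in> S \<Longrightarrow> f y = g y" "f differentiable (at x)"
  shows "g differentiable (at x)"
  using assms unfolding differentiable_def by (metis has_derivative_transform_within_open)

text \<open>On an open set derivatives are local, so in the inductions below a derivative may be
  replaced by any formula that agrees with it on \<open>S\<close>.\<close>

lemma Ck_on_cong: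
  assumes "open S" "\<And>y. y \<in> S \<Longrightarrow> f y = g y" "Ck_on k S f"
  shows "Ck_on k S g"
  using assms(2,3)
proof (induction k arbitrary: f g)
  case 0
  then show ?case by (simp cong: continuous_on_cong)
next
  case (Suc k)
  have "Ck_on k S (\<lambda>x. frechet_derivative g (at x) b)" if "b \<in> Basis" for b
  proof (rule Suc.IH)
    show "frechet_derivative f (at y) b = frechet_derivative g (at y) b" if "y \<in> S" for y
      using frechet_derivative_cong_open[OF assms(1) that Suc.prems(1)] by simp
  qed (use Suc.prems that in auto)
  with Suc.prems show ?case
    using differentiable_cong_open[OF assms(1)] by (metis Ck_on.simps(2))
qed

lemma Ck_on_subset:
  assumes "Ck_on k S f" "T \<subseteq> S"
  shows "Ck_on k T f"
  using assms by (induction k arbitrary: f) (auto intro: continuous_on_subset)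

lemma Ck_on_Un:
  assumes "open S" "open T" "Ck_on k S f" "Ck_on k T f"
  shows "Ck_on k (S \<union> T) f"
  using assms by (induction k arbitrary: f) (auto intro: continuous_on_open_Un)

lemma Ck_on_Suc_imp: "Ck_on (Suc k) S f \<Longrightarrow> Ck_on k S f"
proof (induction k arbitrary: f)
  case 0
  then show ?case
    by (auto intro!: continuous_at_imp_continuous_on differentiable_imp_continuous_within)
next
  case (Suc k)
  then show ?case by (metis Ck_on.simps(2))
qed

lemma Ck_on_const: "Ck_on k S (\<lambda>x. c)"
  by (induction k arbitrary: c) simp_all

lemma Ck_on_add:
  assumes "open S" "Ck_on k S f" "Ck_on k S g"
  shows "Ck_on k S (\<lambda>x. f x + g x)"
  using assms(2,3)
proof (induction k arbitrary: f g)
  case 0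
  then show ?case by (simp add: continuous_on_add)
next
  case (Suc k)
  have "Ck_on k S (\<lambda>x. frechet_derivative (\<lambda>x. f x + g x) (at x) b)" if "b \<in> Basis" for b
  proof (rule Ck_on_cong[OF assms(1)])
    show "Ck_on k S (\<lambda>x. frechet_derivative f (at x) b + frechet_derivative g (at x) b)"
      using Suc that by simp
    show "frechet_derivative f (at y) b + frechet_derivative g (at y) b =
      frechet_derivative (\<lambda>x. f x + g x) (at y) b" if "y \<in> S" for y
    proof -
      have "(f has_derivative frechet_derivative f (at y)) (at y)"
        "(g has_derivative frechet_derivative g (at y)) (at y)"
        using Suc.prems that by (auto simp: frechet_derivative_works)
      from frechet_derivative_at[OF has_derivative_add[OF this]] show ?thesis
        by (rule fun_cong)
    qed
  qed
  then show ?case using Suc.prems by (auto intro: differentiable_add)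
qed

lemma frechet_derivative_mult_real:
  fixes f g :: "'a::real_normed_vector \<Rightarrow> real"
  assumes "f differentiable (at y)" "g differentiable (at y)"
  shows "frechet_derivative (\<lambda>x. f x * g x) (at y) b =
    f y * frechet_derivative g (at y) b + frechet_derivative f (at y) b * g y"
proof -
  have "(f has_derivative frechet_derivative f (at y)) (at y)"
    "(g has_derivative frechet_derivative g (at y)) (at y)"
    using assms by (auto simp: frechet_derivative_works)
  from fun_cong[OF frechet_derivative_at[OF has_derivative_mult[OF this]], of b] show ?thesis
    by simp
qed

lemma Ck_on_mult:
  assumes "open S" "Ck_on k S f" "Ck_on k S g"
  shows "Ck_on k S (\<lambda>x. f x * g x)"
  using assms(2,3)
proof (induction k arbitrary: f g)
  case 0
  then show ?case by (simp add: continuous_on_mult)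
next
  case (Suc k)
  have "Ck_on k S (\<lambda>x. frechet_derivative (\<lambda>x. f x * g x) (at x) b)" if "b \<in> Basis" for b
  proof (rule Ck_on_cong[OF assms(1)])
    show "Ck_on k S (\<lambda>x. f x * frechet_derivative g (at x) b + frechet_derivative f (at x) b * g x)"
      using Suc.prems that Ck_on_Suc_imp[OF Suc.prems(1)] Ck_on_Suc_imp[OF Suc.prems(2)]
      by (intro Ck_on_add assms(1) Suc.IH) (simp_all del: Ck_on.simps(2), simp_all)
    show "f y * frechet_derivative g (at y) b + frechet_derivative f (at y) b * g y =
      frechet_derivative (\<lambda>x. f x * g x) (at y) b" if "y \<in> S" for y
      using Suc.prems that by (intro frechet_derivative_mult_real[symmetric]) auto
  qed
  then show ?case using Suc.prems by (auto intro: differentiable_mult)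
qed

lemma frechet_derivative_compose_real:
  fixes f :: "'a::real_normed_vector \<Rightarrow> real" and \<phi> :: "real \<Rightarrow> real"
  assumes "f differentiable (at y)" "(\<phi> has_real_derivative d) (at (f y))"
  shows "(\<lambda>x. \<phi> (f x)) differentiable (at y)"
    "frechet_derivative (\<lambda>x. \<phi> (f x)) (at y) b = d * frechet_derivative f (at y) b"
proof -
  have "(f has_derivative frechet_derivative f (at y)) (at y)"
    using assms by (auto simp: frechet_derivative_works)
  from DERIV_compose_FDERIV[OF assms(2) this]
  have *: "((\<lambda>x. \<phi> (f x)) has_derivative (\<lambda>b. frechet_derivative f (at y) b * d)) (at y)" .
  then show "(\<lambda>x. \<phi> (f x)) differentiable (at y)" by (auto simp: differentiable_def)
  show "frechet_derivative (\<lambda>x. \<phi> (f x)) (at y) b = d * frechet_derivative f (at y) b"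
    using frechet_derivative_at[OF *] by (metis mult.commute)
qed

lemma Ck_on_bounded_linear:
  assumes "bounded_linear f" shows "Ck_on k S f"
proof -
  have "frechet_derivative f (at x) = f" for x
    using assms frechet_derivative_at[OF bounded_linear.has_derivative[OF assms has_derivative_ident]] by simp
  then show ?thesis
    using assms
    by (cases k) (auto simp: Ck_on_const bounded_linear_imp_differentiable linear_continuous_on)
qed

text \<open>Joint smoothness of \<Gamma> off the diagonal is assumed; freezing the first variable
  yields smoothness of \<open>\<Gamma> x\<close> off its pole. A derivative of the slice along
  \<open>b\<close> is one of \<open>f\<close> along \<open>(0, b)\<close>, again a basis
  vector.\<close>

lemma Ck_on_slice:
  fixes f :: "'a::euclidean_space \<times> 'b::euclidean_space \<Rightarrow> real"
  assumes "open S" "Ck_on k S f"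
  shows "Ck_on k {y. (a, y) \<in> S} (\<lambda>y. f (a, y))"
  using assms(2)
proof (induction k arbitrary: f)
  case 0
  then show ?case
    by (auto intro!: continuous_on_compose2[of S f] continuous_intros)
next
  case (Suc k)
  have op: "open {y. (a, y) \<in> S}"
    using assms(1) by (auto intro!: open_vimage[of S "\<lambda>y. (a,y)", unfolded vimage_def] continuous_intros)
  have D: "((\<lambda>y. f (a, y)) has_derivative (\<lambda>h. frechet_derivative f (at (a, y)) (0, h))) (at y)"
    if "(a, y) \<in> S" for y
  proof -
    have "(f has_derivative frechet_derivative f (at (a, y))) (at (a, y))"
      using Suc.prems that by (auto simp: frechet_derivative_works)
    moreover have "(Pair a has_derivative (\<lambda>h. (0, h))) (at y)"
      by (auto intro!: derivative_eq_intros)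
    ultimately show ?thesis
      using has_derivative_compose by fastforce
  qed
  have "Ck_on k {y. (a, y) \<in> S} (\<lambda>x. frechet_derivative (\<lambda>y. f (a, y)) (at x) b)" if "b \<in> Basis" for b
  proof (rule Ck_on_cong[OF op])
    have "(0, b) \<in> Basis" using that by (auto simp: Basis_prod_def)
    then show "Ck_on k {y. (a, y) \<in> S} (\<lambda>y. frechet_derivative f (at (a, y)) (0, b))"
      using Suc by auto
  qed (use fun_cong[OF frechet_derivative_at[OF D]] in auto)
  then show ?case using D by (auto simp: differentiable_def)
qed

section \<open>Smooth functions and partial derivatives\<close>

lemma smooth_on_cong:
  "open S \<Longrightarrow> smooth_on S f \<Longrightarrow> (\<And>y. y \<in> S \<Longrightarrow> f y = g y) \<Longrightarrow> smooth_on S g"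
  unfolding smooth_on_def by (metis Ck_on_cong)

lemma smooth_on_subset: "smooth_on S f \<Longrightarrow> T \<subseteq> S \<Longrightarrow> smooth_on T f"
  unfolding smooth_on_def by (metis Ck_on_subset)

lemma smooth_on_Un:
  "open S \<Longrightarrow> open T \<Longrightarrow> smooth_on S f \<Longrightarrow> smooth_on T f \<Longrightarrow> smooth_on (S \<union> T) f"
  unfolding smooth_on_def by (metis Ck_on_Un)

lemma smooth_on_const: "smooth_on S (\<lambda>x. c)"
  unfolding smooth_on_def by (simp add: Ck_on_const)

lemma smooth_on_add:
  "open S \<Longrightarrow> smooth_on S f \<Longrightarrow> smooth_on S g \<Longrightarrow> smooth_on S (\<lambda>x. f x + g x)"
  unfolding smooth_on_def by (simp add: Ck_on_add)

lemma smooth_on_mult: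
  "open S \<Longrightarrow> smooth_on S f \<Longrightarrow> smooth_on S g \<Longrightarrow> smooth_on S (\<lambda>x. f x * g x)"
  unfolding smooth_on_def by (simp add: Ck_on_mult)

lemma smooth_on_cmult:
  "open S \<Longrightarrow> smooth_on S f \<Longrightarrow> smooth_on S (\<lambda>x. c * f x)"
  by (rule smooth_on_mult[OF _ smooth_on_const])

lemma smooth_on_diff:
  assumes "open S" "smooth_on S f" "smooth_on S g" shows "smooth_on S (\<lambda>x. f x - g x)"
  using smooth_on_add[OF assms(1,2) smooth_on_cmult[OF assms(1,3), of "-1"]] by simp

lemma smooth_on_sum:
  assumes "open S" "\<And>i. i \<in> I \<Longrightarrow> smooth_on S (f i)"
  shows "smooth_on S (\<lambda>x. \<Sum>i\<in>I. f i x)"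
  using assms(2)
  by (induction I rule: infinite_finite_induct) (auto simp: smooth_on_const smooth_on_add assms(1))

lemma smooth_on_bounded_linear: "bounded_linear f \<Longrightarrow> smooth_on S f"
  unfolding smooth_on_def by (simp add: Ck_on_bounded_linear)

lemma smooth_on_imp_differentiable: "smooth_on S f \<Longrightarrow> x \<in> S \<Longrightarrow> f differentiable (at x)"
  unfolding smooth_on_def by (metis Ck_on.simps(2))

lemma smooth_on_imp_continuous_on: "smooth_on S f \<Longrightarrow> continuous_on S f"
  unfolding smooth_on_def by (metis Ck_on.simps(1))

lemma smooth_on_pderiv: "smooth_on S f \<Longrightarrow> smooth_on S (pderiv_at i f)"
proof -
  assume "smooth_on S f"
  moreover have "axis i 1 \<in> (Basis :: (real^'a) set)" by (simp add: axis_in_Basis_iff)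
  ultimately show ?thesis
    unfolding smooth_on_def pderiv_at_def[abs_def] by (metis Ck_on.simps(2))
qed

lemma smooth_on_slice:
  "open S \<Longrightarrow> smooth_on S f \<Longrightarrow> smooth_on {y. (a, y) \<in> S} (\<lambda>y. f (a, y))"
  unfolding smooth_on_def by (metis Ck_on_slice)

lemma pderiv_at_cong:
  assumes "open S" "x \<in> S" "\<And>y. y \<in> S \<Longrightarrow> f y = g y"
  shows "pderiv_at i f x = pderiv_at i g x"
  using frechet_derivative_cong_open[OF assms] by (simp add: pderiv_at_def)

lemma pderiv_at_add:
  assumes "f differentiable (at x)" "g differentiable (at x)"
  shows "pderiv_at i (\<lambda>x. f x + g x) x = pderiv_at i f x + pderiv_at i g x"
proof -
  have "((\<lambda>x. f x + g x) has_derivative (\<lambda>h. frechet_derivative f (at x) h + frechet_derivative g (at x) h)) (at x)"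
    using assms by (intro has_derivative_add) (auto simp: frechet_derivative_works)
  from frechet_derivative_at[OF this] show ?thesis unfolding pderiv_at_def by metis
qed

lemma pderiv_at_mult:
  assumes "f differentiable (at x)" "g differentiable (at x)"
  shows "pderiv_at i (\<lambda>x. f x * g x) x = f x * pderiv_at i g x + pderiv_at i f x * g x"
  using frechet_derivative_mult_real[OF assms] by (simp add: pderiv_at_def)

lemma pderiv_at_const: "pderiv_at i (\<lambda>x. c) x = 0"
  by (simp add: pderiv_at_def)

lemma pderiv_at_cmult:
  assumes "f differentiable (at x)"
  shows "pderiv_at i (\<lambda>x. c * f x) x = c * pderiv_at i f x"
  using pderiv_at_mult[OF _ assms, of "\<lambda>x. c"] by (simp add: pderiv_at_const)

section \<open>Functions flat at zero, for cut-offs and convex compositions\<close>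

definition bump :: "nat \<Rightarrow> real \<Rightarrow> real" where
  "bump n t = (if t > 0 then inverse t ^ n * exp (- inverse t) else 0)"

lemma bump_tendsto_0: "(bump n \<longlongrightarrow> 0) (at 0)"
proof -
  have R: "(bump n \<longlongrightarrow> 0) (at_right 0)"
  proof (rule Lim_transform_eventually)
    have "((\<lambda>x::real. x ^ n / exp x) \<longlongrightarrow> 0) at_top" by (rule tendsto_power_div_exp_0)
    then show "((\<lambda>t::real. inverse t ^ n / exp (inverse t)) \<longlongrightarrow> 0) (at_right 0)"
      using filterlim_compose filterlim_inverse_at_top_right by blast
    show "\<forall>\<^sub>F t in at_right 0. inverse t ^ n / exp (inverse t) = bump n t"
      unfolding eventually_at_filter by (auto simp: bump_def exp_minus divide_simps)
  qed
  have "(bump n \<longlongrightarrow> 0) (at_left 0)"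
    by (rule Lim_transform_eventually[OF tendsto_const])
      (auto simp: eventually_at_filter bump_def)
  with R show ?thesis by (simp add: filterlim_split_at)
qed

text \<open>The powers of 1/t in front of exp(-1/t) make the family closed under differentiation up
  to linear combinations. This is what the induction for smoothness of \<open>bump n\<close>
  needs.\<close>

lemma bump_has_derivative:
  "(bump n has_real_derivative (bump (n+2) t - of_nat n * bump (n+1) t)) (at t)"
proof (cases t "0::real" rule: linorder_cases)
  case less
  have "((\<lambda>_. 0) has_real_derivative 0) (at t)" by simp
  then have "(bump n has_real_derivative 0) (at t)"
    by (rule has_field_derivative_transform_within_open[where S="{..<0}"])
      (use less in \<open>auto simp: bump_def\<close>)
  with less show ?thesis by (simp add: bump_def)
next
  case equal
  \<comment> \<open>Since \<open>bump n 0 = 0\<close>, the difference quotient at zero is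
    \<open>bump (Suc n)\<close>, which tends to 0.\<close>
  have "((\<lambda>h. (bump n h - bump n 0) / h) \<longlongrightarrow> 0) (at 0)"
    by (rule Lim_transform_eventually[OF bump_tendsto_0[of "Suc n"]])
      (auto simp: eventually_at_filter bump_def divide_simps)
  then show ?thesis
    using equal by (simp add: DERIV_def bump_def)
next
  case greater
  have "((\<lambda>t. inverse t ^ n * exp (- inverse t)) has_real_derivative
      (bump (n+2) t - of_nat n * bump (n+1) t)) (at t)"
    using greater
    apply (auto intro!: derivative_eq_intros simp: bump_def)
    apply (cases n)
     apply (auto simp: field_simps power2_eq_square)
    done
  then show ?thesis
    by (rule has_field_derivative_transform_within_open[where S="{0<..}"])
      (use greater in \<open>auto simp: bump_def\<close>)
qed

lemma Ck_on_bump: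
  assumes "open S" "smooth_on S f"
  shows "Ck_on k S (\<lambda>x. bump n (f x))"
proof (induction k arbitrary: n)
  case 0
  have "continuous_on UNIV (bump n)"
    by (intro continuous_at_imp_continuous_on ballI DERIV_isCont[OF bump_has_derivative])
  then show ?case
    using smooth_on_imp_continuous_on[OF assms(2)] by (auto intro: continuous_on_compose2)
next
  case (Suc k)
  note f = smooth_on_imp_differentiable[OF assms(2)]
  have "Ck_on k S (\<lambda>x. frechet_derivative (\<lambda>x. bump n (f x)) (at x) b)" if "b \<in> Basis" for b
  proof (rule Ck_on_cong[OF assms(1)])
    have "Ck_on (Suc k) S f" using assms(2) unfolding smooth_on_def by blast
    then show "Ck_on k S (\<lambda>x. (bump (n+2) (f x) + (- of_nat n) * bump (n+1) (f x)) * frechet_derivative f (at x) b)"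
      using that by (intro Ck_on_mult Ck_on_add assms(1) Suc.IH Ck_on_const) auto
  qed (use frechet_derivative_compose_real[OF f bump_has_derivative] in auto)
  then show ?case using frechet_derivative_compose_real(1)[OF f bump_has_derivative] by auto
qed

lemma smooth_on_bump: "open S \<Longrightarrow> smooth_on S f \<Longrightarrow> smooth_on S (\<lambda>x. bump n (f x))"
  using Ck_on_bump unfolding smooth_on_def by blast

lemma bump_pos_iff: "bump n t > 0 \<longleftrightarrow> t > 0"
  by (auto simp: bump_def)

lemma bump_nonneg: "bump n t \<ge> 0"
  by (auto simp: bump_def)

text \<open>The difference is the second derivative of \<open>bump 0\<close>, whose first derivative
  is \<open>bump 2\<close>. So exp(-1/t), extended by zero, is convex up to 1/2.\<close>

lemma bump_convex: "t \<le> 1/2 \<Longrightarrow> bump 4 t - 2 * bump 3 t \<ge> 0"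
proof (cases "t > 0")
  case True
  assume "t \<le> 1/2"
  with True have "inverse t \<ge> 2" by (simp add: field_simps)
  then have "inverse t ^ 3 * (inverse t - 2) * exp (- inverse t) \<ge> 0" using True by simp
  then show ?thesis using True by (simp add: bump_def algebra_simps eval_nat_numeral)
qed (auto simp: bump_def)

lemma smooth_on_norm_diff_squared: "smooth_on S (\<lambda>x::'a::euclidean_space. (norm (x - a))\<^sup>2)"
proof -
  have "smooth_on UNIV (\<lambda>x. \<Sum>b\<in>Basis. (x \<bullet> b - a \<bullet> b) * (x \<bullet> b - a \<bullet> b))"
    by (intro smooth_on_sum smooth_on_mult smooth_on_diff smooth_on_const
        smooth_on_bounded_linear bounded_linear_inner_left open_UNIV)
  moreover have "(\<lambda>x. \<Sum>b\<in>Basis. (x \<bullet> b - a \<bullet> b) * (x \<bullet> b - a \<bullet> b)) = (\<lambda>x. (norm (x - a))\<^sup>2)"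
    unfolding power2_norm_eq_inner
    by (subst euclidean_inner) (simp add: inner_diff_left)
  ultimately show ?thesis using smooth_on_subset by fastforce
qed

subsection \<open>The operator on smooth functions\<close>

text \<open>Component \<open>i\<close> of the vector field V A grad f; its divergence is
  \<open>V\<close> times the operator applied to \<open>f\<close>.\<close>

definition flux :: "(real^'n::finite \<Rightarrow> real) \<Rightarrow> (real^'n \<Rightarrow> real^'n^'n) \<Rightarrow> 'n \<Rightarrow>
    (real^'n \<Rightarrow> real) \<Rightarrow> real^'n \<Rightarrow> real" where
  "flux V A i f y = (\<Sum>j\<in>UNIV. V y * A y $ i $ j * pderiv_at j f y)"

lemma Lop_flux: "Lop V A f x = 1 / V x * (\<Sum>i\<in>UNIV. pderiv_at i (flux V A i f) x)"
  by (simp add: Lop_def flux_def[abs_def])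

lemma flux_cong:
  assumes "open S" "x \<in> S" "\<And>y. y \<in> S \<Longrightarrow> f y = g y"
  shows "flux V A i f x = flux V A i g x"
  unfolding flux_def using pderiv_at_cong[OF assms] by simp

lemma Lop_cong:
  assumes "open S" "x \<in> S" "\<And>y. y \<in> S \<Longrightarrow> f y = g y"
  shows "Lop V A f x = Lop V A g x"
  unfolding Lop_flux using pderiv_at_cong[OF assms(1,2) flux_cong[OF assms(1) _ assms(3)]] by simp

lemma Lop_const: "Lop V A (\<lambda>x. c) x = 0"
  unfolding Lop_def by (simp add: pderiv_at_const)

locale smooth_operator =
  fixes V :: "real^'n::finite \<Rightarrow> real" and A :: "real^'n \<Rightarrow> real^'n^'n"
  assumes H1: "H1 V A" and H2: "H2 A"
begin

lemma V_pos: "V x > 0" using H1 by (auto simp: H1_def)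

lemma V_smooth: "smooth_on S V"
  using H1 smooth_on_subset unfolding H1_def by blast

lemma A_smooth: "smooth_on S (\<lambda>x. A x $ i $ j)"
  using H1 smooth_on_subset unfolding H1_def by blast

lemma A_sym: "A x $ i $ j = A x $ j $ i"
  using H2 unfolding H2_def transpose_def by (metis vec_lambda_beta)

lemma smooth_on_flux:
  assumes "open S" "smooth_on S f" shows "smooth_on S (flux V A i f)"
  unfolding flux_def[abs_def]
  by (intro smooth_on_sum smooth_on_mult smooth_on_pderiv V_smooth A_smooth assms)

lemma continuous_on_V_Lop:
  assumes "open S" "smooth_on S f" shows "continuous_on S (\<lambda>x. V x * Lop V A f x)"
proof -
  have "smooth_on S (\<lambda>x. \<Sum>i\<in>UNIV. pderiv_at i (flux V A i f) x)"
    by (intro smooth_on_sum smooth_on_pderiv smooth_on_flux assms)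
  moreover have "V x * Lop V A f x = (\<Sum>i\<in>UNIV. pderiv_at i (flux V A i f) x)" for x
    using V_pos[of x] by (simp add: Lop_flux)
  ultimately show ?thesis by (simp add: smooth_on_imp_continuous_on)
qed

lemma flux_add:
  assumes "open S" "smooth_on S f" "smooth_on S g" "x \<in> S"
  shows "flux V A i (\<lambda>x. f x + g x) x = flux V A i f x + flux V A i g x"
  unfolding flux_def
  by (simp add: pderiv_at_add smooth_on_imp_differentiable[OF _ assms(4)] assms sum.distrib distrib_left)

lemma flux_cmult:
  assumes "open S" "smooth_on S f" "x \<in> S"
  shows "flux V A i (\<lambda>x. c * f x) x = c * flux V A i f x"
  unfolding flux_def
  by (simp add: pderiv_at_cmult smooth_on_imp_differentiable[OF _ assms(3)] assms sum_distrib_left mult_ac)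

lemma harmonic_on_const: "harmonic_on V A W (\<lambda>x. c)"
  by (simp add: harmonic_on_def smooth_on_const Lop_const)

lemma harmonic_on_subset: "harmonic_on V A W f \<Longrightarrow> W' \<subseteq> W \<Longrightarrow> harmonic_on V A W' f"
  by (auto simp: harmonic_on_def smooth_on_subset)

lemma harmonic_on_add:
  assumes "open W" "harmonic_on V A W f" "harmonic_on V A W g"
  shows "harmonic_on V A W (\<lambda>x. f x + g x)"
proof -
  have s: "smooth_on W f" "smooth_on W g" using assms by (auto simp: harmonic_on_def)
  have "Lop V A (\<lambda>x. f x + g x) x = Lop V A f x + Lop V A g x" if "x \<in> W" for x
  proof -
    have "pderiv_at i (flux V A i (\<lambda>x. f x + g x)) x =
        pderiv_at i (flux V A i f) x + pderiv_at i (flux V A i g) x" for i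
      using pderiv_at_cong[OF assms(1) that flux_add[OF assms(1) s]]
        smooth_on_imp_differentiable[OF smooth_on_flux[OF assms(1)] that] s
      by (subst pderiv_at_add[symmetric]) auto
    then show ?thesis by (simp add: Lop_flux sum.distrib add_divide_distrib)
  qed
  then show ?thesis using assms smooth_on_add by (auto simp: harmonic_on_def)
qed

lemma harmonic_on_cmult:
  assumes "open W" "harmonic_on V A W f"
  shows "harmonic_on V A W (\<lambda>x. c * f x)"
proof -
  have s: "smooth_on W f" using assms by (auto simp: harmonic_on_def)
  have "Lop V A (\<lambda>x. c * f x) x = c * Lop V A f x" if "x \<in> W" for x
  proof -
    have "pderiv_at i (flux V A i (\<lambda>x. c * f x)) x = c * pderiv_at i (flux V A i f) x" for i
      using pderiv_at_cong[OF assms(1) that flux_cmult[OF assms(1) s]]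
        smooth_on_imp_differentiable[OF smooth_on_flux[OF assms(1) s] that]
      by (subst pderiv_at_cmult[symmetric]) auto
    then show ?thesis by (simp add: Lop_flux flip: sum_distrib_left)
  qed
  then show ?thesis using assms smooth_on_cmult by (auto simp: harmonic_on_def)
qed

lemma harmonic_on_sum:
  assumes "open W" "\<And>i. i \<in> I \<Longrightarrow> harmonic_on V A W (f i)"
  shows "harmonic_on V A W (\<lambda>x. \<Sum>i\<in>I. f i x)"
  using assms(2)
  by (induction I rule: infinite_finite_induct) (auto simp: harmonic_on_const harmonic_on_add assms(1))

text \<open>The product rule leaves two terms pairing the gradients of \<open>f\<close> and
  \<open>g\<close> through \<open>V A\<close>; they cancel because \<open>A\<close> is
  symmetric.\<close>

lemma Green_identity:
  assumes "open S" "smooth_on S f" "smooth_on S g" "x \<in> S"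
  shows "(\<Sum>i\<in>UNIV. pderiv_at i (\<lambda>y. g y * flux V A i f y + (- 1) * (f y * flux V A i g y)) x) =
    V x * (g x * Lop V A f x - f x * Lop V A g x)"
proof -
  note d = smooth_on_imp_differentiable[OF _ assms(4)]
  have "pderiv_at i (\<lambda>y. g y * flux V A i f y + (- 1) * (f y * flux V A i g y)) x =
      (g x * pderiv_at i (flux V A i f) x + pderiv_at i g x * flux V A i f x)
      + (-1) * (f x * pderiv_at i (flux V A i g) x + pderiv_at i f x * flux V A i g x)" for i
  proof -
    have 1: "smooth_on S (flux V A i f)" "smooth_on S (flux V A i g)"
      using assms smooth_on_flux by auto
    have 2: "smooth_on S (\<lambda>y. g y * flux V A i f y)" "smooth_on S (\<lambda>y. f y * flux V A i g y)"
      using assms smooth_on_mult 1 by auto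
    show ?thesis
      using pderiv_at_add[OF d[OF 2(1)] d[OF smooth_on_cmult[OF assms(1) 2(2)]], of i "-1"]
        pderiv_at_cmult[OF d[OF 2(2)], of i "-1"]
        pderiv_at_mult[OF d[OF assms(3)] d[OF 1(1)], of i]
        pderiv_at_mult[OF d[OF assms(2)] d[OF 1(2)], of i] by argo
  qed
  note P = this
  have "(\<Sum>i\<in>UNIV. pderiv_at i (\<lambda>y. g y * flux V A i f y + (- 1) * (f y * flux V A i g y)) x) =
      V x * (g x * Lop V A f x - f x * Lop V A g x)
      + (\<Sum>i\<in>UNIV. pderiv_at i g x * flux V A i f x) - (\<Sum>i\<in>UNIV. pderiv_at i f x * flux V A i g x)"
    unfolding P using V_pos[of x] by (simp add: Lop_flux sum.distrib sum_subtractf sum_distrib_left algebra_simps)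
  also have "(\<Sum>i\<in>UNIV. pderiv_at i g x * flux V A i f x) = (\<Sum>i\<in>UNIV. pderiv_at i f x * flux V A i g x)"
    unfolding flux_def sum_distrib_left
    by (subst sum.swap) (auto intro!: sum.cong simp: A_sym)
  finally show ?thesis by simp
qed

text \<open>With \<open>f = bump 0\<close>, L(f(w)) = f'(w) L w + f''(w) (A grad w, grad w). The
  first term vanishes, and the second is nonnegative by convexity of \<open>f\<close> and
  semi-definiteness of \<open>A\<close>.\<close>

lemma Lop_bump_nonneg:
  assumes "open S" "smooth_on S w" "x \<in> S" "Lop V A w x = 0" "w x \<le> 1/2"
  shows "Lop V A (\<lambda>x. bump 0 (w x)) x \<ge> 0"
proof -
  note dw = smooth_on_imp_differentiable[OF assms(2)]
  have p: "pderiv_at j (\<lambda>x. bump n (w x)) y =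
      (bump (n+2) (w y) - of_nat n * bump (n+1) (w y)) * pderiv_at j w y" if "y \<in> S" for n j y
    unfolding pderiv_at_def
    using frechet_derivative_compose_real(2)[OF dw[OF that] bump_has_derivative] .
  have fl: "flux V A i (\<lambda>x. bump 0 (w x)) y = bump 2 (w y) * flux V A i w y" if "y \<in> S" for i y
    unfolding flux_def p[OF that] by (simp add: sum_distrib_left mult_ac numeral_2_eq_2)
  have "pderiv_at i (flux V A i (\<lambda>x. bump 0 (w x))) x =
      bump 2 (w x) * pderiv_at i (flux V A i w) x
      + (bump 4 (w x) - 2 * bump 3 (w x)) * (pderiv_at i w x * flux V A i w x)" for i
    using pderiv_at_cong[OF assms(1,3) fl]
    by (simp add: pderiv_at_mult p assms(3) smooth_on_imp_differentiable[OF _ assms(3)]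
        smooth_on_bump smooth_on_flux assms(1,2))
  then have "V x * Lop V A (\<lambda>x. bump 0 (w x)) x =
      bump 2 (w x) * (V x * Lop V A w x)
      + (bump 4 (w x) - 2 * bump 3 (w x)) * (\<Sum>i\<in>UNIV. pderiv_at i w x * flux V A i w x)"
    using V_pos[of x] by (simp add: Lop_flux sum.distrib sum_distrib_left)
  moreover have "(\<Sum>i\<in>UNIV. pderiv_at i w x * flux V A i w x) \<ge> 0"
  proof -
    define v where "v = (\<chi> i. pderiv_at i w x)"
    have "(\<Sum>i\<in>UNIV. pderiv_at i w x * flux V A i w x) = V x * (v \<bullet> (A x *v v))"
      unfolding flux_def inner_vec_def matrix_vector_mult_def v_def
      by (simp add: sum_distrib_left mult_ac)
    then show ?thesis using H2 V_pos[of x] by (simp add: H2_def)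
  qed
  ultimately have "V x * Lop V A (\<lambda>x. bump 0 (w x)) x \<ge> 0"
    using assms(4) bump_convex[OF assms(5)] by simp
  then show ?thesis using V_pos[of x] by (simp add: zero_le_mult_iff)
qed

end

subsection \<open>Integration against test functions\<close>

lemma integrable_continuous_compact_support:
  fixes f :: "'a::euclidean_space \<Rightarrow> real"
  assumes "continuous_on UNIV f" "compact K" "\<And>x. x \<notin> K \<Longrightarrow> f x = 0"
  shows "integrable lborel f"
proof -
  have "integrable lborel (\<lambda>x. indicator K x *\<^sub>R f x)"
    using assms by (intro borel_integrable_compact) (auto intro: continuous_on_subset)
  moreover have "(\<lambda>x. indicator K x *\<^sub>R f x) = f" using assms(3) by (force simp: indicator_def fun_eq_iff)
  ultimately show ?thesis by simp
qed

text \<open>By translation invariance every difference quotient has integral zero, and dominated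
  convergence passes to the derivative. This removes the divergence when the Green identity is
  integrated.\<close>

lemma integral_pderiv_eq_0:
  fixes f :: "real^'n::finite \<Rightarrow> real"
  assumes f: "smooth_on UNIV f" and K: "compact K" "\<And>x. x \<notin> K \<Longrightarrow> f x = 0"
  shows "integrable lborel (pderiv_at i f)" "(LINT x|lborel. pderiv_at i f x) = 0"
proof -
  define e :: "real^'n" where "e = axis i 1"
  have ne: "norm e = 1" by (simp add: e_def)
  have g0: "pderiv_at i f x = 0" if "x \<notin> K" for x
    using pderiv_at_cong[of "- K" x f "\<lambda>_. 0"] that K compact_imp_closed[OF K(1)]
    by (auto simp: pderiv_at_const)
  have gc: "continuous_on UNIV (pderiv_at i f)"
    using f smooth_on_pderiv smooth_on_imp_continuous_on by blast
  show gi: "integrable lborel (pderiv_at i f)"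
    using integrable_continuous_compact_support[OF gc K(1) g0] .
  have fc: "continuous_on UNIV f" using f smooth_on_imp_continuous_on by blast
  have fi: "integrable lborel f" using integrable_continuous_compact_support[OF fc K] .
  obtain B where B: "\<And>x. \<bar>pderiv_at i f x\<bar> \<le> B"
  proof -
    have "bounded (pderiv_at i f ` K)"
      using gc K(1) by (meson compact_continuous_image compact_imp_bounded continuous_on_subset subset_UNIV)
    then obtain B where "\<And>x. x \<in> K \<Longrightarrow> \<bar>pderiv_at i f x\<bar> \<le> B" by (auto simp: bounded_iff)
    then have "\<bar>pderiv_at i f x\<bar> \<le> max B 0" for x using g0[of x] by (cases "x \<in> K") force+
    then show thesis using that by blast
  qed
  obtain R where R: "K \<subseteq> cball 0 R"
    using compact_imp_bounded[OF K(1)] by (auto simp: bounded_iff subset_iff)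
  have der: "((\<lambda>t. f (x + t *\<^sub>R e)) has_real_derivative pderiv_at i f (x + t *\<^sub>R e)) (at t)" for x t
  proof -
    have "(f has_derivative frechet_derivative f (at (x + t *\<^sub>R e))) (at (x + t *\<^sub>R e))"
      using f smooth_on_imp_differentiable by (auto simp: frechet_derivative_works)
    moreover have "((\<lambda>t. x + t *\<^sub>R e) has_derivative (\<lambda>h. h *\<^sub>R e)) (at t)"
      by (auto intro!: derivative_eq_intros)
    ultimately have "((\<lambda>t. f (x + t *\<^sub>R e)) has_derivative
        (\<lambda>h. frechet_derivative f (at (x + t *\<^sub>R e)) (h *\<^sub>R e))) (at t)"
      using has_derivative_compose by fastforce
    moreover have "frechet_derivative f (at (x + t *\<^sub>R e)) (h *\<^sub>R e) = pderiv_at i f (x + t *\<^sub>R e) * h" for h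
      using linear_frechet_derivative[OF smooth_on_imp_differentiable[OF f]]
      by (simp add: linear_cmul pderiv_at_def e_def)
    ultimately show ?thesis by (simp add: has_field_derivative_def)
  qed
  \<comment> \<open>Steps of length at most 1 keep the supports of all quotients in
    \<open>cball 0 (R+1)\<close>; with the mean value theorem this gives one integrable
    majorant.\<close>
  define h where "h n = 1 / real (Suc n)" for n
  have h: "h n > 0" "h n \<le> 1" for n by (auto simp: h_def)
  define D where "D n x = (f (x + h n *\<^sub>R e) - f x) / h n" for n x
  have trans: "(LINT x|lborel. f (x + c)) = (LINT x|lborel. f x)"
    and transi: "integrable lborel (\<lambda>x. f (x + c))" for c
  proof -
    have [measurable]: "f \<in> borel_measurable borel"
      using fc by (rule borel_measurable_continuous_onI)
    have "(LINT x|lborel. f x) = (LINT x|distr lborel borel ((+) c). f x)" by (simp add: lborel_distr_plus)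
    also have "\<dots> = (LINT x|lborel. f (x + c))" by (subst integral_distr) (auto simp: add.commute)
    finally show "(LINT x|lborel. f (x + c)) = (LINT x|lborel. f x)" ..
    have "integrable (distr lborel borel ((+) c)) f" using fi by (simp add: lborel_distr_plus)
    then show "integrable lborel (\<lambda>x. f (x + c))" by (subst (asm) integrable_distr_eq) (auto simp: add.commute)
  qed
  have D0: "(LINT x|lborel. D n x) = 0" for n
    unfolding D_def using fi transi by (simp add: trans)
  have "(\<lambda>n. LINT x|lborel. D n x) \<longlonglongrightarrow> (LINT x|lborel. pderiv_at i f x)"
  proof (rule integral_dominated_convergence)
    show "pderiv_at i f \<in> borel_measurable lborel" using gi by simp
    show "D n \<in> borel_measurable lborel" for n
      unfolding D_def using fi transi by (auto intro!: borel_measurable_divide borel_measurable_diff)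
    have "integrable lborel (\<lambda>x. indicator (cball 0 (R+1)) x *\<^sub>R B)"
      by (intro borel_integrable_compact) auto
    then show "integrable lborel (\<lambda>x. B * indicator (cball 0 (R+1)) x :: real)" by (simp add: mult.commute)
    show "AE x in lborel. (\<lambda>n. D n x) \<longlonglongrightarrow> pderiv_at i f x"
    proof (intro AE_I2)
      fix x
      have "((\<lambda>u. (f (x + u *\<^sub>R e) - f x) / u) \<longlongrightarrow> pderiv_at i f x) (at 0)"
        using der[of x 0] by (simp add: DERIV_def)
      moreover have "filterlim h (at 0) sequentially"
        unfolding h_def filterlim_at using LIMSEQ_inverse_real_of_nat by (auto simp: inverse_eq_divide)
      ultimately show "(\<lambda>n. D n x) \<longlonglongrightarrow> pderiv_at i f x"
        unfolding D_def by (rule filterlim_compose)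
    qed
    show "AE x in lborel. norm (D n x) \<le> B * indicator (cball 0 (R+1)) x" for n
    proof (intro AE_I2)
      fix x
      show "norm (D n x) \<le> B * indicator (cball 0 (R+1)) x"
      proof (cases "x \<in> cball 0 (R+1)")
        case True
        obtain t where "f (x + h n *\<^sub>R e) - f (x + 0 *\<^sub>R e) = (h n - 0) * pderiv_at i f (x + t *\<^sub>R e)"
          using MVT2[OF h(1)[of n], of "\<lambda>t. f (x + t *\<^sub>R e)" "\<lambda>t. pderiv_at i f (x + t *\<^sub>R e)", OF der]
          by blast
        then have "D n x = pderiv_at i f (x + t *\<^sub>R e)" unfolding D_def using h[of n] by simp
        then show ?thesis using B True by simp
      next
        case False
        have "norm x \<le> norm (x + h n *\<^sub>R e) + h n"
          using norm_triangle_ineq4[of "x + h n *\<^sub>R e" "h n *\<^sub>R e"] h[of n] by (simp add: ne)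
        then have "x \<notin> K" "x + h n *\<^sub>R e \<notin> K" using False R h[of n] by force+
        then show ?thesis using K(2) False by (simp add: D_def)
      qed
    qed
  qed
  then show "(LINT x|lborel. pderiv_at i f x) = 0"
    unfolding D0 by (simp add: LIMSEQ_const_iff)
qed

lemma bump_ball_test:
  fixes a :: "real^'n::finite"
  assumes "r > 0"
  defines "\<phi> \<equiv> \<lambda>x. bump 0 (r\<^sup>2 - (norm (x - a))\<^sup>2)"
  shows "smooth_on UNIV \<phi>" "\<And>x. \<phi> x \<ge> 0" "\<phi> x > 0 \<longleftrightarrow> x \<in> ball a r"
    "closure {x. \<phi> x \<noteq> 0} \<subseteq> cball a r"
proof -
  show "smooth_on UNIV \<phi>" unfolding \<phi>_def
    by (intro smooth_on_bump smooth_on_diff smooth_on_const smooth_on_norm_diff_squared open_UNIV)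
  show p: "\<phi> x \<ge> 0" for x by (simp add: \<phi>_def bump_nonneg)
  have *: "\<phi> x > 0 \<longleftrightarrow> x \<in> ball a r" for x
    using assms(1) power_strict_mono[of "norm (x-a)" r 2] power2_less_imp_less[of "norm (x-a)" r]
    by (auto simp: \<phi>_def bump_pos_iff dist_norm norm_minus_commute)
  then show "\<phi> x > 0 \<longleftrightarrow> x \<in> ball a r" .
  have "{x. \<phi> x \<noteq> 0} \<subseteq> cball a r" using * p by (auto simp: less_le)
  then show "closure {x. \<phi> x \<noteq> 0} \<subseteq> cball a r" by (intro closure_minimal) auto
qed

section \<open>The fundamental solution and its harmonicity off the pole\<close>

locale fundamental_solution = smooth_operator V A
  for V :: "real^'n::finite \<Rightarrow> real" and A :: "real^'n \<Rightarrow> real^'n^'n" +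
  fixes \<Gamma> :: "real^'n \<Rightarrow> real^'n \<Rightarrow> real"
  assumes FS: "FS V A \<Gamma>"
begin

lemma Gamma_pos: "x \<noteq> y \<Longrightarrow> \<Gamma> x y > 0"
  using FS unfolding FS_def by blast

lemma Gamma_sym: "x \<noteq> y \<Longrightarrow> \<Gamma> x y = \<Gamma> y x"
  using FS unfolding FS_def by blast

lemma open_off_diagonal: "open {p::(real^'n) \<times> (real^'n). fst p \<noteq> snd p}"
  by (intro open_Collect_neq continuous_intros)

lemma Gamma_smooth: "smooth_on (- {x}) (\<Gamma> x)"
proof -
  have "smooth_on {p. fst p \<noteq> snd p} (\<lambda>p. \<Gamma> (fst p) (snd p))"
    using FS unfolding FS_def by blast
  from smooth_on_slice[OF open_off_diagonal this, of x]
  have "smooth_on {y. x \<noteq> y} (\<Gamma> x)" by simp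
  then show ?thesis by (rule smooth_on_subset) auto
qed

lemma representation_formula:
  "\<phi> \<in> test_functions UNIV \<Longrightarrow> (LINT y|lborel. \<Gamma> x y * Lop V A \<phi> y * V y) = - \<phi> x"
  using FS unfolding FS_def by blast

lemma test_functionI:
  assumes "smooth_on UNIV \<phi>" "compact K" "\<And>x. x \<notin> K \<Longrightarrow> \<phi> x = 0"
  shows "\<phi> \<in> test_functions UNIV"
proof -
  have "closure {x. \<phi> x \<noteq> 0} \<subseteq> K"
    using assms by (intro closure_minimal compact_imp_closed) auto
  then show ?thesis
    using assms unfolding test_functions_def
    by (auto intro: bounded_subset[OF compact_imp_bounded] dest: subset_trans[OF closure_subset])
qed

lemma Lop_eq_0_off:
  assumes "closed K" "\<And>x. x \<notin> K \<Longrightarrow> \<phi> x = 0" "x \<notin> K"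
  shows "Lop V A \<phi> x = 0" "flux V A i \<phi> x = 0"
  using Lop_cong[OF open_Compl[OF assms(1)], of x \<phi> "\<lambda>_. 0" V A]
    flux_cong[OF open_Compl[OF assms(1)], of x \<phi> "\<lambda>_. 0" V A i] assms(2,3)
  by (simp_all add: Lop_const, simp add: flux_def pderiv_at_const)

text \<open>The representation formula has value zero here because \<phi> vanishes at the pole
  \<open>x\<close>. The Green identity moves the operator from \<phi> onto
  \<open>\<Gamma> x\<close>, so \<open>\<Gamma> x\<close> solves the equation weakly off its
  pole.\<close>

lemma integral_Lop_Gamma:
  assumes r: "cball a r \<subseteq> - {x}" and \<phi>: "smooth_on UNIV \<phi>" "\<And>y. y \<notin> cball a r \<Longrightarrow> \<phi> y = 0"
  shows "integrable lborel (\<lambda>y. \<phi> y * (V y * Lop V A (\<Gamma> x) y))"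
    "(LINT y|lborel. \<phi> y * (V y * Lop V A (\<Gamma> x) y)) = 0"
proof -
  let ?K = "cball a r" and ?q = "\<lambda>y. V y * Lop V A (\<Gamma> x) y"
  define \<psi> where "\<psi> i y = \<Gamma> x y * flux V A i \<phi> y + (- 1) * (\<phi> y * flux V A i (\<Gamma> x) y)" for i y
  have UN: "- {x} \<union> - ?K = UNIV" using r by auto
  have op: "open (- {x})" "open (- ?K)" by auto
  have \<phi>': "smooth_on (- {x}) \<phi>" using \<phi>(1) smooth_on_subset by blast
  have \<psi>0: "\<psi> i y = 0" if "y \<notin> ?K" for i y
    using Lop_eq_0_off(2)[OF closed_cball \<phi>(2) that] \<phi>(2)[OF that] by (simp add: \<psi>_def)
  have \<psi>s: "smooth_on UNIV (\<psi> i)" for i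
  proof -
    have "smooth_on (- {x}) (\<psi> i)" unfolding \<psi>_def[abs_def]
      by (intro smooth_on_add smooth_on_mult smooth_on_flux smooth_on_const Gamma_smooth op \<phi>')
    moreover have "smooth_on (- ?K) (\<psi> i)"
      by (rule smooth_on_cong[OF op(2) smooth_on_const[of _ 0]]) (use \<psi>0 in auto)
    ultimately show ?thesis using smooth_on_Un[OF op] UN by metis
  qed
  have qc: "continuous_on UNIV (\<lambda>y. \<phi> y * ?q y)"
  proof -
    have "continuous_on (- {x}) (\<lambda>y. \<phi> y * ?q y)"
      by (intro continuous_on_mult smooth_on_imp_continuous_on[OF \<phi>'] continuous_on_V_Lop op Gamma_smooth)
    moreover have "continuous_on (- ?K) (\<lambda>y. \<phi> y * ?q y)"
      by (rule continuous_on_eq[OF continuous_on_const[of _ 0]]) (use \<phi>(2) in auto)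
    ultimately show ?thesis using continuous_on_open_Un[OF op] UN by metis
  qed
  show I: "integrable lborel (\<lambda>y. \<phi> y * ?q y)"
    by (rule integrable_continuous_compact_support[OF qc compact_cball]) (use \<phi>(2) in auto)
  \<comment> \<open>At \<open>y = x\<close> the value of \<Gamma> is arbitrary, but all terms vanish
    because the pole lies outside the support of \<phi>.\<close>
  have eq: "\<Gamma> x y * Lop V A \<phi> y * V y = (\<Sum>i\<in>UNIV. pderiv_at i (\<psi> i) y) + \<phi> y * ?q y" for y
  proof (cases "y = x")
    case True
    then have "y \<notin> ?K" using r by auto
    moreover have "pderiv_at i (\<psi> i) y = 0" for i
      using pderiv_at_cong[OF op(2), of y "\<psi> i" "\<lambda>_. 0"] \<psi>0 \<open>y \<notin> ?K\<close> by (simp add: pderiv_at_const)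
    ultimately show ?thesis
      using Lop_eq_0_off(1)[OF closed_cball \<phi>(2) \<open>y \<notin> ?K\<close>] \<phi>(2) by simp
  next
    case False
    then have "y \<in> - {x}" by simp
    from Green_identity[OF op(1) \<phi>' Gamma_smooth this] show ?thesis
      unfolding \<psi>_def[abs_def] by (simp add: algebra_simps)
  qed
  have "- \<phi> x = (LINT y|lborel. \<Gamma> x y * Lop V A \<phi> y * V y)"
    using representation_formula[OF test_functionI[OF \<phi>(1) compact_cball \<phi>(2)]] by simp
  also have "\<dots> = (LINT y|lborel. \<phi> y * ?q y)"
    unfolding eq using integral_pderiv_eq_0[OF \<psi>s compact_cball \<psi>0] I
    by (subst Bochner_Integration.integral_add) (auto simp: Bochner_Integration.integral_sum)
  finally show "(LINT y|lborel. \<phi> y * ?q y) = 0" using \<phi>(2)[of x] r by auto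
qed

text \<open>Fundamental lemma of the calculus of variations: the weak equation is tested with a
  cut-off on a ball where the continuous function \<open>?q\<close> keeps its sign.\<close>

lemma Gamma_harmonic: "harmonic_on V A (- {x}) (\<Gamma> x)"
proof -
  let ?q = "\<lambda>y. V y * Lop V A (\<Gamma> x) y"
  have "?q y = 0" if y: "y \<in> - {x}" for y
  proof (rule ccontr)
    assume q: "?q y \<noteq> 0"
    \<comment> \<open>The constant factor \<open>?q y\<close> treats both signs of \<open>?q\<close>
      at once.\<close>
    have "continuous_on (- {x}) (\<lambda>z. ?q z * ?q y)"
      by (intro continuous_on_mult continuous_on_const continuous_on_V_Lop Gamma_smooth) auto
    then have "open {z \<in> - {x}. 0 < ?q z * ?q y}"
      using continuous_open_preimage[of "- {x}" _ "{0<..}"] by (force simp: vimage_def Int_def)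
    moreover have "y \<in> {z \<in> - {x}. 0 < ?q z * ?q y}" using y q by (simp only: mem_Collect_eq simp_thms) (metis not_real_square_gt_zero)
    ultimately obtain r where r: "r > 0" "cball y r \<subseteq> {z \<in> - {x}. 0 < ?q z * ?q y}"
      by (meson open_contains_cball)
    have rp: "0 < ?q z * ?q y" if "z \<in> cball y r" for z using r(2) that by blast
    define \<phi> where "\<phi> z = bump 0 (r\<^sup>2 - (norm (z - y))\<^sup>2)" for z
    note bt = bump_ball_test[OF r(1), where a=y, folded \<phi>_def]
    have \<phi>0: "\<phi> z = 0" if "z \<notin> cball y r" for z
      using subsetD[OF subset_trans[OF closure_subset bt(4)], of z] that by auto
    have sub: "cball y r \<subseteq> - {x}" using r by blast
    have I: "integrable lborel (\<lambda>z. \<phi> z * ?q z * ?q y)" "(LINT z|lborel. \<phi> z * ?q z * ?q y) = 0"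
      using integral_Lop_Gamma[OF sub bt(1) \<phi>0] by simp_all
    have nn: "\<phi> z * ?q z * ?q y \<ge> 0" for z
    proof (cases "z \<in> cball y r")
      case True
      then show ?thesis using mult_nonneg_nonneg[OF bt(2)[of z] less_imp_le[OF rp[OF True]]]
        by (simp only: mult.assoc)
    qed (simp add: \<phi>0)
    have "AE z in lborel. \<phi> z * ?q z * ?q y = 0"
      using integral_nonneg_eq_0_iff_AE[OF I(1)] I(2) nn by simp
    then have "AE z in lborel. z \<notin> ball y r"
    proof eventually_elim
      case (elim z)
      show ?case
      proof
        assume z: "z \<in> ball y r"
        then have "\<phi> z * (?q z * ?q y) > 0"
          using bt(3)[of z] rp[of z] ball_subset_cball[of y r] by (metis mult_pos_pos subsetD)
        then show False using elim by (simp only: mult.assoc)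
      qed
    qed
    then have "ball y r \<in> null_sets lborel"
      by (subst AE_iff_null_sets) auto
    then have "negligible (ball y r)"
      by (simp add: negligible_iff_null_sets null_sets_completionI)
    then show False using open_not_negligible[of "ball y r"] r(1) by auto
  qed
  then show ?thesis
    using Gamma_smooth V_pos unfolding harmonic_on_def by (metis less_irrefl mult_eq_0_iff)
qed

subsection \<open>The weak maximum principle\<close>

text \<open>If \<open>w z\<close> were positive, a convex function of \<open>w\<close> would give a
  test function, positive at \<open>z\<close>, on which the operator is nonnegative. The
  representation formula forces the opposite sign at \<open>z\<close>.\<close>

lemma weak_maximum_principle:
  assumes W: "open W" "bounded W" and w: "harmonic_on V A W w" "continuous_on (closure W) w"
    and bd: "\<And>x. x \<in> frontier W \<Longrightarrow> w x \<le> 0" and z: "z \<in> W"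
  shows "w z \<le> 0"
proof (rule ccontr)
  assume "\<not> w z \<le> 0"
  then have m: "w z > 0" by simp
  have cW: "compact (closure W)" using W by (simp add: compact_closure)
  obtain B where B: "\<And>x. x \<in> closure W \<Longrightarrow> w x \<le> B"
    using continuous_attains_sup[OF cW _ w(2)] z closure_subset by (metis empty_iff subsetD)
  have Bp: "B > 0" using B[of z] z closure_subset m by fastforce
  \<comment> \<open>The shift makes \<open>u\<close> negative on the frontier but positive at
    \<open>z\<close>; the scaling keeps \<open>u\<close> in the range up to 1/2 where
    \<open>bump 0\<close> is convex.\<close>
  define u where "u x = 1 / (2 * B) * (w x + (- w z / 2))" for x
  have u: "harmonic_on V A W u" unfolding u_def[abs_def]
    by (intro harmonic_on_cmult harmonic_on_add harmonic_on_const W w)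
  have us: "smooth_on W u" using u by (simp add: harmonic_on_def)
  have uc: "continuous_on (closure W) u" unfolding u_def[abs_def] by (intro continuous_intros w)
  have ub: "u x \<le> 1/2" if "x \<in> closure W" for x
    using B[OF that] Bp m by (simp add: u_def field_simps)
  have uf: "u x < 0" if "x \<in> frontier W" for x
    using bd[OF that] Bp m by (simp add: u_def field_simps)
  have uz: "u z > 0" using Bp m by (simp add: u_def)
  \<comment> \<open>This compact set stays inside \<open>W\<close> and contains the support of
    \<phi>. Hence \<open>W\<close> and \<open>- K\<close> cover the space, and the extension by zero
    is smooth.\<close>
  define K where "K = {x \<in> closure W. u x \<ge> 0}"
  have "closed K" unfolding K_def
    using continuous_closed_preimage[OF uc closed_closure, of "{0..}"] by (auto simp: vimage_def Int_def)
  then have K: "compact K" using cW K_def by (metis (no_types, lifting) compact_Int_closed inf.absorb_iff2 mem_Collect_eq subsetI)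
  have KW: "K \<subseteq> W" unfolding K_def using uf W(1) by (fastforce simp: frontier_def interior_open)
  define \<phi> where "\<phi> x = (if x \<in> W then bump 0 (u x) else 0)" for x
  have \<phi>0: "\<phi> x = 0" if "x \<notin> K" for x
    using that closure_subset by (fastforce simp: K_def \<phi>_def bump_def)
  have "smooth_on W \<phi>"
    by (rule smooth_on_cong[OF W(1) smooth_on_bump[OF W(1) us, of 0]]) (simp add: \<phi>_def)
  moreover have "smooth_on (- K) \<phi>"
    using \<open>closed K\<close> by (intro smooth_on_cong[OF _ smooth_on_const[of _ 0]]) (auto simp: \<phi>0)
  ultimately have "smooth_on (W \<union> - K) \<phi>"
    using W(1) \<open>closed K\<close> by (intro smooth_on_Un) auto
  moreover have "W \<union> - K = UNIV" using KW by auto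
  ultimately have \<phi>t: "\<phi> \<in> test_functions UNIV" using test_functionI[OF _ K \<phi>0] by simp
  have L: "Lop V A \<phi> x \<ge> 0" for x
  proof (cases "x \<in> W")
    case True
    have "Lop V A \<phi> x = Lop V A (\<lambda>x. bump 0 (u x)) x"
      by (rule Lop_cong[OF W(1) True]) (simp add: \<phi>_def)
    also have "\<dots> \<ge> 0"
      using u ub True closure_subset by (intro Lop_bump_nonneg[OF W(1) us True]) (auto simp: harmonic_on_def)
    finally show ?thesis .
  next
    case False
    then show ?thesis using Lop_eq_0_off(1)[of K \<phi> x, OF \<open>closed K\<close> \<phi>0] KW by force
  qed
  have "(LINT y|lborel. \<Gamma> z y * Lop V A \<phi> y * V y) \<ge> 0"
  proof (rule integral_nonneg_AE)
    \<comment> \<open>The diagonal is left out because \<open>\<Gamma> z z\<close> has no prescribed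
      sign.\<close>
    have "AE y in lborel. y \<noteq> z" by (rule AE_lborel_singleton)
    then show "AE y in lborel. 0 \<le> \<Gamma> z y * Lop V A \<phi> y * V y"
    proof eventually_elim
      case (elim y)
      then show ?case using Gamma_pos[of z y] L[of y] V_pos[of y] by auto
    qed
  qed
  moreover have "\<phi> z > 0" using z uz by (simp add: \<phi>_def bump_pos_iff)
  ultimately show False using representation_formula[OF \<phi>t, of z] by simp
qed

end

subsection \<open>Maximum principle sets and large sets\<close>

text \<open>Inserting a real number between \<open>u x\<close> and \<open>c + h x\<close> writes the
  sublevel set as a union of intersections of open sets, one for \<open>u\<close> and one for
  \<open>h\<close>.\<close>

lemma usc_minus_continuous:
  fixes u :: "'a::topological_space \<Rightarrow> ereal"
  assumes u: "\<And>c. open {x. u x < c}" and h: "continuous_on S h"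
  shows "openin (top_of_set S) {x \<in> S. u x - ereal (h x) < c}"
proof -
  have "{x \<in> S. u x - ereal (h x) < c} =
      (\<Union>q. (S \<inter> {x. u x < ereal q}) \<inter> {x \<in> S. ereal q < c + ereal (h x)})"
  proof -
    have "u x - ereal (h x) < c \<longleftrightarrow> (\<exists>q. u x < ereal q \<and> ereal q < c + ereal (h x))" for x
      by (subst ereal_minus_less) (auto dest: ereal_dense2 less_trans)
    then show ?thesis by blast
  qed
  moreover have "openin (top_of_set S) {x \<in> S. ereal q < c + ereal (h x)}" for q
  proof (cases c)
    case (real r)
    have "{x \<in> S. ereal q < c + ereal (h x)} = S \<inter> h -` {q - r<..}"
      by (auto simp: real)
    then show ?thesis using continuous_openin_preimage_gen[OF h] by simp
  qed auto
  ultimately show ?thesis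
    using u by (auto intro!: openin_Union openin_Int openin_open_Int)
qed

lemma subharm_bdd_le:
  assumes u: "u \<in> subharm_bdd V A S" and W: "open W" "bounded W" "closure W \<subseteq> S"
    and h: "harmonic_on V A W h" "continuous_on (closure W) h"
    and fr: "\<And>x. x \<in> frontier W \<Longrightarrow> u x \<le> ereal (h x)" and x: "x \<in> W"
  shows "u x \<le> ereal (h x)"
proof -
  have "subharmonic_on V A S u" using u by (simp add: subharm_bdd_def)
  then have "open W \<and> bounded W \<and> closure W \<subseteq> S \<and> harmonic_on V A W h \<and>
      continuous_on (closure W) h \<and> (\<forall>x\<in>frontier W. u x \<le> ereal (h x)) \<longrightarrow> (\<forall>x\<in>W. u x \<le> ereal (h x))"
    unfolding subharmonic_on_def by (elim conjE allE)
  then show ?thesis using assms by blast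
qed

context fundamental_solution
begin

lemma usc_UNIV: "u \<in> subharm_bdd V A UNIV \<Longrightarrow> open {x. u x < c}"
  by (simp add: subharm_bdd_def subharmonic_on_def)

text \<open>Comparing \<open>u - h\<close> with a harmonic \<open>k\<close> is comparing
  \<open>u\<close> with \<open>k + h\<close>. The lower bound on \<open>h\<close> keeps the
  difference bounded above.\<close>

lemma subharm_bdd_minus_harmonic:
  assumes O: "open \<Omega>" and u: "u \<in> subharm_bdd V A UNIV"
    and h: "harmonic_on V A \<Omega> h" "\<And>x. x \<in> \<Omega> \<Longrightarrow> b \<le> h x"
  shows "(\<lambda>x. u x - ereal (h x)) \<in> subharm_bdd V A \<Omega>"
proof -
  have us: "u x < \<infinity>" "closure {x. u x > -\<infinity>} = UNIV" for x
    using u by (auto simp: subharm_bdd_def subharmonic_on_def)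
  obtain C where C: "\<And>x. u x \<le> ereal C" using u by (auto simp: subharm_bdd_def)
  have hc: "continuous_on \<Omega> h" using h smooth_on_imp_continuous_on by (auto simp: harmonic_on_def)
  have fin: "u x - ereal (h x) < \<infinity>" for x
    using us(1)[of x] by (cases "u x") auto
  have dense: "\<Omega> \<subseteq> closure {x \<in> \<Omega>. u x - ereal (h x) > -\<infinity>}"
  proof -
    have "\<Omega> \<inter> closure {x. u x > -\<infinity>} \<subseteq> closure (\<Omega> \<inter> {x. u x > -\<infinity>})"
      by (rule open_Int_closure_subset[OF O])
    moreover have "u x > -\<infinity> \<Longrightarrow> u x - ereal (h x) > -\<infinity>" for x by (cases "u x") auto
    then have "closure (\<Omega> \<inter> {x. u x > -\<infinity>}) \<subseteq> closure {x \<in> \<Omega>. u x - ereal (h x) > -\<infinity>}"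
      by (intro closure_mono) auto
    ultimately show ?thesis using us(2) by auto
  qed
  have cmp: "u x - ereal (h x) \<le> ereal (k x)"
    if W: "open W" "bounded W" "closure W \<subseteq> \<Omega>" "harmonic_on V A W k" "continuous_on (closure W) k"
      and bd: "\<And>x. x \<in> frontier W \<Longrightarrow> u x - ereal (h x) \<le> ereal (k x)" and x: "x \<in> W" for W k x
  proof -
    have *: "u x - ereal (h x) \<le> ereal (k x) \<longleftrightarrow> u x \<le> ereal (k x + h x)" for x
      by (cases "u x") auto
    have "harmonic_on V A W (\<lambda>x. k x + h x)"
      using W closure_subset[of W] by (intro harmonic_on_add harmonic_on_subset[OF h(1)]) auto
    moreover have "continuous_on (closure W) (\<lambda>x. k x + h x)"
      using W continuous_on_subset[OF hc] by (intro continuous_on_add) auto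
    ultimately show ?thesis
      using subharm_bdd_le[OF u W(1,2), of "\<lambda>x. k x + h x"] bd x unfolding * by blast
  qed
  have "u x - ereal (h x) \<le> ereal (C - b)" if "x \<in> \<Omega>" for x
    using C[of x] h(2)[OF that] by (cases "u x") auto
  then show ?thesis
    unfolding subharm_bdd_def subharmonic_on_def
    using fin dense cmp usc_minus_continuous[OF usc_UNIV[OF u] hc] by blast
qed

text \<open>The maximum principle applied to \<open>u - h\<close>. The boundary condition is stated
  along points of \<Omega> with a margin \<open>e\<close>, so that \<open>h\<close> may be singular
  at the frontier.\<close>

lemma max_principle_compare:
  assumes MP: "max_principle_set V A \<Omega>" and u: "u \<in> subharm_bdd V A UNIV"
    and h: "harmonic_on V A \<Omega> h" "\<And>x. x \<in> \<Omega> \<Longrightarrow> b \<le> h x"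
    and bd: "\<And>\<xi> e. \<xi> \<in> frontier \<Omega> \<Longrightarrow> 0 < e \<Longrightarrow> eventually (\<lambda>x. u x \<le> ereal (h x + e)) (at \<xi> within \<Omega>)"
    and x: "x \<in> \<Omega>"
  shows "u x \<le> ereal (h x)"
proof -
  have "open \<Omega>" using MP by (simp add: max_principle_set_def)
  from subharm_bdd_minus_harmonic[OF this u h]
  have "(\<lambda>x. u x - ereal (h x)) \<in> subharm_bdd V A \<Omega>" .
  moreover have "Limsup (at \<xi> within \<Omega>) (\<lambda>x. u x - ereal (h x)) \<le> 0" if "\<xi> \<in> frontier \<Omega>" for \<xi>
  proof (rule ereal_le_epsilon2)
    show "Limsup (at \<xi> within \<Omega>) (\<lambda>x. u x - ereal (h x)) \<le> 0 + ereal e" if "0 < e" for e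
    proof (rule Limsup_bounded)
      have "u x \<le> ereal (h x + e) \<Longrightarrow> u x - ereal (h x) \<le> 0 + ereal e" for x by (cases "u x") auto
      with bd[OF \<open>\<xi> \<in> frontier \<Omega>\<close> \<open>0 < e\<close>]
      show "\<forall>\<^sub>F x in at \<xi> within \<Omega>. u x - ereal (h x) \<le> 0 + ereal e"
        by (auto elim: eventually_mono)
    qed
  qed
  ultimately have "u x - ereal (h x) \<le> 0" using MP x unfolding max_principle_set_def by blast
  then show ?thesis by (cases "u x") auto
qed

text \<open>On a large ball a constant that dominates \<open>u\<close> on the sphere dominates it
  inside. Thus a subharmonic function on the whole space approaches its supremum at
  infinity.\<close>

lemma SUP_le_Limsup_at_infinity:
  assumes u: "u \<in> subharm_bdd V A UNIV"
  shows "u x \<le> Limsup at_infinity u"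
proof (rule ccontr)
  assume "\<not> u x \<le> Limsup at_infinity u"
  then have "Limsup at_infinity u < u x" by simp
  from ereal_dense2[OF this] obtain c where c: "Limsup at_infinity u < ereal c" "ereal c < u x"
    by blast
  obtain R where R: "\<And>y. R \<le> norm y \<Longrightarrow> u y < ereal c"
    using Limsup_lessD[OF c(1)] by (auto simp: eventually_at_infinity)
  define W where "W = ball (0::real^'n) (max R (norm x) + 1)"
  have pos: "max R (norm x) + 1 > 0" by (smt (verit) norm_ge_zero)
  have "u x \<le> ereal c"
  proof (rule subharm_bdd_le[OF u _ _ _ harmonic_on_const[of W c]])
    show "u y \<le> ereal c" if "y \<in> frontier W" for y
      using that R[of y] pos by (intro less_imp_le R) (simp add: W_def frontier_ball)
  qed (auto simp: W_def)
  then show False using c(2) by simp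
qed

section \<open>The reciprocal of the fundamental solution\<close>

lemma gam_nonneg: "gam \<Gamma> x y \<ge> 0"
  using Gamma_pos[of x y] by (auto simp: gam_def)

lemma gam_pos: "x \<noteq> y \<Longrightarrow> gam \<Gamma> x y > 0"
  using Gamma_pos[of x y] by (auto simp: gam_def)

lemma gam_sym: "gam \<Gamma> x y = gam \<Gamma> y x"
  using Gamma_sym[of x y] by (auto simp: gam_def)

text \<open>Continuity at \<open>x\<close> itself is the blow-up of \<Gamma> at its pole.\<close>

lemma gam_continuous: "continuous_on UNIV (gam \<Gamma> x)"
proof (rule continuous_at_imp_continuous_on, rule ballI)
  fix y
  show "isCont (gam \<Gamma> x) y"
  proof (cases "y = x")
    case True
    have "filterlim (\<Gamma> x) at_top (at x)" using FS unfolding FS_def by blast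
    then have "((\<lambda>y. inverse (\<Gamma> x y)) \<longlongrightarrow> 0) (at x)" by (rule tendsto_inverse_0_at_top)
    then have "(gam \<Gamma> x \<longlongrightarrow> 0) (at x)"
      by (rule Lim_transform_eventually) (auto simp: eventually_at_filter gam_def inverse_eq_divide)
    then show ?thesis using True by (simp add: isCont_def gam_def)
  next
    case False
    have "continuous_on (- {x}) (\<lambda>y. 1 / \<Gamma> x y)"
      using Gamma_pos[of x] by (intro continuous_on_divide continuous_on_const
          smooth_on_imp_continuous_on[OF Gamma_smooth]) force
    then have "continuous_on (- {x}) (gam \<Gamma> x)"
      by (rule continuous_on_eq) (auto simp: gam_def)
    then show ?thesis using False continuous_on_eq_continuous_at[of "- {x}"] by auto
  qed
qed

lemma Gamma_tendsto_0: "(\<Gamma> x \<longlongrightarrow> 0) at_infinity"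
  using FS unfolding FS_def by blast

text \<open>For a bounded complement a constant majorant suffices. In the unbounded case
  \<open>u\<close> is known to lie below \<open>c\<close> only on the far part of the complement,
  and a multiple of \<Gamma> is added to control the rest.\<close>

lemma max_principle_imp_large:
  assumes MP: "max_principle_set V A \<Omega>"
  shows "large_at_infinity V A (UNIV - \<Omega>)"
  unfolding large_at_infinity_def
proof
  assume "thin_at_infinity V A (UNIV - \<Omega>)"
  then obtain u where u: "u \<in> subharm_bdd V A UNIV"
    and thin: "if bounded (UNIV - \<Omega>) then (SUP x\<in>UNIV - \<Omega>. u x) < (SUP x. u x)
     else Limsup (inf at_infinity (principal (UNIV - \<Omega>))) u < Limsup at_infinity u"
    unfolding thin_at_infinity_def by blast
  have O: "open \<Omega>" using MP by (simp add: max_principle_set_def)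
  have fr: "\<xi> \<notin> \<Omega>" if "\<xi> \<in> frontier \<Omega>" for \<xi>
    using that O by (simp add: frontier_def interior_open)
  have usc: "eventually (\<lambda>x. u x < c) (at \<xi> within \<Omega>)" if "u \<xi> < c" for \<xi> c
    using usc_UNIV[OF u, of c] that by (auto simp: eventually_at_topological)
  show False
  proof (cases "bounded (UNIV - \<Omega>)")
    case True
    with thin have "(SUP x\<in>UNIV - \<Omega>. u x) < (SUP x. u x)" by simp
    then obtain c where c: "(SUP x\<in>UNIV - \<Omega>. u x) < ereal c" "ereal c < (SUP x. u x)"
      using ereal_dense2 by blast
    have F: "u x < ereal c" if "x \<notin> \<Omega>" for x
      using c(1) that by (meson DiffI SUP_lessD UNIV_I)
    have "u x \<le> ereal c" if "x \<in> \<Omega>" for x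
    proof (rule max_principle_compare[OF MP u harmonic_on_const _ _ that])
      fix \<xi> and e :: real assume "\<xi> \<in> frontier \<Omega>" "0 < e"
      show "\<forall>\<^sub>F x in at \<xi> within \<Omega>. u x \<le> ereal (c + e)"
        using usc[OF F[OF fr[OF \<open>\<xi> \<in> frontier \<Omega>\<close>]]]
        by (rule eventually_mono) (use \<open>0 < e\<close> in \<open>auto elim!: order_trans[OF less_imp_le]\<close>)
    qed auto
    then have "(SUP x. u x) \<le> ereal c" using F by (metis SUP_least less_imp_le)
    with c(2) show False by simp
  next
    case False
    with thin have "Limsup (inf at_infinity (principal (UNIV - \<Omega>))) u < Limsup at_infinity u" by simp
    then obtain c where c: "Limsup (inf at_infinity (principal (UNIV - \<Omega>))) u < ereal c"
      "ereal c < Limsup at_infinity u"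
      using ereal_dense2 by blast
    obtain R where R: "\<And>x. R \<le> norm x \<Longrightarrow> x \<notin> \<Omega> \<Longrightarrow> u x < ereal c"
      using Limsup_lessD[OF c(1)] by (auto simp: eventually_inf_principal eventually_at_infinity)
    \<comment> \<open>The pole is placed off \<Omega>, so the comparison function is harmonic in
      \<Omega>.\<close>
    obtain a where a: "a \<notin> \<Omega>" using False by (metis DiffE bounded_empty equals0I)
    obtain C where C: "\<And>x. u x \<le> ereal C" using u by (auto simp: subharm_bdd_def)
    obtain B where B: "B > 0" "\<And>y. y \<in> cball 0 R \<Longrightarrow> gam \<Gamma> a y \<le> B"
    proof -
      have "compact (gam \<Gamma> a ` cball 0 R)"
        by (intro compact_continuous_image continuous_on_subset[OF gam_continuous]) auto
      then obtain B where "\<And>y. y \<in> cball 0 R \<Longrightarrow> \<bar>gam \<Gamma> a y\<bar> \<le> B"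
        using compact_imp_bounded by (fastforce simp: bounded_iff)
      then show thesis using that[of "max B 1"] by fastforce
    qed
    \<comment> \<open>Chosen so that \<open>k * \<Gamma> a y\<close> is at least
      \<open>\<bar>C\<bar> + \<bar>c\<bar> + 1\<close> wherever \<open>gam \<Gamma> a y\<close> is
      at most \<open>B\<close>. There \<open>h\<close> exceeds the global bound \<open>C\<close>, in
      particular on \<open>cball 0 R\<close> away from \<open>a\<close>.\<close>
    define k where "k = B * (\<bar>C\<bar> + \<bar>c\<bar> + 1)"
    have k: "k > 0" using B(1) by (simp add: k_def add_nonneg_pos)
    define h where "h y = c + k * \<Gamma> a y" for y
    have hC: "h y \<ge> C" if "gam \<Gamma> a y \<le> B" "y \<noteq> a" for y
    proof -
      have "1 \<le> B * \<Gamma> a y" using that Gamma_pos[of a y] by (auto simp: gam_def field_simps)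
      then have "\<bar>C\<bar> + \<bar>c\<bar> + 1 \<le> k * \<Gamma> a y"
        unfolding k_def using mult_left_mono[of 1 "B * \<Gamma> a y" "\<bar>C\<bar> + \<bar>c\<bar> + 1"] by (simp add: mult_ac)
      then show ?thesis by (simp add: h_def)
    qed
    have hc: "h y \<ge> c" if "y \<noteq> a" for y using Gamma_pos[of a y] that k by (auto simp: h_def)
    have F: "u y \<le> ereal (h y)" if "y \<notin> \<Omega>" "y \<noteq> a" for y
    proof (cases "norm y \<le> R")
      case True
      then show ?thesis using hC[OF B(2)] that C[of y] by (force elim: order_trans)
    next
      case False
      then show ?thesis using R[of y] hc[of y] that by (auto elim!: order_trans[OF less_imp_le])
    qed
    have Oa: "\<Omega> \<subseteq> - {a}" using a by auto
    have hh: "harmonic_on V A (- {a}) h" unfolding h_def[abs_def]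
      by (intro harmonic_on_add harmonic_on_const harmonic_on_cmult Gamma_harmonic) auto
    then have hcont: "continuous_on (- {a}) h"
      by (simp add: harmonic_on_def smooth_on_imp_continuous_on)
    have main: "u x \<le> ereal (h x)" if "x \<in> \<Omega>" for x
    proof (rule max_principle_compare[OF MP u harmonic_on_subset[OF hh Oa] hc _ that])
      fix \<xi> and e :: real assume \<xi>: "\<xi> \<in> frontier \<Omega>" and e: "0 < e"
      show "\<forall>\<^sub>F x in at \<xi> within \<Omega>. u x \<le> ereal (h x + e)"
      proof (cases "\<xi> = a")
        case True
        \<comment> \<open>When the pole is a frontier point, \<open>h\<close> has no useful value
          there, but near the pole it exceeds \<open>C\<close>.\<close>
        have "isCont (gam \<Gamma> a) a"
          using gam_continuous by (simp add: continuous_on_eq_continuous_at)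
        then have "(gam \<Gamma> a \<longlongrightarrow> 0) (at a)" by (simp add: isCont_def gam_def)
        from order_tendstoD(2)[OF this B(1)] have "eventually (\<lambda>y. gam \<Gamma> a y < B) (at \<xi> within \<Omega>)"
          unfolding True by (rule filter_leD[OF at_le[OF subset_UNIV]])
        moreover have "eventually (\<lambda>y. y \<in> \<Omega>) (at \<xi> within \<Omega>)" by (simp add: eventually_at_filter)
        ultimately show ?thesis
        proof eventually_elim
          case (elim y)
          then have "C \<le> h y + e" using hC[of y] a e by force
          then show ?case using C[of y] order_trans by fastforce
        qed
      next
        case False
        have "u \<xi> < ereal (h \<xi> + e / 2)"
          using F[OF fr[OF \<xi>] False] e by (auto elim!: order.strict_trans1)
        from usc[OF this] have "eventually (\<lambda>x. u x < ereal (h \<xi> + e / 2)) (at \<xi> within \<Omega>)" .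
        moreover have "isCont h \<xi>"
          using hcont False continuous_on_eq_continuous_at[of "- {a}" h] by auto
        then have "(h \<longlongrightarrow> h \<xi>) (at \<xi>)" by (simp add: isCont_def)
        then have "eventually (\<lambda>x. h \<xi> - e/2 < h x) (at \<xi>)"
          using e by (intro order_tendstoD(1)) auto
        then have "eventually (\<lambda>x. h \<xi> - e/2 < h x) (at \<xi> within \<Omega>)"
          by (rule filter_leD[OF at_le[OF subset_UNIV]])
        ultimately show ?thesis
        proof eventually_elim
          case (elim x)
          then have "ereal (h \<xi> + e/2) \<le> ereal (h x + e)" by simp
          with elim(1) show ?case by (meson less_imp_le order_trans)
        qed
      qed
    qed (use Oa in auto)
    have all: "u x \<le> ereal (h x)" if "x \<noteq> a" for x using main F that by blast
    obtain d where d: "ereal c < ereal d" "ereal d < Limsup at_infinity u"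
      using c(2) ereal_dense2 by blast
    \<comment> \<open>The added singular term disappears at infinity, which brings the upper limit
      of \<open>u\<close> down to \<open>d\<close>.\<close>
    have "eventually (\<lambda>y. \<Gamma> a y < (d - c) / k) at_infinity"
      using order_tendstoD(2)[OF Gamma_tendsto_0] d(1) k by simp
    moreover have "eventually (\<lambda>y. y \<noteq> a) at_infinity"
      unfolding eventually_at_infinity by (rule exI[of _ "norm a + 1"]) auto
    ultimately have "eventually (\<lambda>y. u y \<le> ereal d) at_infinity"
    proof eventually_elim
      case (elim y)
      then have "h y \<le> d" using k by (simp add: h_def field_simps)
      with all[OF elim(2)] show ?case by (meson ereal_less_eq(3) order_trans)
    qed
    then have "Limsup at_infinity u \<le> ereal d" by (rule Limsup_bounded)
    with d(2) show False by simp
  qed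
qed

text \<open>\<open>w\<close> is the positive part of a counterexample, extended by zero.\<close>

lemma not_max_principle_obtain:
  assumes O: "open \<Omega>" and nMP: "\<not> max_principle_set V A \<Omega>"
  obtains w :: "real^'n \<Rightarrow> real" where "(\<lambda>x. ereal (w x)) \<in> subharm_bdd V A UNIV"
    "\<And>x. 0 \<le> w x" "\<And>x. x \<notin> \<Omega> \<Longrightarrow> w x = 0" "\<exists>x. w x > 0"
proof -
  obtain u z where u: "u \<in> subharm_bdd V A \<Omega>"
    and bd: "\<And>\<xi>. \<xi> \<in> frontier \<Omega> \<Longrightarrow> Limsup (at \<xi> within \<Omega>) u \<le> 0"
    and z: "z \<in> \<Omega>" "\<not> u z \<le> 0"
    using O nMP unfolding max_principle_set_def by blast
  obtain C where C: "\<And>x. x \<in> \<Omega> \<Longrightarrow> u x \<le> ereal C" using u by (auto simp: subharm_bdd_def)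
  have uO: "open {x \<in> \<Omega>. u x < c}" for c
    using u O by (auto simp: subharm_bdd_def subharmonic_on_def openin_open_eq)
  \<comment> \<open>\<open>real_of_ereal\<close> sends minus infinity to 0, which is the correct
    positive part.\<close>
  define w where "w x = (if x \<in> \<Omega> then max 0 (real_of_ereal (u x)) else 0)" for x
  have wu: "ereal (w x) = max 0 (u x)" if "x \<in> \<Omega>" for x
    using C[OF that] that by (cases "u x") (auto simp: w_def max_def zero_ereal_def)
  have w0: "0 \<le> w x" "x \<notin> \<Omega> \<Longrightarrow> w x = 0" for x by (auto simp: w_def)
  have usc: "open {x. ereal (w x) < c}" for c
  proof (cases "c \<le> 0")
    case True
    have "{x. ereal (w x) < c} = {}" using w0(1) True by (auto simp: not_less intro: order_trans)
    then show ?thesis by simp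
  next
    case False
    then have c: "0 < c" by simp
    have "\<exists>T. open T \<and> x \<in> T \<and> T \<subseteq> {x. ereal (w x) < c}" if x: "ereal (w x) < c" for x
    proof -
      consider "x \<in> \<Omega>" | "x \<notin> closure \<Omega>" | "x \<in> frontier \<Omega>" "x \<notin> \<Omega>"
        using O by (auto simp: frontier_def interior_open)
      then show ?thesis
      proof cases
        case 1
        have "{y \<in> \<Omega>. u y < c} \<subseteq> {x. ereal (w x) < c}" using wu c by auto
        moreover have "x \<in> {y \<in> \<Omega>. u y < c}" using 1 wu[OF 1] x by auto
        ultimately show ?thesis using uO by blast
      next
        case 2
        have "- closure \<Omega> \<subseteq> {x. ereal (w x) < c}" 
        proof
          fix y assume "y \<in> - closure \<Omega>"
          then have "y \<notin> \<Omega>" using closure_subset[of \<Omega>] by blast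
          then show "y \<in> {x. ereal (w x) < c}" using w0(2) c by (simp flip: zero_ereal_def)
        qed
        then show ?thesis using 2 by (metis ComplI closed_closure open_Compl)
      next
        case 3
        \<comment> \<open>The boundary condition on \<open>u\<close> is what makes the extension by
          zero upper semicontinuous at the frontier.\<close>
        have "Limsup (at x within \<Omega>) u < c" using bd[OF 3(1)] c by auto
        from Limsup_lessD[OF this] obtain T where T: "open T" "x \<in> T"
            "\<forall>y\<in>T. y \<noteq> x \<longrightarrow> y \<in> \<Omega> \<longrightarrow> u y < c"
          unfolding eventually_at_topological by blast
        have "T \<subseteq> {x. ereal (w x) < c}"
        proof
          fix y assume "y \<in> T"
          show "y \<in> {x. ereal (w x) < c}"
          proof (cases "y \<in> \<Omega>")
            case True
            then have "u y < c" using T(3) \<open>y \<in> T\<close> 3(2) by metis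
            then show ?thesis using c wu[OF True] by simp
          qed (use w0(2) c in \<open>simp flip: zero_ereal_def\<close>)
        qed
        then show ?thesis using T(1,2) by blast
      qed
    qed
    then show ?thesis using open_subopen by (metis (no_types, lifting) mem_Collect_eq)
  qed
  have cmp: "ereal (w x) \<le> ereal (h x)"
    if W: "open W" "bounded W" "harmonic_on V A W h" "continuous_on (closure W) h"
      and fr: "\<And>x. x \<in> frontier W \<Longrightarrow> ereal (w x) \<le> ereal (h x)" and x: "x \<in> W" for W h x
  proof (rule ccontr)
    assume neg: "\<not> ereal (w x) \<le> ereal (h x)"
    \<comment> \<open>On the frontier of \<open>W\<close>, \<open>h\<close> dominates the
      nonnegative \<open>w\<close>; the weak maximum principle for \<open>-h\<close> carries the
      sign inside. So the points where \<open>w\<close> exceeds \<open>h\<close> lie in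
      \<Omega>.\<close>
    have h0: "0 \<le> h y" if "y \<in> closure W" for y
    proof (cases "y \<in> W")
      case True
      have "- 1 * h y \<le> 0"
      proof (rule weak_maximum_principle[OF W(1,2) harmonic_on_cmult[OF W(1,3)] _ _ True])
        show "continuous_on (closure W) (\<lambda>y. - 1 * h y)" by (intro continuous_intros W)
        show "- 1 * h y \<le> 0" if "y \<in> frontier W" for y
          using order_trans[OF _ fr[OF that], of 0] w0(1)[of y] by simp
      qed
      then show ?thesis by simp
    next
      case False
      then have "y \<in> frontier W" using that W(1) by (simp add: frontier_def interior_open)
      from order_trans[OF _ fr[OF this], of 0] w0(1)[of y] show ?thesis by simp
    qed
    define e where "e = (w x - h x) / 2"
    have e: "e > 0" using neg by (simp add: e_def)
    define K where "K = {y \<in> closure W. h y + e \<le> w y}"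
    have "closedin (top_of_set (closure W)) K"
    proof -
      have "closure W - K = {y \<in> closure W. ereal (w y) - ereal (h y) < ereal e}"
        by (auto simp: K_def)
      then have "openin (top_of_set (closure W)) (closure W - K)"
        using usc_minus_continuous[OF usc W(4), of "ereal e"] by simp
      moreover have "K \<subseteq> closure W" by (auto simp: K_def)
      ultimately show ?thesis by (simp add: closedin_def)
    qed
    then have K: "compact K"
      using W(2) by (meson bounded_closure bounded_subset closed_closure closedin_closed_trans
          closedin_imp_subset compact_eq_bounded_closed)
    have KW: "K \<subseteq> W \<inter> \<Omega>"
    proof
      fix y assume "y \<in> K"
      then have y: "y \<in> closure W" "h y + e \<le> w y" by (auto simp: K_def)
      have "y \<notin> frontier W" using fr[of y] y e by auto
      then have "y \<in> W" using y W(1) by (simp add: frontier_def interior_open)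
      moreover have "y \<in> \<Omega>" using w0(2)[of y] h0[OF y(1)] y(2) e by force
      ultimately show "y \<in> W \<inter> \<Omega>" by simp
    qed
    obtain d where d: "d > 0" "(\<Union>y\<in>K. ball y d) \<subseteq> W \<inter> \<Omega>"
      using compact_subset_open_imp_ball_epsilon_subset[OF K _ KW] W(1) O by blast
    \<comment> \<open>Half the radius keeps the closure inside both \<open>W\<close> and \<Omega>.
      The frontier of \<open>W'\<close> misses \<open>K\<close>, so \<open>h + e\<close> dominates
      \<open>u\<close> there and subharmonicity of \<open>u\<close> in \<Omega> applies.\<close>
    define W' where "W' = (\<Union>y\<in>K. ball y (d/2))"
    have W'o: "open W'" by (auto simp: W'_def)
    have KW': "K \<subseteq> W'" using d(1) by (force simp: W'_def)
    have cW': "closure W' \<subseteq> W \<inter> \<Omega>"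
    proof
      fix y assume "y \<in> closure W'"
      then obtain y' where "y' \<in> W'" "dist y' y < d/2"
        using d(1) by (meson closure_approachable half_gt_zero)
      then obtain y'' where "y'' \<in> K" "dist y'' y' < d/2" by (auto simp: W'_def)
      then have "dist y'' y < d" using \<open>dist y' y < d/2\<close> dist_triangle[of y'' y y'] by simp
      then have "y \<in> (\<Union>y\<in>K. ball y d)" using \<open>y'' \<in> K\<close> by auto
      then show "y \<in> W \<inter> \<Omega>" using d(2) by blast
    qed
    have xK: "x \<in> K" using x closure_subset[of W] e by (auto simp: K_def e_def field_simps)
    have sW: "W' \<subseteq> W" using cW' closure_subset[of W'] by blast
    have "u x \<le> ereal (h x + e)"
    proof (rule subharm_bdd_le[OF u W'o])
      show "bounded W'" using W(2) sW bounded_subset by blast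
      show "closure W' \<subseteq> \<Omega>" using cW' by simp
      show "harmonic_on V A W' (\<lambda>x. h x + e)"
        by (intro harmonic_on_add harmonic_on_const W'o harmonic_on_subset[OF W(3) sW])
      show "continuous_on (closure W') (\<lambda>x. h x + e)"
        using cW' closure_subset[of W] by (intro continuous_intros continuous_on_subset[OF W(4)]) blast
      show "x \<in> W'" using xK KW' by blast
      show "u y \<le> ereal (h y + e)" if y: "y \<in> frontier W'" for y
      proof -
        have "y \<in> closure W'" "y \<notin> W'" using y W'o by (auto simp: frontier_def interior_open)
        then have "y \<notin> K" "y \<in> closure W" "y \<in> \<Omega>" using subsetD[OF KW'] subsetD[OF cW'] closure_subset[of W] by auto
        then have "w y \<le> h y + e" "u y \<le> ereal (w y)" by (auto simp: K_def wu)
        then show ?thesis by (meson ereal_less_eq(3) order_trans)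
      qed
    qed
    moreover have "w x > h x + e" "x \<in> \<Omega>" "h x + e > 0"
      using e h0[of x] x xK KW closure_subset[of W] by (auto simp: e_def field_simps)
    ultimately have "max 0 (u x) \<le> ereal (h x + e)" and less: "h x + e < w x" by auto
    then have "ereal (w x) \<le> ereal (h x + e)" using wu[OF \<open>x \<in> \<Omega>\<close>] by (simp only:)
    then show False using less by simp
  qed
  show thesis
  proof
    have "ereal (w x) \<le> ereal (max 0 C)" for x
    proof (cases "x \<in> \<Omega>")
      case True
      have "u x \<le> ereal (max 0 C)" using C[OF True] by (rule order_trans) simp
      moreover have "0 \<le> ereal (max 0 C)" by (simp add: zero_ereal_def le_max_iff_disj)
      ultimately show ?thesis unfolding wu[OF True] by (metis max.boundedI)
    qed (simp add: w0)
    then have "\<exists>C. \<forall>x\<in>UNIV. ereal (w x) \<le> ereal C" by blast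
    moreover have "subharmonic_on V A UNIV (\<lambda>x. ereal (w x))"
      unfolding subharmonic_on_def using usc cmp by simp blast
    ultimately show "(\<lambda>x. ereal (w x)) \<in> subharm_bdd V A UNIV"
      unfolding subharm_bdd_def by blast
    have "ereal (w z) > 0" using wu[OF z(1)] z(2) by simp
    then show "\<exists>x. w x > 0" by auto
  qed (use w0 in auto)
qed

text \<open>One function witnesses thinness in both cases: it vanishes on the complement, and its
  positive value at \<open>z\<close> bounds from below both its supremum and its upper limit at
  infinity.\<close>

lemma large_imp_max_principle:
  assumes O: "open \<Omega>" and large: "large_at_infinity V A (UNIV - \<Omega>)"
  shows "max_principle_set V A \<Omega>"
proof (rule ccontr)
  assume "\<not> max_principle_set V A \<Omega>"
  then obtain w z where w: "(\<lambda>x. ereal (w x)) \<in> subharm_bdd V A UNIV"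
    "\<And>x. x \<notin> \<Omega> \<Longrightarrow> w x = 0" "w z > 0"
    using not_max_principle_obtain[OF O] by metis
  have "(SUP x\<in>UNIV - \<Omega>. ereal (w x)) \<le> 0" using w(2) by (intro SUP_least) auto
  also have "0 < ereal (w z)" using w(3) by simp
  also have "\<dots> \<le> (SUP x. ereal (w x))" by (rule SUP_upper) simp
  finally have 1: "(SUP x\<in>UNIV - \<Omega>. ereal (w x)) < (SUP x. ereal (w x))" .
  have "Limsup (inf at_infinity (principal (UNIV - \<Omega>))) (\<lambda>x. ereal (w x)) \<le> 0"
    using w(2) by (intro Limsup_bounded) (auto simp: eventually_inf_principal)
  also have "0 < ereal (w z)" using w(3) by simp
  also have "\<dots> \<le> Limsup at_infinity (\<lambda>x. ereal (w x))" by (rule SUP_le_Limsup_at_infinity[OF w(1)])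
  finally have "thin_at_infinity V A (UNIV - \<Omega>)"
    unfolding thin_at_infinity_def using w(1) 1 by auto
  then show False using large by (simp add: large_at_infinity_def)
qed

end

subsection \<open>Finite selection principles\<close>

text \<open>A discrete equilibrium measure: \<open>S\<close> minimizes the energy \<open>\<Sum>y\<in>S. \<Sum>z\<in>S. g y z\<close>
  minus \<open>2 card S\<close>.\<close>

lemma equilibrium_subset:
  fixes g :: "'a \<Rightarrow> 'a \<Rightarrow> real"
  assumes P: "finite P" and g: "\<And>x y. g x y = g y x" "\<And>x y. 0 \<le> g x y" "\<And>x. g x x = 1"
  obtains S where "S \<subseteq> P" "\<And>y. y \<in> P \<Longrightarrow> 1/2 \<le> (\<Sum>z\<in>S. g y z)"
    "\<And>y. y \<in> S \<Longrightarrow> (\<Sum>z\<in>S. g y z) \<le> 3/2"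
proof -
  define E where "E S = (\<Sum>y\<in>S. \<Sum>z\<in>S. g y z) - 2 * real (card S)" for S
  have "Min (E ` Pow P) \<in> E ` Pow P" using P by (intro Min_in) auto
  then obtain S where S: "S \<subseteq> P" "Min (E ` Pow P) = E S" by auto
  then have min: "E S \<le> E T" if "T \<subseteq> P" for T
    using Min_le[of "E ` Pow P" "E T"] P that by auto
  \<comment> \<open>The energy change of one added point. Minimality against adding a point gives
    the lower bound 1/2; minimality against removing one gives the upper bound, the diagonal term
    adding 1.\<close>
  have ins: "E (insert y T) = E T + 2 * (\<Sum>z\<in>T. g y z) - 1" if "finite T" "y \<notin> T" for y T
  proof -
    have "(\<Sum>z\<in>T. g z y) = (\<Sum>z\<in>T. g y z)" by (simp add: g(1))
    then show ?thesis using that g(3) by (simp add: E_def sum.distrib)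
  qed
  have fS: "finite S" using S(1) P finite_subset by blast
  show thesis
  proof (rule that[OF S(1)])
    fix y assume y: "y \<in> P"
    show "1/2 \<le> (\<Sum>z\<in>S. g y z)"
    proof (cases "y \<in> S")
      case True
      have "g y y \<le> (\<Sum>z\<in>S. g y z)" using True fS g(2) by (intro member_le_sum) auto
      then show ?thesis using g(3)[of y] by simp
    next
      case False
      have "E S \<le> E (insert y S)" using S(1) y by (intro min) auto
      then show ?thesis using ins[OF fS False] by simp
    qed
  next
    fix y assume y: "y \<in> S"
    define T where "T = S - {y}"
    have T: "S = insert y T" "y \<notin> T" "finite T" using y fS by (auto simp: T_def)
    have "E S \<le> E T" using S(1) by (intro min) (auto simp: T_def)
    then have "(\<Sum>z\<in>T. g y z) \<le> 1/2" using ins[OF T(3,2)] T(1) by simp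
    then show "(\<Sum>z\<in>S. g y z) \<le> 3/2" using T g(3)[of y] by simp
  qed
qed

text \<open>Greedy choice: a member of largest radius is kept, everything it meets is discarded, and
  the rest is treated inductively.\<close>

lemma finite_Vitali:
  fixes r :: "'a \<Rightarrow> real" and B :: "'a \<Rightarrow> 'b set"
  assumes "finite P" "\<And>x. x \<in> P \<Longrightarrow> B x \<noteq> {}"
  shows "\<exists>Q\<subseteq>P. disjoint_family_on B Q \<and> (\<forall>x\<in>P. \<exists>q\<in>Q. B x \<inter> B q \<noteq> {} \<and> r x \<le> r q)"
  using assms
proof (induction P rule: finite_psubset_induct)
  case (psubset P)
  show ?case
  proof (cases "P = {}")
    case True
    then show ?thesis by (auto simp: disjoint_family_on_def)
  next
    case False
    have "Max (r ` P) \<in> r ` P" using False psubset.hyps by (intro Max_in) auto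
    then obtain m where m: "m \<in> P" "r m = Max (r ` P)" by auto
    then have rm: "r x \<le> r m" if "x \<in> P" for x using that psubset.hyps by simp
    define P' where "P' = {x \<in> P. B x \<inter> B m = {}}"
    have "m \<notin> P'" using psubset.prems[OF m(1)] by (auto simp: P'_def)
    then have "P' \<subset> P" using m(1) by (auto simp: P'_def)
    from psubset.IH[OF this] obtain Q where Q: "Q \<subseteq> P'" "disjoint_family_on B Q"
      "\<forall>x\<in>P'. \<exists>q\<in>Q. B x \<inter> B q \<noteq> {} \<and> r x \<le> r q"
      using psubset.prems by (auto simp: P'_def)
    show ?thesis
    proof (intro exI[of _ "insert m Q"] conjI ballI)
      show "insert m Q \<subseteq> P" using m(1) Q(1) by (auto simp: P'_def)
      show "disjoint_family_on B (insert m Q)"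
        using Q(1,2) unfolding disjoint_family_on_def P'_def by blast
      show "\<exists>q\<in>insert m Q. B x \<inter> B q \<noteq> {} \<and> r x \<le> r q" if "x \<in> P" for x
        using Q(3) rm[OF that] that by (cases "x \<in> P'") (auto simp: P'_def)
    qed
  qed
qed

text \<open>Pigeonhole over the dyadic scales between \<open>s\<close> and \<open>R\<close>.\<close>

lemma dyadic_density:
  fixes f :: "'a \<Rightarrow> real"
  assumes S: "finite S" and s: "0 < s" "s \<le> R" and p: "1 < p"
    and sum: "1/4 \<le> (\<Sum>y\<in>{y \<in> S. f y < R}. s / max s (f y))"
  obtains r where "s \<le> r" "r \<le> R"
    "(1 - 2 powr (1 - p)) / 8 * (r / R) powr p * R \<le> s * real (card {y \<in> S. f y < r})"
proof (rule ccontr)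
  assume no: "\<not> thesis"
  note found = that
  define q where "q = 2 powr (1 - p)"
  have q: "0 < q" "q < 1" using p by (auto simp: q_def powr_less_one)
  have R: "0 < R" using s by simp
  \<comment> \<open>The last dyadic scale that is not below \<open>s\<close>.\<close>
  obtain J where J: "R / 2 ^ Suc J < s" "s \<le> R / 2 ^ J"
  proof -
    obtain n where "R / s < 2 ^ n" using real_arch_pow[of 2 "R / s"] by auto
    then have ex: "R / 2 ^ n < s" using s by (simp add: field_simps)
    define m where "m = (LEAST n. R / 2 ^ n < s)"
    have m: "R / 2 ^ m < s" unfolding m_def by (rule LeastI[of _ n]) (rule ex)
    then have "m \<noteq> 0" using s by (auto intro: ccontr)
    then obtain J where "m = Suc J" by (cases m) auto
    moreover have "\<not> R / 2 ^ J < s"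
      using not_less_Least[of J "\<lambda>n. R / 2 ^ n < s"] \<open>m = Suc J\<close> by (simp add: m_def)
    ultimately show thesis using m that by simp
  qed
  define N where "N j = real (card {y \<in> S. f y < R / 2 ^ j})" for j :: nat
  have pt: "s / max s (f y) \<le> (\<Sum>j\<le>J. if f y < R / 2 ^ j then 2 * 2 ^ j * s / R else 0)"
    if "f y < R" for y
  proof -
    \<comment> \<open>The alternative \<open>i = Suc J\<close> stops the search for points closer
      than every admissible scale. The predecessor of \<open>m\<close> is the dyadic scale of
      \<open>y\<close>.\<close>
    define m where "m = (LEAST i. i = Suc J \<or> R / 2 ^ i \<le> f y)"
    have m: "m = Suc J \<or> R / 2 ^ m \<le> f y" unfolding m_def by (rule LeastI[of _ "Suc J"]) simp
    then have "m \<noteq> 0" using that by (auto intro: ccontr)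
    then obtain j where j: "m = Suc j" by (cases m) auto
    have "m \<le> Suc J" unfolding m_def by (rule Least_le) simp
    then have jJ: "j \<le> J" using j by simp
    have fj: "f y < R / 2 ^ j"
      using not_less_Least[of j "\<lambda>i. i = Suc J \<or> R / 2 ^ i \<le> f y"] j by (simp add: m_def not_le)
    have "s / max s (f y) \<le> 2 * 2 ^ j * s / R"
    proof (cases "m = Suc J")
      case True
      have "s / max s (f y) \<le> 1" using s by simp
      also have "1 \<le> 2 * 2 ^ j * s / R" using J(1) True j R by (simp add: field_simps)
      finally show ?thesis .
    next
      case False
      then have "R / 2 ^ Suc j \<le> max s (f y)" using m j by auto
      then have "s / max s (f y) \<le> s / (R / 2 ^ Suc j)"
        using s R by (intro divide_left_mono) auto
      then show ?thesis by (simp add: mult_ac)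
    qed
    also have "\<dots> = (if f y < R / 2 ^ j then 2 * 2 ^ j * s / R else 0)" using fj by simp
    also have "\<dots> \<le> (\<Sum>j\<le>J. if f y < R / 2 ^ j then 2 * 2 ^ j * s / R else 0)"
      using jJ s R by (intro member_le_sum) auto
    finally show ?thesis .
  qed
  \<comment> \<open>Failure of the claim at scale \<open>R / 2 ^ j\<close> bounds that scale's share
    by a term of a geometric series. The ratio \<open>q\<close> is below 1 because \<open>p\<close>
    exceeds 1, and the shares add up to less than 1/4.\<close>
  have less: "N j * (2 * 2 ^ j * s / R) < (1 - q) / 4 * q ^ j" if "j \<le> J" for j
  proof -
    have "s \<le> R / 2 ^ j"
      using J(2) that R by (elim order_trans) (simp add: frac_le power_increasing)
    moreover have "R / 2 ^ j \<le> R" using R by (simp add: field_simps)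
    ultimately have "s * N j < (1 - q) / 8 * (R / 2 ^ j / R) powr p * R"
      using no found[of "R / 2 ^ j"] unfolding N_def q_def by (meson not_le)
    then have "s * N j * (2 * 2 ^ j / R) < (1 - q) / 8 * (R / 2 ^ j / R) powr p * R * (2 * 2 ^ j / R)"
      using R by (intro mult_strict_right_mono) auto
    then have "N j * (2 * 2 ^ j * s / R) < (1 - q) / 4 * (2 ^ j * (1 / 2 ^ j) powr p)"
      using R by (simp add: mult_ac)
    also have "(2::real) ^ j * (1 / 2 ^ j) powr p = q ^ j"
    proof -
      have "(2::real) ^ j * (1 / 2 ^ j) powr p = 2 powr real j * (2 powr (- real j)) powr p"
        by (simp add: powr_realpow powr_minus_divide)
      also have "\<dots> = 2 powr (real j * (1 - p))"
        by (simp add: powr_powr powr_add[symmetric] algebra_simps)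
      also have "\<dots> = q ^ j" by (simp add: q_def powr_power mult.commute)
      finally show ?thesis .
    qed
    finally show ?thesis .
  qed
  have "(\<Sum>y\<in>{y \<in> S. f y < R}. s / max s (f y))
      \<le> (\<Sum>y\<in>{y \<in> S. f y < R}. \<Sum>j\<le>J. if f y < R / 2 ^ j then 2 * 2 ^ j * s / R else 0)"
    using pt by (intro sum_mono) auto
  also have "\<dots> \<le> (\<Sum>y\<in>S. \<Sum>j\<le>J. if f y < R / 2 ^ j then 2 * 2 ^ j * s / R else 0)"
    using S s R by (intro sum_mono2 sum_nonneg) auto
  also have "\<dots> = (\<Sum>j\<le>J. \<Sum>y\<in>S. if f y < R / 2 ^ j then 2 * 2 ^ j * s / R else 0)"
    by (rule sum.swap)
  also have "\<dots> = (\<Sum>j\<le>J. N j * (2 * 2 ^ j * s / R))"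
    using S by (simp add: N_def sum.If_cases Int_def)
  also have "\<dots> < (\<Sum>j\<le>J. (1 - q) / 4 * q ^ j)"
    using less by (intro sum_strict_mono) auto
  also have "\<dots> = (1 - q) / 4 * (\<Sum>j\<le>J. q ^ j)" by (simp only: sum_distrib_left)
  also have "\<dots> = (1 - q ^ Suc J) / 4" using sum_gp_basic[of q J] by simp
  also have "\<dots> \<le> 1/4" using q by simp
  finally show False using sum by simp
qed

subsection \<open>Gamma-balls\<close>

locale Gamma_quasi_metric = fundamental_solution V A \<Gamma>
  for V :: "real^'n::finite \<Rightarrow> real" and A :: "real^'n \<Rightarrow> real^'n^'n"
    and \<Gamma> :: "real^'n \<Rightarrow> real^'n \<Rightarrow> real" +
  fixes \<theta> :: real
  assumes \<theta>: "0 < \<theta>" "\<theta> < 1"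
    and G: "\<And>x y r. r > 0 \<Longrightarrow> x \<notin> Gball \<Gamma> y r \<Longrightarrow> Gball \<Gamma> x (\<theta> * r) \<inter> Gball \<Gamma> y (\<theta> * r) = {}"
begin

abbreviation d :: "real^'n \<Rightarrow> real^'n \<Rightarrow> real" where "d \<equiv> gam \<Gamma>"

lemma d_refl [simp]: "d x x = 0"
  by (simp add: gam_def)

text \<open>Condition (G) with radius \<open>d x y\<close>: as \<open>x\<close> is not in the ball
  of this radius about \<open>y\<close>, the two balls shrunk by \<theta> cannot share the point
  \<open>z\<close>.\<close>

lemma quasi_triangle: "d x y \<le> max (d x z) (d z y) / \<theta>"
proof (rule ccontr)
  assume neg: "\<not> d x y \<le> max (d x z) (d z y) / \<theta>"
  have "0 \<le> max (d x z) (d z y) / \<theta>" using \<theta> gam_nonneg[of x z] by (simp add: max.coboundedI1)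
  then have r: "d x y > 0" using neg by linarith
  have "x \<notin> Gball \<Gamma> y (d x y)" by (simp add: Gball_def gam_sym)
  from G[OF r this] have "z \<notin> Gball \<Gamma> x (\<theta> * d x y) \<or> z \<notin> Gball \<Gamma> y (\<theta> * d x y)" by blast
  then have "\<theta> * d x y \<le> max (d x z) (d z y)" by (auto simp: Gball_def gam_sym)
  then show False using neg \<theta> by (simp add: field_simps)
qed

lemma quasi_triangle_le:
  assumes "d x z \<le> m" "d z y \<le> m" shows "d x y \<le> m / \<theta>"
proof -
  have "max (d x z) (d z y) / \<theta> \<le> m / \<theta>" using assms \<theta> by (intro divide_right_mono) auto
  then show ?thesis using quasi_triangle[of x y z] by linarith
qed

lemma open_Gball: "open (Gball \<Gamma> x r)"
  unfolding Gball_def using gam_continuous[of x]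
  by (intro open_Collect_less continuous_on_const) auto

lemma centre_in_Gball: "r > 0 \<Longrightarrow> x \<in> Gball \<Gamma> x r"
  by (simp add: Gball_def)

lemma bounded_d_le: "bounded {y. d x y \<le> r}"
proof -
  define e where "e = 1 / (\<bar>r\<bar> + 1)"
  have "e > 0" by (simp add: e_def add_nonneg_pos)
  from order_tendstoD(2)[OF Gamma_tendsto_0 this, of x]
  obtain b where b: "\<And>y. b \<le> norm y \<Longrightarrow> \<Gamma> x y < e" by (auto simp: eventually_at_infinity)
  have "norm y \<le> max b (norm x)" if "d x y \<le> r" for y
  proof (rule ccontr)
    assume "\<not> norm y \<le> max b (norm x)"
    then have y: "x \<noteq> y" "\<Gamma> x y < e" using b[of y] by auto
    then have "\<bar>r\<bar> + 1 < 1 / \<Gamma> x y"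
      using Gamma_pos[of x y] by (simp add: e_def field_simps)
    then show False using that y by (simp add: gam_def)
  qed
  then show ?thesis by (auto simp: bounded_iff)
qed

lemma closed_d_le: "closed {y. d x y \<le> r}"
  using gam_continuous[of x] by (intro closed_Collect_le continuous_on_const) auto

text \<open>Small \<Gamma>-balls form a neighbourhood base: \<open>d y\<close> has a positive
  minimum on the compact part of the unit \<Gamma>-ball outside \<open>T\<close>.\<close>

lemma d_ball_subset:
  assumes "open T" "y \<in> T"
  obtains s where "s > 0" "\<And>e. d y e \<le> s \<Longrightarrow> e \<in> T"
proof -
  define K where "K = {e. d y e \<le> 1} - T"
  have "compact ({e. d y e \<le> 1})"
    using bounded_d_le closed_d_le by (simp add: compact_eq_bounded_closed)
  then have K: "compact K" unfolding K_def using assms(1) by (rule compact_diff)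
  show thesis
  proof (cases "K = {}")
    case True
    then show thesis using that[of 1] by (auto simp: K_def)
  next
    case False
    then obtain k where k: "k \<in> K" "\<And>e. e \<in> K \<Longrightarrow> d y k \<le> d y e"
      using continuous_attains_inf[OF K False continuous_on_subset[OF gam_continuous[of y] subset_UNIV]]
      by blast
    have pos: "d y k > 0" using k(1) assms(2) by (intro gam_pos) (auto simp: K_def)
    have "e \<in> T" if "d y e \<le> min 1 (d y k / 2)" for e
    proof (rule ccontr)
      assume "e \<notin> T"
      then have "e \<in> K" using that by (auto simp: K_def)
      then show False using k(2)[of e] that pos by simp
    qed
    then show thesis using that[of "min 1 (d y k / 2)"] pos by simp
  qed
qed

text \<open>A Lebesgue number for \<Gamma>-balls. The covering radii are shrunk by \<theta> to
  absorb the constant of the quasi-triangle inequality.\<close>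

lemma compact_d_ball_subset:
  assumes "compact E" "open T" "E \<subseteq> T"
  obtains s where "s > 0" "\<And>y e. y \<in> E \<Longrightarrow> d y e \<le> s \<Longrightarrow> e \<in> T"
proof -
  have "\<forall>y\<in>E. \<exists>s>0. \<forall>e. d y e \<le> s \<longrightarrow> e \<in> T" 
  proof
    fix y assume "y \<in> E"
    then have "y \<in> T" using assms(3) by blast
    from d_ball_subset[OF assms(2) this] show "\<exists>s>0. \<forall>e. d y e \<le> s \<longrightarrow> e \<in> T" by blast
  qed
  then obtain \<sigma> where \<sigma>: "\<And>y. y \<in> E \<Longrightarrow> \<sigma> y > 0" "\<And>y e. y \<in> E \<Longrightarrow> d y e \<le> \<sigma> y \<Longrightarrow> e \<in> T"
    by metis
  have "E \<subseteq> (\<Union>y\<in>E. Gball \<Gamma> y (\<theta> * \<sigma> y))" using \<sigma>(1) \<theta> by (auto simp: Gball_def)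
  from this obtain D where D: "D \<subseteq> E" "finite D" "E \<subseteq> (\<Union>y\<in>D. Gball \<Gamma> y (\<theta> * \<sigma> y))"
    by (rule compactE_image[OF assms(1) open_Gball]) blast
  define s where "s = Min (insert 1 ((\<lambda>y. \<theta> * \<sigma> y) ` D))"
  have "s > 0" using D(1,2) \<sigma>(1) \<theta> by (auto simp: s_def)
  moreover have "e \<in> T" if "y \<in> E" "d y e \<le> s" for y e
  proof -
    obtain z where z: "z \<in> D" "d z y < \<theta> * \<sigma> z" using D(3) \<open>y \<in> E\<close> by (auto simp: Gball_def)
    have "s \<le> \<theta> * \<sigma> z" unfolding s_def using z(1) D(2) by (intro Min_le) auto
    then have "d z e \<le> (\<theta> * \<sigma> z) / \<theta>" using z(2) that by (intro quasi_triangle_le[of z y]) auto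
    then show ?thesis using \<sigma>(2)[of z e] z(1) D(1) \<theta> by auto
  qed
  ultimately show thesis using that by blast
qed

lemma finite_net:
  assumes "compact E" "s > 0"
  obtains P where "finite P" "P \<subseteq> E" "\<And>e. e \<in> E \<Longrightarrow> \<exists>x\<in>P. d x e < s"
proof -
  have "E \<subseteq> (\<Union>y\<in>E. Gball \<Gamma> y s)" using assms(2) by (auto simp: Gball_def)
  then obtain P where "P \<subseteq> E" "finite P" "E \<subseteq> (\<Union>y\<in>P. Gball \<Gamma> y s)"
    by (rule compactE_image[OF assms(1) open_Gball]) blast
  then show thesis using that[of P] by (auto simp: Gball_def)
qed

text \<open>If the equilibrium potential is small at the origin, then the far part of the potential on
  \<open>P\<close> is small, so the near part is dense at some scale around every point of \<open>P\<close>; the Vitali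
  selection turns this into an efficient covering.\<close>

lemma equilibrium_covering:
  assumes P: "finite P" "S \<subseteq> P" and s: "0 < s" "\<And>x. x \<in> P \<Longrightarrow> s \<le> d 0 x" and p: "1 < p"
    and pot: "\<And>x. x \<in> P \<Longrightarrow> 1/2 \<le> (\<Sum>y\<in>S. s / max s (d x y))"
    and small: "(\<Sum>y\<in>S. s / d 0 y) \<le> \<theta> / 4"
  obtains Q \<rho> where "finite Q" "Q \<subseteq> P" "\<And>q. q \<in> Q \<Longrightarrow> \<rho> q > (0::real)"
    "\<And>x e. x \<in> P \<Longrightarrow> d x e < s \<Longrightarrow> \<exists>q\<in>Q. d q e < \<rho> q"
    "(\<Sum>q\<in>Q. (\<rho> q / d 0 q) powr p) \<le>
      (2 / \<theta>\<^sup>2) powr p * 8 / ((1 - 2 powr (1 - p)) * \<theta>) * (\<Sum>y\<in>S. s / d 0 y)"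
proof -
  define c where "c = (1 - 2 powr (1 - p)) / 8"
  have c: "c > 0" using p by (simp add: c_def powr_less_one)
  have fS: "finite S" using P finite_subset by blast
  have d0: "d 0 y > 0" if "y \<in> P" for y using s that by fastforce
  have "\<exists>r. s \<le> r \<and> r \<le> d 0 x \<and> c * (r / d 0 x) powr p * d 0 x \<le> s * real (card {y \<in> S. d x y < r})"
    if x: "x \<in> P" for x
  proof -
    \<comment> \<open>For a point of \<open>S\<close> at least as far from \<open>x\<close> as the
      origin is, the kernels at \<open>x\<close> and at 0 are comparable. Smallness of the potential
      at 0 limits the far part to 1/4, which leaves 1/4 for the near part.\<close>
    have far: "s / max s (d x y) \<le> s / d 0 y / \<theta>" if "y \<in> S" "\<not> d x y < d 0 x" for y
    proof -
      have le: "\<theta> * d 0 y \<le> d x y"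
        using quasi_triangle_le[of 0 x "d x y" y] that \<theta> by (simp add: field_simps)
      have "s / max s (d x y) \<le> s / d x y"
        using that d0[OF x] s by (intro divide_left_mono) auto
      also have "\<dots> \<le> s / (\<theta> * d 0 y)"
        using le d0[of y] d0[OF x] that P(2) \<theta> s by (intro divide_left_mono mult_pos_pos) auto
      finally show ?thesis by (simp add: mult.commute)
    qed
    have nn: "0 \<le> s / d 0 y / \<theta>" if "y \<in> S" for y
      using d0[of y] that P(2) \<theta> s by auto
    have "(\<Sum>y\<in>{y \<in> S. \<not> d x y < d 0 x}. s / max s (d x y))
        \<le> (\<Sum>y\<in>{y \<in> S. \<not> d x y < d 0 x}. s / d 0 y / \<theta>)"
      using far by (intro sum_mono) auto
    also have "\<dots> \<le> (\<Sum>y\<in>S. s / d 0 y / \<theta>)" using fS nn by (intro sum_mono2) auto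
    also have "\<dots> = (\<Sum>y\<in>S. s / d 0 y) / \<theta>" by (simp add: sum_divide_distrib)
    also have "\<dots> \<le> \<theta> / 4 / \<theta>" using small \<theta> by (intro divide_right_mono) auto
    also have "\<dots> = 1/4" using \<theta> by simp
    finally have "(\<Sum>y\<in>{y \<in> S. \<not> d x y < d 0 x}. s / max s (d x y)) \<le> 1/4" .
    moreover have "(\<Sum>y\<in>S. s / max s (d x y)) = (\<Sum>y\<in>{y \<in> S. d x y < d 0 x}. s / max s (d x y))
        + (\<Sum>y\<in>{y \<in> S. \<not> d x y < d 0 x}. s / max s (d x y))"
      using fS by (subst sum.union_disjoint[symmetric]) (auto intro!: sum.cong)
    ultimately have "1/4 \<le> (\<Sum>y\<in>{y \<in> S. d x y < d 0 x}. s / max s (d x y))"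
      using pot[OF x] by linarith
    from dyadic_density[OF fS s(1) s(2)[OF x] p this] show ?thesis unfolding c_def by blast
  qed
  then have "\<forall>x\<in>P. \<exists>r. s \<le> r \<and> r \<le> d 0 x \<and>
      c * (r / d 0 x) powr p * d 0 x \<le> s * real (card {y \<in> S. d x y < r})"
    by blast
  from bchoice[OF this] obtain r where r': "\<forall>x\<in>P. s \<le> r x \<and> r x \<le> d 0 x \<and>
      c * (r x / d 0 x) powr p * d 0 x \<le> s * real (card {y \<in> S. d x y < r x})"
    by blast
  then have r: "\<And>x. x \<in> P \<Longrightarrow> s \<le> r x" "\<And>x. x \<in> P \<Longrightarrow> r x \<le> d 0 x"
    "\<And>x. x \<in> P \<Longrightarrow> c * (r x / d 0 x) powr p * d 0 x \<le> s * real (card {y \<in> S. d x y < r x})"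
    by blast+
  have "\<exists>Q\<subseteq>P. disjoint_family_on (\<lambda>x. Gball \<Gamma> x (r x)) Q \<and>
      (\<forall>x\<in>P. \<exists>q\<in>Q. Gball \<Gamma> x (r x) \<inter> Gball \<Gamma> q (r q) \<noteq> {} \<and> r x \<le> r q)"
  proof (rule finite_Vitali[OF P(1)])
    show "Gball \<Gamma> x (r x) \<noteq> {}" if "x \<in> P" for x
      using centre_in_Gball[of "r x" x] r(1)[OF that] s by auto
  qed
  then obtain Q where Q: "Q \<subseteq> P" "disjoint_family_on (\<lambda>x. Gball \<Gamma> x (r x)) Q"
    "\<forall>x\<in>P. \<exists>q\<in>Q. Gball \<Gamma> x (r x) \<inter> Gball \<Gamma> q (r q) \<noteq> {} \<and> r x \<le> r q"
    by (elim exE conjE)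
  \<comment> \<open>Two uses of the quasi-triangle inequality lead from \<open>q\<close> to a point
    near \<open>x\<close>; the factor 2 makes the resulting inequality strict.\<close>
  define \<rho> where "\<rho> q = 2 / \<theta>\<^sup>2 * r q" for q
  have rpos: "r q > 0" if "q \<in> P" for q using r(1)[OF that] s by simp
  show thesis
  proof (rule that)
    show fQ: "finite Q" using Q(1) P(1) finite_subset by blast
    show "Q \<subseteq> P" by fact
    show "\<rho> q > 0" if "q \<in> Q" for q using rpos that Q(1) \<theta> by (auto simp: \<rho>_def)
    show "\<exists>q\<in>Q. d q e < \<rho> q" if x: "x \<in> P" and e: "d x e < s" for x e
    proof -
      obtain q z where q: "q \<in> Q" "d x z < r x" "d q z < r q" "r x \<le> r q"
        using bspec[OF Q(3) x] by (auto simp: Gball_def)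
      have "d q x \<le> r q / \<theta>" using q by (intro quasi_triangle_le[of q z]) (auto simp: gam_sym)
      moreover have "d x e \<le> r q / \<theta>"
      proof -
        have "d x e \<le> r q" using e r(1)[OF x] q(4) by simp
        also have "r q \<le> r q / \<theta>" using \<theta> rpos[of q] q(1) Q(1) by (auto simp: field_simps)
        finally show ?thesis .
      qed
      ultimately have "d q e \<le> r q / \<theta> / \<theta>" by (rule quasi_triangle_le)
      also have "\<dots> < \<rho> q"
        using rpos[of q] q(1) Q(1) \<theta> by (auto simp: \<rho>_def power2_eq_square field_simps)
      finally show ?thesis using q(1) by blast
    qed
    \<comment> \<open>The dense scale at \<open>q\<close> charges the content of the selected ball
      to the points of \<open>S\<close> inside it. Disjointness then lets all charges be paid by the
      single potential at 0.\<close>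
    have each: "(\<rho> q / d 0 q) powr p \<le> (2 / \<theta>\<^sup>2) powr p / c / \<theta> * (\<Sum>y\<in>{y \<in> S. d q y < r q}. s / d 0 y)"
      if "q \<in> Q" for q
    proof -
      have qP: "q \<in> P" using that Q(1) by blast
      let ?Sq = "{y \<in> S. d q y < r q}"
      have "s / d 0 q \<le> s / d 0 y / \<theta>" if y: "y \<in> ?Sq" for y
      proof -
        have "\<theta> * d 0 y \<le> d 0 q"
          using quasi_triangle_le[of 0 q "d 0 q" y] y r(2)[OF qP] \<theta> by (simp add: field_simps)
        moreover have "d 0 y > 0" using y P(2) d0 by auto
        ultimately have "s / d 0 q \<le> s / (\<theta> * d 0 y)"
          using s \<theta> d0[OF qP] by (intro divide_left_mono mult_pos_pos) auto
        then show ?thesis by (simp add: mult.commute)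
      qed
      then have "(\<Sum>y\<in>?Sq. s / d 0 q) \<le> (\<Sum>y\<in>?Sq. s / d 0 y / \<theta>)" by (rule sum_mono)
      then have le: "s * real (card ?Sq) / d 0 q \<le> (\<Sum>y\<in>?Sq. s / d 0 y) / \<theta>"
        by (simp add: sum_divide_distrib mult.commute)
      have "(r q / d 0 q) powr p \<le> s * real (card ?Sq) / d 0 q / c"
        using r(3)[OF qP] c d0[OF qP] by (simp add: field_simps)
      also have "\<dots> \<le> (\<Sum>y\<in>?Sq. s / d 0 y) / \<theta> / c" using le c by (intro divide_right_mono) auto
      finally have "(2 / \<theta>\<^sup>2) powr p * (r q / d 0 q) powr p \<le>
          (2 / \<theta>\<^sup>2) powr p * ((\<Sum>y\<in>?Sq. s / d 0 y) / \<theta> / c)"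
        by (rule mult_left_mono) simp
      moreover have "(\<rho> q / d 0 q) powr p = (2 / \<theta>\<^sup>2) powr p * (r q / d 0 q) powr p"
        using rpos[OF qP] d0[OF qP] by (simp add: \<rho>_def flip: powr_mult)
      ultimately show ?thesis by (simp add: mult_ac)
    qed
    have disj: "\<forall>i\<in>Q. \<forall>j\<in>Q. i \<noteq> j \<longrightarrow> {y \<in> S. d i y < r i} \<inter> {y \<in> S. d j y < r j} = {}"
      using Q(2) unfolding disjoint_family_on_def Gball_def by blast
    have "(\<Sum>q\<in>Q. (\<rho> q / d 0 q) powr p)
        \<le> (\<Sum>q\<in>Q. (2 / \<theta>\<^sup>2) powr p / c / \<theta> * (\<Sum>y\<in>{y \<in> S. d q y < r q}. s / d 0 y))"
      using each by (rule sum_mono)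
    also have "\<dots> = (2 / \<theta>\<^sup>2) powr p / c / \<theta> * (\<Sum>q\<in>Q. \<Sum>y\<in>{y \<in> S. d q y < r q}. s / d 0 y)"
      by (simp add: sum_distrib_left)
    also have "(\<Sum>q\<in>Q. \<Sum>y\<in>{y \<in> S. d q y < r q}. s / d 0 y)
        = (\<Sum>y\<in>(\<Union>q\<in>Q. {y \<in> S. d q y < r q}). s / d 0 y)"
      using fQ fS disj by (intro sum.UNION_disjoint[symmetric]) simp_all
    also have "\<dots> \<le> (\<Sum>y\<in>S. s / d 0 y)"
      using fS s d0 P(2) by (intro sum_mono2) (auto intro!: divide_nonneg_nonneg gam_nonneg)
    finally show "(\<Sum>q\<in>Q. (\<rho> q / d 0 q) powr p) \<le>
      (2 / \<theta>\<^sup>2) powr p * 8 / ((1 - 2 powr (1 - p)) * \<theta>) * (\<Sum>y\<in>S. s / d 0 y)"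
      using c \<theta> by (simp add: c_def mult_left_mono divide_right_mono)
  qed
qed

end

subsection \<open>Coverings of the complement when the maximum principle fails\<close>

context Gamma_quasi_metric
begin

text \<open>A discrete boundedness principle: up to the factor 1/\<theta>, the potential at
  \<open>x\<close> is at most its regularized value at the point of \<open>S\<close> nearest to
  \<open>x\<close>, where 3/2 is available.\<close>

lemma equilibrium_potential_le:
  assumes S: "finite S" and s: "0 < s"
    and eq: "\<And>y. y \<in> S \<Longrightarrow> (\<Sum>z\<in>S. s / max s (d y z)) \<le> 3/2"
    and x: "\<And>y. y \<in> S \<Longrightarrow> s \<le> d y x"
  shows "(\<Sum>z\<in>S. s / d z x) \<le> 3 / (2 * \<theta>)"
proof (cases "S = {}")
  case True
  then show ?thesis using \<theta> by simp
next
  case False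
  have "Min ((\<lambda>y. d y x) ` S) \<in> (\<lambda>y. d y x) ` S" using False S by (intro Min_in) auto
  then obtain y where y: "y \<in> S" "d y x = Min ((\<lambda>y. d y x) ` S)" by auto
  have "s / d z x \<le> s / max s (d y z) / \<theta>" if z: "z \<in> S" for z
  proof -
    have dz: "s \<le> d z x" "d z x > 0" using x[OF z] s by auto
    have "d y x \<le> d z x" using y(2) z S by simp
    then have "d y z \<le> d z x / \<theta>" by (intro quasi_triangle_le[of y x]) (auto simp: gam_sym)
    moreover have "s \<le> d z x / \<theta>" using order_trans[OF mult_left_le_one_le[of s \<theta>] dz(1)] s \<theta> by (simp add: field_simps)
    ultimately have "\<theta> * max s (d y z) \<le> d z x" using \<theta> by (simp add: field_simps max_def)
    then have "s / d z x \<le> s / (\<theta> * max s (d y z))"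
      using s \<theta> dz by (intro divide_left_mono mult_pos_pos) auto
    then show ?thesis by (simp add: mult.commute)
  qed
  then have "(\<Sum>z\<in>S. s / d z x) \<le> (\<Sum>z\<in>S. s / max s (d y z) / \<theta>)" by (rule sum_mono)
  also have "\<dots> = (\<Sum>z\<in>S. s / max s (d y z)) / \<theta>" by (simp add: sum_divide_distrib)
  also have "\<dots> \<le> (3/2) / \<theta>" using eq[OF y(1)] \<theta> by (intro divide_right_mono) auto
  finally show ?thesis by simp
qed

text \<open>The singularities of the potential of \<open>S\<close> do no harm: they are hidden in small balls
  on which \<open>w\<close> is small, and off these balls the potential is at most \<open>3 / (2\<theta>)\<close>.\<close>

lemma potential_comparison:
  assumes O: "open \<Omega>" and w: "(\<lambda>x. ereal (w x)) \<in> subharm_bdd V A UNIV"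
    and M: "\<And>x. w x \<le> M" "0 \<le> M" and w0: "\<And>x. x \<notin> \<Omega> \<Longrightarrow> w x = 0"
    and S: "finite S" and s: "0 < s" and \<epsilon>: "0 < \<epsilon>"
    and eq: "\<And>y. y \<in> S \<Longrightarrow> (\<Sum>z\<in>S. s / max s (d y z)) \<le> 3/2"
    and near: "\<And>y e. y \<in> S \<Longrightarrow> d y e \<le> s \<Longrightarrow> w e < \<epsilon>"
    and x: "x \<in> \<Omega>" "\<And>y. y \<in> S \<Longrightarrow> s < d y x"
  shows "w x \<le> M + \<epsilon> - 2 * \<theta> * M / 3 * (\<Sum>y\<in>S. s / d y x)"
proof -
  \<comment> \<open>The largest factor for which \<open>k\<close> times the bound
    \<open>3 / (2 * \<theta>)\<close> does not exceed \<open>M\<close>, so \<open>h\<close> stays at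
    least \<epsilon> off the small balls.\<close>
  define k where "k = 2 * \<theta> * M / 3"
  have k: "0 \<le> k" using M(2) \<theta> by (simp add: k_def)
  define h where "h z = (M + \<epsilon>) + (- k) * (\<Sum>y\<in>S. s * \<Gamma> y z)" for z
  have Sc: "open (- S)" using S by (simp add: finite_imp_closed open_Compl)
  have "harmonic_on V A (- S) h" unfolding h_def[abs_def]
    by (intro harmonic_on_add harmonic_on_const harmonic_on_cmult harmonic_on_sum Sc
        harmonic_on_subset[OF Gamma_harmonic]) auto
  note hh = this
  have hc: "continuous_on (- S) h" using hh by (simp add: harmonic_on_def smooth_on_imp_continuous_on)
  have heq: "h z = M + \<epsilon> - k * (\<Sum>y\<in>S. s / d y z)" if "z \<notin> S" for z
  proof -
    have "s * \<Gamma> y z = s / d y z" if "y \<in> S" for y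
      using that \<open>z \<notin> S\<close> Gamma_pos[of y z] by (auto simp: gam_def)
    then show ?thesis by (simp add: h_def)
  qed
  have hge: "\<epsilon> \<le> h z" if "\<And>y. y \<in> S \<Longrightarrow> s \<le> d y z" for z
  proof -
    have "z \<notin> S" using that[of z] s by auto
    have "k * (\<Sum>y\<in>S. s / d y z) \<le> k * (3 / (2 * \<theta>))"
      using k by (intro mult_left_mono equilibrium_potential_le[OF S s eq that]) auto
    also have "\<dots> = M" using \<theta> by (simp add: k_def)
    finally show ?thesis using heq[OF \<open>z \<notin> S\<close>] by simp
  qed
  have "((\<lambda>z. k * (\<Sum>y\<in>S. s * \<Gamma> y z)) \<longlongrightarrow> k * (\<Sum>y\<in>S. s * 0)) at_infinity"
    by (intro tendsto_mult tendsto_sum tendsto_const Gamma_tendsto_0)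
  then have "((\<lambda>z. k * (\<Sum>y\<in>S. s * \<Gamma> y z)) \<longlongrightarrow> 0) at_infinity" by simp
  from order_tendstoD(2)[OF this \<epsilon>]
  obtain b where b: "\<And>z. b \<le> norm z \<Longrightarrow> k * (\<Sum>y\<in>S. s * \<Gamma> y z) < \<epsilon>"
    by (auto simp: eventually_at_infinity)
  \<comment> \<open>On this sphere the potential is negligible and \<open>h\<close> is at least
    \<open>M\<close>; the truncation makes the comparison domain bounded.\<close>
  define \<rho> where "\<rho> = max b (norm x) + 1"
  define W where "W = (\<Omega> \<inter> (\<Inter>y\<in>S. {z. s < d y z})) \<inter> ball 0 \<rho>"
  have Wo: "open W" unfolding W_def
    using O S gam_continuous by (intro open_Int open_INT ballI open_Collect_less continuous_on_const) auto
  have cW: "s \<le> d y z" if "z \<in> closure W" "y \<in> S" for y z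
  proof -
    have "closed {z. s \<le> d y z}"
      using gam_continuous by (intro closed_Collect_le continuous_on_const) auto
    moreover have "W \<subseteq> {z. s \<le> d y z}" using \<open>y \<in> S\<close> by (auto simp: W_def intro: less_imp_le)
    ultimately show ?thesis using that(1) closure_minimal by blast
  qed
  have cWS: "closure W \<subseteq> - S"
  proof
    fix z assume z: "z \<in> closure W"
    show "z \<in> - S" using cW[OF z, of z] s by auto
  qed
  have "ereal (w x) \<le> ereal (h x)"
  proof (rule subharm_bdd_le[OF w Wo])
    show "bounded W" unfolding W_def by (intro bounded_Int) auto
    have "W \<subseteq> - S" using cWS closure_subset[of W] by (rule subset_trans[rotated])
    then show "harmonic_on V A W h" by (rule harmonic_on_subset[OF hh])
    show "continuous_on (closure W) h" using hc cWS by (rule continuous_on_subset)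
    show "x \<in> W" using x by (auto simp: W_def \<rho>_def)
    show "ereal (w z) \<le> ereal (h z)" if z: "z \<in> frontier W" for z
    proof -
      have zc: "z \<in> closure W" "z \<notin> W" using z Wo by (auto simp: frontier_def interior_open)
      have ge: "\<epsilon> \<le> h z" using cW[OF zc(1)] by (rule hge)
      consider "\<rho> \<le> norm z" | "z \<notin> \<Omega>" | y where "y \<in> S" "d y z \<le> s"
        using zc(2) by (force simp: W_def)
      then have "w z \<le> h z"
      proof cases
        case 1
        then have "k * (\<Sum>y\<in>S. s * \<Gamma> y z) < \<epsilon>" by (intro b) (simp add: \<rho>_def)
        then have "M \<le> h z" by (simp add: h_def)
        then show ?thesis using M(1)[of z] by simp
      next
        case 2
        then show ?thesis using w0[of z] ge \<epsilon> by simp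
      next
        case 3
        then show ?thesis using near[of y z] ge by simp
      qed
      then show ?thesis by simp
    qed
  qed simp
  moreover have "x \<notin> S" using x(2)[of x] s by auto
  ultimately show ?thesis using heq[of x] by (simp add: k_def)
qed

text \<open>The inner radius depends only on a point where \<open>w\<close> is almost maximal. It is
  fixed before \<open>R1\<close>, which allows arbitrarily wide annuli at one fixed cost
  \<open>t0\<close>.\<close>

lemma small_coverings_of_complement:
  assumes O: "open \<Omega>" and nMP: "\<not> max_principle_set V A \<Omega>" and p: "1 < p" and t0: "0 < t0"
  obtains R0 where "0 < R0"
    "\<And>R1. \<exists>Q \<rho>. finite Q \<and> (\<forall>q\<in>Q. 0 < \<rho> q \<and> q \<noteq> 0) \<and>
       - \<Omega> \<inter> {e. R0 \<le> d 0 e \<and> d 0 e \<le> R1} \<subseteq> (\<Union>q\<in>Q. Gball \<Gamma> q (\<rho> q)) \<and>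
       (\<Sum>q\<in>Q. (\<rho> q / d 0 q) powr p) \<le> t0"
proof -
  obtain w z where w: "(\<lambda>x. ereal (w x)) \<in> subharm_bdd V A UNIV"
    "\<And>x. 0 \<le> w x" "\<And>x. x \<notin> \<Omega> \<Longrightarrow> w x = 0" "w z > 0"
    using not_max_principle_obtain[OF O nMP] by metis
  obtain B where B: "\<And>x. w x \<le> B" using w(1) by (auto simp: subharm_bdd_def)
  define M where "M = (SUP x. w x)"
  have bdd: "bdd_above (range w)" using B by (auto simp: bdd_above_def)
  have M: "w x \<le> M" for x unfolding M_def by (rule cSUP_upper[OF _ bdd]) simp
  have Mpos: "0 < M" using M[of z] w(4) by simp
  define c where "c = (2 / \<theta>\<^sup>2) powr p * 8 / ((1 - 2 powr (1 - p)) * \<theta>)"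
  have c: "0 < c" using p \<theta> by (simp add: c_def powr_less_one)
  \<comment> \<open>A target for the potential at 0: the first bound is required by the covering
    lemma, the second keeps the content within \<open>t0\<close>.\<close>
  define t where "t = min (\<theta> / 4) (t0 / c)"
  have t: "0 < t" "t \<le> \<theta> / 4" "c * t \<le> t0"
    using c t0 \<theta> by (auto simp: t_def min_def field_simps)
  \<comment> \<open>One factor \<theta> comes from the constant in the comparison, the other from
    moving the potential from \<open>x0\<close> to the origin.\<close>
  define \<eta> where "\<eta> = 2 * \<theta>\<^sup>2 / 3 * t"
  have \<eta>: "0 < \<eta>" "\<eta> \<le> 1"
  proof -
    show "0 < \<eta>" using t \<theta> by (simp add: \<eta>_def)
    have "\<theta>\<^sup>2 * t \<le> 1 * 1" using t \<theta> by (intro mult_mono power_le_one) auto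
    then show "\<eta> \<le> 1" by (simp add: \<eta>_def)
  qed
  have "M - M * \<eta> / 2 < M" using Mpos \<eta> by simp
  then obtain x0 where x0: "M - M * \<eta> / 2 < w x0"
    unfolding M_def using less_cSUP_iff[OF _ bdd] by auto
  define \<epsilon> where "\<epsilon> = M * \<eta> / 2"
  have \<epsilon>: "0 < \<epsilon>" using Mpos \<eta> by (simp add: \<epsilon>_def)
  have "M * \<eta> \<le> M" using Mpos \<eta> by simp
  then have wx0: "\<epsilon> < w x0" using x0 by (simp add: \<epsilon>_def)
  then have x0O: "x0 \<in> \<Omega>" using w(3) \<epsilon> by force
  \<comment> \<open>Seen from points beyond this radius, \<open>x0\<close> and the origin are at
    comparable distances.\<close>
  define R0 where "R0 = d 0 x0 + 1"
  have R0: "0 < R0" using gam_nonneg[of 0 x0] by (simp add: R0_def)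
  show thesis
  proof (rule that[OF R0])
    fix R1
    define E where "E = - \<Omega> \<inter> {e. R0 \<le> d 0 e \<and> d 0 e \<le> R1}"
    have "closed E" unfolding E_def using O gam_continuous
      by (intro closed_Int closed_Compl closed_Collect_conj closed_Collect_le continuous_on_const) auto
    moreover have "bounded E" by (rule bounded_subset[OF bounded_d_le[of 0 R1]]) (auto simp: E_def)
    ultimately have E: "compact E" by (simp add: compact_eq_bounded_closed)
    have "open {x. ereal (w x) < ereal \<epsilon>}" using usc_UNIV[OF w(1)] .
    moreover have "E \<subseteq> {x. ereal (w x) < ereal \<epsilon>}" using w(3) \<epsilon> by (auto simp: E_def)
    ultimately obtain s' where s': "0 < s'" "\<And>y e. y \<in> E \<Longrightarrow> d y e \<le> s' \<Longrightarrow> e \<in> {x. ereal (w x) < ereal \<epsilon>}"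
      using compact_d_ball_subset[OF E] by metis
    define s where "s = min s' R0"
    have s: "0 < s" "s \<le> R0" using s'(1) R0 by (auto simp: s_def)
    have near: "w e < \<epsilon>" if "y \<in> E" "d y e \<le> s" for y e
      using s'(2)[of y e] that by (simp add: s_def)
    obtain P where P: "finite P" "P \<subseteq> E" "\<And>e. e \<in> E \<Longrightarrow> \<exists>x\<in>P. d x e < s"
      by (rule finite_net[OF E s(1)]) blast
    have dP: "R0 \<le> d 0 y" if "y \<in> P" for y using P(2) that by (auto simp: E_def)
    obtain S where S: "S \<subseteq> P" "\<And>y. y \<in> P \<Longrightarrow> 1/2 \<le> (\<Sum>z\<in>S. s / max s (d y z))"
      "\<And>y. y \<in> S \<Longrightarrow> (\<Sum>z\<in>S. s / max s (d y z)) \<le> 3/2"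
    proof (rule equilibrium_subset[OF P(1), of "\<lambda>y z. s / max s (d y z)"])
    qed (use s in \<open>auto simp: gam_sym\<close>)
    have fS: "finite S" using S(1) P(1) finite_subset by blast
    have SE: "S \<subseteq> E" using S(1) P(2) by blast
    \<comment> \<open>Near \<open>S\<close> the function \<open>w\<close> is below \<epsilon>,
      whereas \<open>w x0\<close> is larger; so the comparison applies at \<open>x0\<close>.\<close>
    have far: "s < d y x0" if "y \<in> S" for y
      using near[of y x0] that SE wx0 by force
    have "w x0 \<le> M + \<epsilon> - 2 * \<theta> * M / 3 * (\<Sum>y\<in>S. s / d y x0)"
      using near SE by (intro potential_comparison[OF O w(1) M _ w(3) fS s(1) \<epsilon> S(3) _ x0O far])
        (use Mpos in auto)
    then have "2 * \<theta> * M / 3 * (\<Sum>y\<in>S. s / d y x0) \<le> M * \<eta>" using x0 by (simp add: \<epsilon>_def)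
    then have "M * (2 * \<theta> / 3 * (\<Sum>y\<in>S. s / d y x0)) \<le> M * \<eta>" by (simp add: mult_ac)
    then have "2 * \<theta> / 3 * (\<Sum>y\<in>S. s / d y x0) \<le> \<eta>" using Mpos by simp
    moreover have "\<theta> * (\<Sum>y\<in>S. s / d 0 y) \<le> (\<Sum>y\<in>S. s / d y x0)"
      unfolding sum_distrib_left
    proof (rule sum_mono)
      fix y assume y: "y \<in> S"
      have R: "R0 \<le> d 0 y" using dP y S(1) by auto
      have "d y x0 \<le> d 0 y / \<theta>"
        using R by (intro quasi_triangle_le[of y 0]) (auto simp: gam_sym R0_def)
      then have "s / (d 0 y / \<theta>) \<le> s / d y x0"
        using far[OF y] s R R0 \<theta> by (intro divide_left_mono mult_pos_pos divide_pos_pos) auto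
      then show "\<theta> * (s / d 0 y) \<le> s / d y x0" by (simp add: mult.commute)
    qed
    then have "2 * \<theta> / 3 * (\<theta> * (\<Sum>y\<in>S. s / d 0 y)) \<le> 2 * \<theta> / 3 * (\<Sum>y\<in>S. s / d y x0)"
      using \<theta> by (intro mult_left_mono) auto
    ultimately have "2 * \<theta>\<^sup>2 / 3 * (\<Sum>y\<in>S. s / d 0 y) \<le> 2 * \<theta>\<^sup>2 / 3 * t"
      by (simp add: \<eta>_def power2_eq_square mult_ac)
    then have le: "(\<Sum>y\<in>S. s / d 0 y) \<le> t" using \<theta> by simp
    have "s \<le> d 0 x" if "x \<in> P" for x using dP[OF that] s by simp
    from equilibrium_covering[OF P(1) S(1) s(1) this p S(2) order_trans[OF le t(2)]]
    obtain Q \<rho> where Q: "finite Q" "Q \<subseteq> P" "\<And>q. q \<in> Q \<Longrightarrow> \<rho> q > 0"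
      "\<And>x e. x \<in> P \<Longrightarrow> d x e < s \<Longrightarrow> \<exists>q\<in>Q. d q e < \<rho> q"
      "(\<Sum>q\<in>Q. (\<rho> q / d 0 q) powr p) \<le> c * (\<Sum>y\<in>S. s / d 0 y)"
      unfolding c_def by blast
    have "c * (\<Sum>y\<in>S. s / d 0 y) \<le> c * t" using le c by simp
    then have "(\<Sum>q\<in>Q. (\<rho> q / d 0 q) powr p) \<le> t0" using Q(5) t(3) by linarith
    moreover have "E \<subseteq> (\<Union>q\<in>Q. Gball \<Gamma> q (\<rho> q))"
    proof
      fix e assume "e \<in> E"
      then obtain x where "x \<in> P" "d x e < s" using P(3) by blast
      from Q(4)[OF this] show "e \<in> (\<Union>q\<in>Q. Gball \<Gamma> q (\<rho> q))" by (auto simp: Gball_def)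
    qed
    moreover have "q \<noteq> 0" if "q \<in> Q" for q
    proof
      assume "q = 0"
      then show False using dP[of q] Q(2) that R0 by auto
    qed
    ultimately show "\<exists>Q \<rho>. finite Q \<and> (\<forall>q\<in>Q. 0 < \<rho> q \<and> q \<noteq> 0) \<and>
       - \<Omega> \<inter> {e. R0 \<le> d 0 e \<and> d 0 e \<le> R1} \<subseteq> (\<Union>q\<in>Q. Gball \<Gamma> q (\<rho> q)) \<and>
       (\<Sum>q\<in>Q. (\<rho> q / d 0 q) powr p) \<le> t0"
      using Q(1,3) unfolding E_def by blast
  qed
qed

end

text \<open>The definition asks for index sets of naturals and an extended infinite sum. Re-indexing
  through \<open>to_nat_on\<close> reduces this to a uniform bound on finite real sums over any
  countable family.\<close>

lemma p_boundedI:
  fixes z :: "'i \<Rightarrow> real^'n::finite"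
  assumes I: "countable I" and zr: "\<And>i. i \<in> I \<Longrightarrow> z i \<noteq> 0" "\<And>i. i \<in> I \<Longrightarrow> 0 < r i"
    and F: "F \<subseteq> (\<Union>i\<in>I. Gball \<Gamma> (z i) (r i))"
    and T: "\<And>I'. finite I' \<Longrightarrow> I' \<subseteq> I \<Longrightarrow> (\<Sum>i\<in>I'. (r i / gam \<Gamma> 0 (z i)) powr p) \<le> T"
  shows "p_bounded \<Gamma> p F"
proof -
  define J where "J = to_nat_on I ` I"
  define g where "g = from_nat_into I"
  have g: "g (to_nat_on I i) = i" if "i \<in> I" for i unfolding g_def using I that by simp
  have gI: "g n \<in> I" if "n \<in> J" for n using that g by (auto simp: J_def)
  have inj: "inj_on g J" by (rule inj_on_inverseI[of _ "to_nat_on I"]) (auto simp: J_def g)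
  let ?f = "\<lambda>n. if z (g n) = 0 then \<infinity> else ennreal ((r (g n) / gam \<Gamma> 0 (z (g n))) powr p)"
  have "(\<Sum>\<^sub>\<infinity>n\<in>J. ?f n) \<le> ennreal T"
  proof (rule infsum_le_finite_sums)
    fix J' assume J': "finite J'" "J' \<subseteq> J"
    have "sum ?f J' = (\<Sum>n\<in>J'. ennreal ((r (g n) / gam \<Gamma> 0 (z (g n))) powr p))"
      using J'(2) gI zr(1) by (intro sum.cong) auto
    also have "\<dots> = ennreal (\<Sum>n\<in>J'. (r (g n) / gam \<Gamma> 0 (z (g n))) powr p)" by simp
    also have "(\<Sum>n\<in>J'. (r (g n) / gam \<Gamma> 0 (z (g n))) powr p) =
        (\<Sum>i\<in>g ` J'. (r i / gam \<Gamma> 0 (z i)) powr p)"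
      using inj_on_subset[OF inj J'(2)] by (simp add: sum.reindex)
    also have "ennreal \<dots> \<le> ennreal T"
      using J' gI by (intro ennreal_leI T) auto
    finally show "sum ?f J' \<le> ennreal T" .
  qed (rule nonneg_summable_on_complete, simp)
  also have "ennreal T < \<infinity>" by simp
  finally have "(\<Sum>\<^sub>\<infinity>n\<in>J. ?f n) < \<infinity>" .
  moreover have "F \<subseteq> (\<Union>n\<in>J. Gball \<Gamma> (z (g n)) (r (g n)))"
    using F g by (force simp: J_def)
  ultimately show ?thesis
    unfolding p_bounded_def using gI zr(2)
    by (intro exI[of _ J] exI[of _ "\<lambda>n. z (g n)"] exI[of _ "\<lambda>n. r (g n)"]) auto
qed

section \<open>Gluing coverings of annuli\<close>

context Gamma_quasi_metric
begin

text \<open>A ball that is small relative to the distance of its centre from 0 stays at comparable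
  distance from 0, which limits the annuli it can meet.\<close>

lemma d_0_in_small_ball:
  assumes "\<rho> \<le> \<theta> / 2 * d 0 q" "d q e < \<rho>"
  shows "\<theta> * d 0 e \<le> d 0 q" "\<theta> * d 0 q \<le> d 0 e"
proof -
  have "0 < \<theta> / 2 * d 0 q" using assms gam_nonneg[of q e] by linarith
  then have q: "d 0 q > 0" using \<theta> by (simp add: zero_less_mult_iff)
  have le: "\<rho> \<le> 1/2 * (\<theta> * d 0 q)" using assms(1) by simp
  have "\<theta> * d 0 q \<le> d 0 q" using \<theta> q by simp
  then have "d q e \<le> d 0 q" using le assms(2) q by linarith
  then have "d 0 e \<le> d 0 q / \<theta>" by (intro quasi_triangle_le[of 0 q]) auto
  then show "\<theta> * d 0 e \<le> d 0 q" using \<theta> by (simp add: field_simps)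
  have "d 0 q \<le> max (d 0 e) (d e q) / \<theta>" by (rule quasi_triangle)
  then have "\<theta> * d 0 q \<le> max (d 0 e) (d e q)" using \<theta> by (simp add: field_simps)
  moreover have "d e q < \<theta> * d 0 q" using assms(2) le mult_pos_pos[OF \<theta>(1) q] by (simp add: gam_sym)
  ultimately show "\<theta> * d 0 q \<le> d 0 e" by auto
qed

lemma ratio_le_of_powr_le:
  assumes "0 \<le> x" "0 < y" "0 < p" "(x / y) powr p \<le> (\<theta> / 2) powr p"
  shows "x \<le> \<theta> / 2 * y"
proof -
  have "x / y \<le> \<theta> / 2"
    using assms \<theta> powr_less_mono2[of p "\<theta> / 2" "x / y"] by force
  then show ?thesis using assms(2) by (simp add: field_simps)
qed

text \<open>Each ball of an efficient covering meets at most two annuli of ratio \<open>2/\<theta>\<^sup>2\<close>. Hence the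
  contents of the annuli have bounded partial sums, and near-optimal coverings of the single
  annuli combine into one countable covering.\<close>

lemma not_max_principle_imp_p_bounded:
  assumes O: "open \<Omega>" and nMP: "\<not> max_principle_set V A \<Omega>" and p: "1 < p"
  shows "p_bounded \<Gamma> p (- \<Omega>)"
proof -
  \<comment> \<open>A total content of this size forces every single ball to be small relative to
    its centre.\<close>
  define t0 where "t0 = (\<theta> / 2) powr p"
  have t0: "0 < t0" using \<theta> by (simp add: t0_def)
  obtain R0 where R0: "0 < R0" and cov: "\<And>R1. \<exists>Q \<rho>. finite Q \<and> (\<forall>q\<in>Q. 0 < \<rho> q \<and> q \<noteq> 0) \<and>
       - \<Omega> \<inter> {e. R0 \<le> d 0 e \<and> d 0 e \<le> R1} \<subseteq> (\<Union>q\<in>Q. Gball \<Gamma> q (\<rho> q)) \<and>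
       (\<Sum>q\<in>Q. (\<rho> q / d 0 q) powr p) \<le> t0"
    by (rule small_coverings_of_complement[OF O nMP p t0]) (rule that)
  \<comment> \<open>A small ball spans a ratio of at most 1/\<theta> squared in distance from 0,
    less than \<open>b\<close>, so it cannot reach past the next annulus.\<close>
  define b where "b = 2 / \<theta>\<^sup>2"
  have \<theta>2: "0 < \<theta>\<^sup>2" "\<theta>\<^sup>2 \<le> 1" using \<theta> by (auto intro: power_le_one)
  have b: "1 < b" "\<theta>\<^sup>2 * b = 2" using \<theta>2 \<theta> by (auto simp: b_def field_simps)
  define E where "E k = - \<Omega> \<inter> {e. R0 * b ^ k \<le> d 0 e \<and> d 0 e < R0 * b ^ Suc k}" for k
  define cost where "cost Q \<rho> = (\<Sum>q\<in>Q. (\<rho> q / d 0 q) powr p)" for Q :: "(real^'n) set" and \<rho>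
  define covers where "covers k Q \<rho> \<longleftrightarrow> finite Q \<and> (\<forall>q\<in>Q. 0 < \<rho> q \<and> q \<noteq> 0) \<and>
      E k \<subseteq> (\<Union>q\<in>Q. Gball \<Gamma> q (\<rho> q))" for k Q and \<rho> :: "real^'n \<Rightarrow> real"
  \<comment> \<open>Coverings for different outer radii are unrelated, but the infimum for one
    annulus does not depend on the outer radius. Working with infima avoids passing to a limit of
    coverings.\<close>
  define X where "X k = {cost Q \<rho> |Q \<rho>. covers k Q \<rho>}" for k
  have cost_nonneg: "0 \<le> cost Q \<rho>" for Q \<rho> by (simp add: cost_def sum_nonneg)
  have bdd: "bdd_below (X k)" for k using cost_nonneg by (auto simp: X_def bdd_below_def)
  have two: "card {k. k < K \<and> E k \<inter> Gball \<Gamma> q \<rho> \<noteq> {}} \<le> 2"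
    if small: "\<rho> \<le> \<theta> / 2 * d 0 q" for K q \<rho>
  proof (cases "{k. k < K \<and> E k \<inter> Gball \<Gamma> q \<rho> \<noteq> {}} = {}")
    case False
    define N where "N = {k. k < K \<and> E k \<inter> Gball \<Gamma> q \<rho> \<noteq> {}}"
    have N: "finite N" "N \<noteq> {}" using False by (auto simp: N_def)
    define m where "m = Min N"
    have m: "m \<in> N" "\<And>k. k \<in> N \<Longrightarrow> m \<le> k" using N by (auto simp: m_def)
    obtain e where e: "e \<in> E m" "d q e < \<rho>" using m(1) by (auto simp: N_def Gball_def)
    have "k \<le> Suc m" if k: "k \<in> N" for k
    proof (rule ccontr)
      assume "\<not> k \<le> Suc m"
      then have km: "Suc (Suc m) \<le> k" by simp
      obtain e' where e': "e' \<in> E k" "d q e' < \<rho>" using k by (auto simp: N_def Gball_def)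
      have "\<theta>\<^sup>2 * d 0 e' \<le> \<theta> * d 0 q"
        using d_0_in_small_ball(1)[OF small e'(2)] \<theta> by (simp add: power2_eq_square)
      also have "\<dots> \<le> d 0 e" by (rule d_0_in_small_ball(2)[OF small e(2)])
      also have "\<dots> < R0 * b ^ Suc m" using e(1) by (simp add: E_def)
      also have "\<dots> \<le> \<theta>\<^sup>2 * (R0 * b ^ Suc (Suc m))"
        using b R0 by (simp add: mult_ac)
      also have "\<dots> \<le> \<theta>\<^sup>2 * (R0 * b ^ k)"
        using km b R0 by (intro mult_left_mono power_increasing) auto
      also have "\<dots> \<le> \<theta>\<^sup>2 * d 0 e'" using e'(1) by (intro mult_left_mono) (auto simp: E_def)
      finally show False by simp
    qed
    then have "N \<subseteq> {m, Suc m}" using m(2) by (force simp: le_Suc_eq)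
    then have "card N \<le> card {m, Suc m}" by (intro card_mono) auto
    then show ?thesis by (simp add: N_def)
  next
    case True
    then show ?thesis by (simp only: card.empty)
  qed
  \<comment> \<open>One covering of the first \<open>K\<close> annuli is split among them, and each
    ball is charged at most twice. Nonemptiness is recorded because an infimum of reals is
    meaningful only then.\<close>
  have partial: "(\<forall>k<K. X k \<noteq> {}) \<and> (\<Sum>k<K. Inf (X k)) \<le> 2 * t0" for K
  proof -
    obtain Q \<rho> where Q: "finite Q" "\<forall>q\<in>Q. 0 < \<rho> q \<and> q \<noteq> 0"
      "- \<Omega> \<inter> {e. R0 \<le> d 0 e \<and> d 0 e \<le> R0 * b ^ K} \<subseteq> (\<Union>q\<in>Q. Gball \<Gamma> q (\<rho> q))"
      "(\<Sum>q\<in>Q. (\<rho> q / d 0 q) powr p) \<le> t0"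
      using cov[of "R0 * b ^ K"] by blast
    have small: "\<rho> q \<le> \<theta> / 2 * d 0 q" if q: "q \<in> Q" for q
    proof (rule ratio_le_of_powr_le)
      have "(\<rho> q / d 0 q) powr p \<le> (\<Sum>q\<in>Q. (\<rho> q / d 0 q) powr p)"
        using q Q(1) by (intro member_le_sum) auto
      then show "(\<rho> q / d 0 q) powr p \<le> (\<theta> / 2) powr p" using Q(4) by (simp add: t0_def)
      show "0 \<le> \<rho> q" using Q(2) q less_imp_le by blast
      show "0 < d 0 q" using Q(2) q gam_pos[of 0 q] by auto
    qed (use p in simp)
    define Qk where "Qk k = {q \<in> Q. E k \<inter> Gball \<Gamma> q (\<rho> q) \<noteq> {}}" for k
    have Ek: "E k \<subseteq> - \<Omega> \<inter> {e. R0 \<le> d 0 e \<and> d 0 e \<le> R0 * b ^ K}" if "k < K" for k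
    proof -
      have "R0 * 1 \<le> R0 * b ^ k" "R0 * b ^ Suc k \<le> R0 * b ^ K"
        using that b R0 by (intro mult_left_mono one_le_power power_increasing; simp)+
      then show ?thesis by (auto simp: E_def)
    qed
    have cv: "covers k (Qk k) \<rho>" if "k < K" for k
    proof -
      have "E k \<subseteq> (\<Union>q\<in>Q. Gball \<Gamma> q (\<rho> q))" using Ek[OF that] Q(3) by (rule subset_trans)
      then have "E k \<subseteq> (\<Union>q\<in>Qk k. Gball \<Gamma> q (\<rho> q))" unfolding Qk_def by blast
      then show ?thesis using Q(1,2) by (auto simp: covers_def Qk_def)
    qed
    have mem: "cost (Qk k) \<rho> \<in> X k" if "k < K" for k using cv[OF that] by (auto simp: X_def)
    have "(\<Sum>k<K. Inf (X k)) \<le> (\<Sum>k<K. cost (Qk k) \<rho>)"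
      using mem bdd by (intro sum_mono cInf_lower) auto
    also have "\<dots> = (\<Sum>k<K. \<Sum>q\<in>Q. if E k \<inter> Gball \<Gamma> q (\<rho> q) \<noteq> {} then (\<rho> q / d 0 q) powr p else 0)"
      using Q(1) by (simp add: cost_def Qk_def sum.If_cases Int_def)
    also have "\<dots> = (\<Sum>q\<in>Q. \<Sum>k<K. if E k \<inter> Gball \<Gamma> q (\<rho> q) \<noteq> {} then (\<rho> q / d 0 q) powr p else 0)"
      by (rule sum.swap)
    also have "\<dots> = (\<Sum>q\<in>Q. real (card {k. k < K \<and> E k \<inter> Gball \<Gamma> q (\<rho> q) \<noteq> {}}) * (\<rho> q / d 0 q) powr p)"
      by (simp add: sum.If_cases Int_def)
    also have "\<dots> \<le> (\<Sum>q\<in>Q. 2 * (\<rho> q / d 0 q) powr p)"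
      using two[OF small] by (intro sum_mono mult_right_mono) force+
    also have "\<dots> \<le> 2 * t0" using Q(4) by (simp flip: sum_distrib_left)
    finally show ?thesis using mem by blast
  qed
  \<comment> \<open>The errors \<open>(1/2) ^ k\<close> are summable, with total at most 2.\<close>
  have "\<exists>Q \<rho>. covers k Q \<rho> \<and> cost Q \<rho> < Inf (X k) + (1/2) ^ k" for k
  proof -
    have "X k \<noteq> {}" using partial[of "Suc k"] by blast
    from cInf_lessD[OF this, of "Inf (X k) + (1/2) ^ k"] show ?thesis by (auto simp: X_def)
  qed
  then obtain Q \<rho> where Q: "\<And>k. covers k (Q k) (\<rho> k)" "\<And>k. cost (Q k) (\<rho> k) < Inf (X k) + (1/2) ^ k"
    by metis
  have sumQ: "(\<Sum>k<K. cost (Q k) (\<rho> k)) \<le> 2 * t0 + 2" for K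
  proof -
    have "(\<Sum>k<K. cost (Q k) (\<rho> k)) \<le> (\<Sum>k<K. Inf (X k) + (1/2) ^ k)"
      using Q(2) by (intro sum_mono less_imp_le) auto
    also have "\<dots> = (\<Sum>k<K. Inf (X k)) + (\<Sum>k<K. (1/2) ^ k)" by (simp add: sum.distrib)
    also have "(\<Sum>k<K. (1/2::real) ^ k) \<le> 2" by (simp add: sum_gp_strict)
    finally show ?thesis using partial[of K] by simp
  qed
  \<comment> \<open>One large ball covers the part near the origin. Its centre must differ from 0,
    where the defining sum is infinite; the coordinate chosen is arbitrary. It takes index 0 below
    and shifts the annuli by one.\<close>
  define z0 :: "real^'n" where "z0 = axis undefined 1"
  have z0: "z0 \<noteq> 0" by (simp add: z0_def axis_eq_0_iff)
  define r0 where "r0 = max (d z0 0) R0 / \<theta> + 1"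
  have r0: "r0 > 0" using R0 \<theta> by (simp add: r0_def add_nonneg_pos)
  define Q' where "Q' k = (case k of 0 \<Rightarrow> {z0} | Suc k \<Rightarrow> Q k)" for k
  define \<rho>' where "\<rho>' k = (case k of 0 \<Rightarrow> (\<lambda>_. r0) | Suc k \<Rightarrow> \<rho> k)" for k
  have Q': "finite (Q' k)" "\<And>q. q \<in> Q' k \<Longrightarrow> q \<noteq> 0 \<and> 0 < \<rho>' k q" for k
    using Q(1) z0 r0 by (auto simp: Q'_def \<rho>'_def covers_def split: nat.splits)
  define T where "T = (r0 / d 0 z0) powr p + (2 * t0 + 2)"
  show ?thesis
  proof (rule p_boundedI[of "Sigma UNIV Q'" snd "\<lambda>(k, q). \<rho>' k q" _ _ _ T])
    show "countable (Sigma UNIV Q')" by (intro countable_SIGMA countableI_type countable_finite[OF Q'(1)])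
    show "snd i \<noteq> 0" if "i \<in> Sigma UNIV Q'" for i using that Q'(2) by auto
    show "0 < (case i of (k, q) \<Rightarrow> \<rho>' k q)" if "i \<in> Sigma UNIV Q'" for i using that Q'(2) by auto
    show "- \<Omega> \<subseteq> (\<Union>i\<in>Sigma UNIV Q'. Gball \<Gamma> (snd i) (case i of (k, q) \<Rightarrow> \<rho>' k q))"
    proof
      fix e assume e: "e \<in> - \<Omega>"
      have "\<exists>k. \<exists>q\<in>Q' k. d q e < \<rho>' k q"
      proof (cases "d 0 e < R0")
        case True
        then have "d z0 e \<le> max (d z0 0) R0 / \<theta>" by (intro quasi_triangle_le[of z0 0]) auto
        then show ?thesis by (intro exI[of _ 0]) (simp add: Q'_def \<rho>'_def r0_def)
      next
        case False
        obtain n where "d 0 e / R0 < b ^ n" using real_arch_pow[OF b(1)] by blast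
        then have n: "d 0 e < R0 * b ^ n" using R0 by (simp add: field_simps)
        define m where "m = (LEAST n. d 0 e < R0 * b ^ n)"
        have m: "d 0 e < R0 * b ^ m" unfolding m_def using n by (rule LeastI)
        then have "m \<noteq> 0" using False by (auto intro: ccontr)
        then obtain k where k: "m = Suc k" by (cases m) auto
        have "\<not> d 0 e < R0 * b ^ k"
          using not_less_Least[of k "\<lambda>n. d 0 e < R0 * b ^ n"] k by (simp add: m_def)
        then have "e \<in> E k" using m k e by (simp add: E_def)
        then obtain q where "q \<in> Q k" "d q e < \<rho> k q"
          using Q(1)[of k] by (auto simp: covers_def Gball_def)
        then show ?thesis by (intro exI[of _ "Suc k"]) (auto simp: Q'_def \<rho>'_def)
      qed
      then show "e \<in> (\<Union>i\<in>Sigma UNIV Q'. Gball \<Gamma> (snd i) (case i of (k, q) \<Rightarrow> \<rho>' k q))"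
        by (auto simp: Gball_def)
    qed
    fix I' assume I': "finite I'" "I' \<subseteq> Sigma UNIV Q'"
    obtain K where K: "fst ` I' \<subseteq> {..<Suc K}"
    proof -
      obtain m where m: "\<forall>n\<in>fst ` I'. n < m"
        using finite_imageI[OF I'(1), of fst] unfolding finite_nat_set_iff_bounded by blast
      have "fst ` I' \<subseteq> {..<Suc m}" using bspec[OF m] by (auto intro: less_SucI)
      then show thesis by (rule that)
    qed
    have "(\<Sum>i\<in>I'. ((case i of (k, q) \<Rightarrow> \<rho>' k q) / d 0 (snd i)) powr p)
        \<le> (\<Sum>i\<in>Sigma {..<Suc K} Q'. ((case i of (k, q) \<Rightarrow> \<rho>' k q) / d 0 (snd i)) powr p)"
      using I' K Q'(1) by (intro sum_mono2) (auto simp: image_subset_iff)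
    also have "\<dots> = (\<Sum>k<Suc K. cost (Q' k) (\<rho>' k))"
      using Q'(1) unfolding cost_def by (subst sum.Sigma) (auto intro!: sum.cong)
    also have "\<dots> = cost {z0} (\<lambda>_. r0) + (\<Sum>k<K. cost (Q k) (\<rho> k))"
      unfolding sum.lessThan_Suc_shift by (simp add: Q'_def \<rho>'_def)
    also have "\<dots> \<le> T" using sumQ[of K] by (simp add: T_def cost_def)
    finally show "(\<Sum>i\<in>I'. ((case i of (k, q) \<Rightarrow> \<rho>' k q) / gam \<Gamma> 0 (snd i)) powr p) \<le> T" .
  qed
qed

end

subsection \<open>Cones\<close>

text \<open>A finite set whose sum is within \<sigma> of the supremum leaves no room for a disjoint
  finite sum above \<sigma>.\<close>

lemma bounded_sums_tail:
  fixes f :: "'i \<Rightarrow> real"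
  assumes "\<And>I. finite I \<Longrightarrow> I \<subseteq> J \<Longrightarrow> sum f I \<le> T" "0 < \<sigma>"
  obtains J0 where "finite J0" "J0 \<subseteq> J" "\<And>I. finite I \<Longrightarrow> I \<subseteq> J - J0 \<Longrightarrow> sum f I \<le> \<sigma>"
proof -
  let ?\<F> = "{I. finite I \<and> I \<subseteq> J}"
  have bdd: "bdd_above (sum f ` ?\<F>)" using assms(1) by (auto simp: bdd_above_def)
  have "{} \<in> ?\<F>" by simp
  then have ne: "?\<F> \<noteq> {}" by blast
  have "(SUP I\<in>?\<F>. sum f I) - \<sigma> < (SUP I\<in>?\<F>. sum f I)" using assms(2) by simp
  then obtain J0 where J0: "J0 \<in> ?\<F>" "(SUP I\<in>?\<F>. sum f I) - \<sigma> < sum f J0"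
    unfolding less_cSUP_iff[OF ne bdd] by blast
  show thesis
  proof (rule that)
    show "finite J0" "J0 \<subseteq> J" using J0(1) by auto
    fix I assume I: "finite I" "I \<subseteq> J - J0"
    have "sum f (J0 \<union> I) \<le> (SUP I\<in>?\<F>. sum f I)"
      using J0(1) I by (intro cSUP_upper[OF _ bdd]) auto
    moreover have "sum f (J0 \<union> I) = sum f J0 + sum f I"
      using J0(1) I by (intro sum.union_disjoint) auto
    ultimately show "sum f I \<le> \<sigma>" using J0(2) by simp
  qed
qed

text \<open>Unpacks the extended sum: a centre at 0 would contribute infinity, so finiteness
  excludes it and bounds all finite real sums.\<close>

lemma p_bounded_sums:
  fixes J :: "nat set"
  assumes "(\<Sum>\<^sub>\<infinity>n\<in>J. if z n = 0 then \<infinity> else ennreal (f n)) < \<infinity>" "\<And>n. 0 \<le> f n"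
  obtains T where "\<And>n. n \<in> J \<Longrightarrow> z n \<noteq> (0::real^'n::finite)" "\<And>I. finite I \<Longrightarrow> I \<subseteq> J \<Longrightarrow> sum f I \<le> T"
proof -
  let ?g = "\<lambda>n. if z n = 0 then \<infinity> else ennreal (f n)"
  let ?s = "\<Sum>\<^sub>\<infinity>n\<in>J. ?g n"
  have le: "sum ?g I \<le> ?s" if "finite I" "I \<subseteq> J" for I
    using that by (subst nonneg_infsum_complete) (auto intro!: SUP_upper)
  have nz: "z n \<noteq> 0" if "n \<in> J" for n
  proof
    assume "z n = 0"
    then have "sum ?g {n} = \<infinity>" by simp
    then show False using le[of "{n}"] that assms(1) by (simp add: top_unique)
  qed
  have "sum f I \<le> enn2real ?s" if I: "finite I" "I \<subseteq> J" for I
  proof -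
    have "ennreal (sum f I) = (\<Sum>n\<in>I. ennreal (f n))" using assms(2) by (simp add: sum_ennreal)
    also have "\<dots> = sum ?g I" using nz I(2) by (intro sum.cong) auto
    also have "\<dots> \<le> ?s" by (rule le[OF I])
    finally have "enn2real (ennreal (sum f I)) \<le> enn2real ?s"
      using assms(1) by (intro enn2real_mono) auto
    then show ?thesis using assms(2) by (simp add: sum_nonneg)
  qed
  with nz show thesis using that by blast
qed

context Gamma_quasi_metric
begin

abbreviation vol :: "real^'n \<Rightarrow> real \<Rightarrow> real" where "vol x r \<equiv> measure lebesgue (Gball \<Gamma> x r)"

lemma lmeasurable_Gball: "Gball \<Gamma> x r \<in> lmeasurable"
proof (rule lmeasurable_open[OF _ open_Gball])
  show "bounded (Gball \<Gamma> x r)"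
    by (rule bounded_subset[OF bounded_d_le[of x r]]) (auto simp: Gball_def)
qed

lemma vol_mono: "Gball \<Gamma> x r \<subseteq> Gball \<Gamma> y r' \<Longrightarrow> vol x r \<le> vol y r'"
  by (intro measure_mono_fmeasurable lmeasurable_Gball fmeasurableD) auto

lemma vol_pos:
  assumes "r > 0" shows "vol x r > 0"
proof -
  have "\<not> negligible (Gball \<Gamma> x r)"
    using open_not_negligible[OF open_Gball] centre_in_Gball[OF assms] by blast
  then have "vol x r \<noteq> 0" using negligible_iff_measure lmeasurable_Gball by blast
  then show ?thesis using measure_nonneg[of lebesgue "Gball \<Gamma> x r"] by linarith
qed

text \<open>Reverse doubling is iterated from radius \<open>t * R\<close> as long as it fits into
  radius \<open>R\<close>. The exponent turns powers of \<alpha> into powers of 2, and the factor 2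
  pays for rounding \<open>t\<close> to a power of 2.\<close>

lemma volume_small_ball:
  assumes \<alpha>: "1 < \<alpha>" "\<And>x r. 0 < r \<Longrightarrow> \<alpha> * vol x r \<le> vol x (2 * r)"
    and t: "0 < t" "t \<le> 1" and R: "0 < R"
  shows "vol x (t * R) \<le> (2 * t) powr log 2 \<alpha> * vol x R"
proof -
  have iter: "\<alpha> ^ k * vol x r \<le> vol x (2 ^ k * r)" if "0 < r" for k r
  proof (induction k)
    case (Suc k)
    have "\<alpha> ^ Suc k * vol x r \<le> \<alpha> * vol x (2 ^ k * r)" using Suc \<alpha>(1) by simp
    also have "\<dots> \<le> vol x (2 * (2 ^ k * r))" using that by (intro \<alpha>(2)) simp
    finally show ?case by (simp add: mult_ac)
  qed simp
  obtain k where k: "2 ^ k * t \<le> 1" "1 < 2 ^ Suc k * t"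
  proof -
    obtain n where "1 / t < 2 ^ n" using real_arch_pow[of 2 "1 / t"] by auto
    then have ex: "1 < 2 ^ n * t" using t by (simp add: field_simps)
    define m where "m = (LEAST n. 1 < 2 ^ n * t)"
    have m: "1 < 2 ^ m * t" unfolding m_def using ex by (rule LeastI)
    then have "m \<noteq> 0" using t by (auto intro: ccontr)
    then obtain j where "m = Suc j" by (cases m) auto
    moreover have "\<not> 1 < 2 ^ j * t"
      using not_less_Least[of j "\<lambda>n. 1 < 2 ^ n * t"] \<open>m = Suc j\<close> by (simp add: m_def)
    ultimately show thesis using m that[of j] by (simp add: not_less)
  qed
  have "2 ^ k * (t * R) \<le> R" using k(1) R by (simp add: mult.assoc[symmetric])
  then have "vol x (2 ^ k * (t * R)) \<le> vol x R"
    by (intro vol_mono) (auto simp: Gball_def)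
  then have v: "\<alpha> ^ k * vol x (t * R) \<le> vol x R"
    using iter[of "t * R" k] t R by simp
  have "1 \<le> (2 ^ k * (2 * t)) powr log 2 \<alpha>"
    using k(2) \<alpha>(1) by (intro ge_one_powr_ge_zero) (simp_all add: mult_ac)
  also have "\<dots> = (2 ^ k) powr log 2 \<alpha> * (2 * t) powr log 2 \<alpha>" using t by (simp add: powr_mult)
  also have "(2 ^ k) powr log 2 \<alpha> = \<alpha> ^ k"
  proof -
    have "(2 ^ k) powr log 2 \<alpha> = (2 powr real k) powr log 2 \<alpha>" by (simp add: powr_realpow)
    also have "\<dots> = (2 powr log 2 \<alpha>) powr real k" by (simp add: powr_powr mult.commute)
    also have "\<dots> = \<alpha> ^ k" using \<alpha>(1) by (simp add: powr_realpow)
    finally show ?thesis .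
  qed
  finally have "vol x (t * R) * 1 \<le> vol x (t * R) * (\<alpha> ^ k * (2 * t) powr log 2 \<alpha>)"
    by (rule mult_left_mono) simp
  also have "\<dots> = (\<alpha> ^ k * vol x (t * R)) * (2 * t) powr log 2 \<alpha>" by simp
  also have "\<dots> \<le> vol x R * (2 * t) powr log 2 \<alpha>" using v by (rule mult_right_mono) simp
  finally show ?thesis by (simp add: mult.commute)
qed

lemma volume_large_ball:
  assumes "0 \<le> \<beta>" "\<And>x r. 0 < r \<Longrightarrow> vol x (2 * r) \<le> \<beta> * vol x r" "0 < r"
  shows "vol x (2 ^ k * r) \<le> \<beta> ^ k * vol x r"
proof (induction k)
  case (Suc k)
  have "vol x (2 ^ Suc k * r) \<le> \<beta> * vol x (2 ^ k * r)"
    using assms(2)[of "2 ^ k * r" x] assms(3) by (simp add: mult.assoc)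
  also have "\<dots> \<le> \<beta> * (\<beta> ^ k * vol x r)" using Suc assms(1) by (rule mult_left_mono)
  finally show ?case by simp
qed simp

text \<open>A cone ball far out is met only by the tail of a covering. With exponent
  \<open>log 2 \<alpha>\<close> the content of a small ball controls its relative volume, so the
  tail has too little volume to cover a fixed fraction of the cone ball.\<close>

lemma cone_not_p_bounded:
  assumes \<alpha>: "2 < \<alpha>" "\<And>x r. 0 < r \<Longrightarrow> \<alpha> * vol x r \<le> vol x (2 * r)"
    and \<beta>: "0 \<le> \<beta>" "\<And>x r. 0 < r \<Longrightarrow> vol x (2 * r) \<le> \<beta> * vol x r"
    and K: "Gcone \<Gamma> K" "K \<subseteq> F"
  shows "\<not> p_bounded \<Gamma> (log 2 \<alpha>) F"
proof
  define p where "p = log 2 \<alpha>"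
  have p: "1 < p" using \<alpha>(1) less_log_of_power[of 2 1 \<alpha>] by (simp add: p_def)
  assume "p_bounded \<Gamma> (log 2 \<alpha>) F"
  then obtain J :: "nat set" and x r where r: "\<And>n. n \<in> J \<Longrightarrow> 0 < r n"
    and F: "F \<subseteq> (\<Union>n\<in>J. Gball \<Gamma> (x n) (r n))"
    and fin: "(\<Sum>\<^sub>\<infinity>n\<in>J. if x n = 0 then \<infinity> else ennreal ((r n / d 0 (x n)) powr p)) < \<infinity>"
    unfolding p_bounded_def p_def by blast
  obtain T where x: "\<And>n. n \<in> J \<Longrightarrow> x n \<noteq> 0"
    and T: "\<And>I. finite I \<Longrightarrow> I \<subseteq> J \<Longrightarrow> (\<Sum>n\<in>I. (r n / d 0 (x n)) powr p) \<le> T"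
    by (rule p_bounded_sums[OF fin]) (auto intro: that)
  obtain z Rj where z: "\<And>j. 0 < Rj j" "\<And>j. Gball \<Gamma> (z j) (Rj j) \<subseteq> K"
    "filterlim (\<lambda>j. norm (z j)) at_top sequentially"
    "liminf (\<lambda>j. ereal (Rj j / d 0 (z j))) > 0"
    using K(1) unfolding Gcone_def by blast
  obtain c where c: "0 < c" "ereal c < liminf (\<lambda>j. ereal (Rj j / d 0 (z j)))"
    using ereal_dense2[OF z(4)] by auto
  \<comment> \<open>The ball about \<open>z j\<close> of radius \<eta> times
    \<open>d 0 (z j)\<close> then lies in the cone ball and at distance from 0 comparable to that of
    its centre.\<close>
  define \<eta> where "\<eta> = min (c / 2) (\<theta> / 4)"
  have \<eta>: "0 < \<eta>" "\<eta> < c" "\<eta> \<le> \<theta> / 4" using c \<theta> by (auto simp: \<eta>_def)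
  \<comment> \<open>Enough doublings for the ball about \<open>z j\<close> to contain the comparison
    balls about the \<open>x n\<close>; the fourth power of \<theta> collects the quasi-triangle
    inequalities used below.\<close>
  obtain k where "2 / \<theta> ^ 4 / \<eta> < 2 ^ k" using real_arch_pow[of 2 "2 / \<theta> ^ 4 / \<eta>"] by auto
  then have k: "2 / \<theta> ^ 4 \<le> 2 ^ k * \<eta>" by (simp only: pos_divide_less_eq[OF \<eta>(1)] less_imp_le)
  define D where "D = 2 powr p * \<beta> ^ k"
  have D: "0 \<le> D" using \<beta>(1) by (simp add: D_def)
  \<comment> \<open>The first bound makes each tail ball small relative to its centre; the second
    makes the total volume fall short.\<close>
  define \<sigma> where "\<sigma> = min ((\<theta> / 2) powr p) (1 / (2 * (D + 1)))"
  have \<sigma>: "0 < \<sigma>" "\<sigma> \<le> (\<theta> / 2) powr p" "D * \<sigma> < 1"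
  proof -
    show "0 < \<sigma>" using \<theta> D by (simp add: \<sigma>_def)
    show "\<sigma> \<le> (\<theta> / 2) powr p" by (simp add: \<sigma>_def)
    have "D * \<sigma> \<le> D * (1 / (2 * (D + 1)))" using D by (intro mult_left_mono) (auto simp: \<sigma>_def)
    also have "\<dots> < 1" using D by (simp add: field_simps)
    finally show "D * \<sigma> < 1" .
  qed
  obtain J0 where J0: "finite J0" "J0 \<subseteq> J"
    "\<And>I. finite I \<Longrightarrow> I \<subseteq> J - J0 \<Longrightarrow> (\<Sum>n\<in>I. (r n / d 0 (x n)) powr p) \<le> \<sigma>"
    using bounded_sums_tail[OF T \<sigma>(1)] by blast
  \<comment> \<open>The finitely many remaining balls stay within this distance of the origin, so
    distant cone balls miss them.\<close>
  define B where "B = Max (insert 0 ((\<lambda>n. max (d 0 (x n)) (r n) / \<theta>) ` J0))"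
  have B: "d 0 e \<le> B" if "n \<in> J0" "d (x n) e < r n" for n e
  proof -
    have "d 0 e \<le> max (d 0 (x n)) (r n) / \<theta>"
      using that by (intro quasi_triangle_le[of 0 "x n"]) auto
    also have "\<dots> \<le> B" unfolding B_def using J0(1) that by (intro Max_ge) auto
    finally show ?thesis .
  qed
  obtain b where b: "\<And>y. d 0 y \<le> B / \<theta> \<Longrightarrow> norm y \<le> b"
    using bounded_d_le[of 0 "B / \<theta>"] by (auto simp: bounded_iff)
  have "eventually (\<lambda>j. ereal c < ereal (Rj j / d 0 (z j))) sequentially"
    using c(2) by (rule less_LiminfD)
  moreover have "eventually (\<lambda>j. max b 0 < norm (z j)) sequentially"
    using z(3) unfolding filterlim_at_top_dense by (rule spec)
  ultimately have "eventually (\<lambda>j. c < Rj j / d 0 (z j) \<and> max b 0 < norm (z j)) sequentially"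
    by eventually_elim auto
  then obtain j where j: "c < Rj j / d 0 (z j)" "max b 0 < norm (z j)"
    by (auto simp: eventually_sequentially)
  define R where "R = d 0 (z j)"
  have R: "0 < R" unfolding R_def using j(2) by (intro gam_pos) auto
  have RB: "B < \<theta> * R"
  proof (rule ccontr)
    assume "\<not> B < \<theta> * R"
    then have "R \<le> B / \<theta>" using \<theta> by (simp add: field_simps)
    then show False using b[of "z j"] j(2) by (simp add: R_def)
  qed
  have "c * R < Rj j" using j(1) R by (simp add: R_def field_simps)
  then have \<eta>R: "\<eta> * R < Rj j" using mult_strict_right_mono[OF \<eta>(2) R] by linarith
  \<comment> \<open>The closed ball is compact, so finitely many covering balls suffice and finite
    subadditivity of volume applies.\<close>
  define C where "C = {e. d (z j) e \<le> \<eta> * R}"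
  have C: "compact C" unfolding C_def using bounded_d_le closed_d_le by (simp add: compact_eq_bounded_closed)
  have "C \<subseteq> Gball \<Gamma> (z j) (Rj j)" using \<eta>R by (auto simp: C_def Gball_def)
  then have "C \<subseteq> (\<Union>n\<in>J. Gball \<Gamma> (x n) (r n))" using z(2) K(2) F by blast
  from this obtain J' where J': "J' \<subseteq> J" "finite J'" "C \<subseteq> (\<Union>n\<in>J'. Gball \<Gamma> (x n) (r n))"
    by (rule compactE_image[OF C open_Gball]) blast
  have CR: "\<theta> * R \<le> d 0 e" "\<theta> * d 0 e \<le> R" if "e \<in> C" for e
  proof -
    have "\<eta> * R \<le> \<theta> / 4 * R" using \<eta>(3) R by (intro mult_right_mono) auto
    also have "\<theta> / 4 * R < \<theta> / 2 * R" using \<theta> R by simp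
    finally have *: "d (z j) e < \<theta> / 2 * R" using that by (simp add: C_def)
    show "\<theta> * R \<le> d 0 e" "\<theta> * d 0 e \<le> R"
      using d_0_in_small_ball[of "\<theta> / 2 * R" "z j" e] * by (simp_all add: R_def)
  qed
  define I where "I = {n \<in> J' - J0. C \<inter> Gball \<Gamma> (x n) (r n) \<noteq> {}}"
  have I: "finite I" "I \<subseteq> J - J0" using J' by (auto simp: I_def)
  have CI: "C \<subseteq> (\<Union>n\<in>I. Gball \<Gamma> (x n) (r n))"
  proof
    fix e assume e: "e \<in> C"
    then obtain n where n: "n \<in> J'" "e \<in> Gball \<Gamma> (x n) (r n)" using J'(3) by blast
    have "n \<notin> J0"
    proof
      assume "n \<in> J0"
      then have "d 0 e \<le> B" using n(2) by (intro B) (auto simp: Gball_def)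
      then show False using CR(1)[OF e] RB by simp
    qed
    then show "e \<in> (\<Union>n\<in>I. Gball \<Gamma> (x n) (r n))" using n e by (auto simp: I_def)
  qed
  have each: "vol (x n) (r n) \<le> (r n / d 0 (x n)) powr p * (D * vol (z j) (\<eta> * R))" if n: "n \<in> I" for n
  proof -
    define R' where "R' = d 0 (x n)"
    define t where "t = r n / R'"
    have nJ: "n \<in> J" using n I by blast
    have R': "0 < R'" unfolding R'_def using x[OF nJ] by (intro gam_pos) auto
    have t: "0 < t" "r n = t * R'" using r[OF nJ] R' by (auto simp: t_def)
    have "(r n / R') powr p \<le> \<sigma>" using J0(3)[of "{n}"] n I(2) by (auto simp: R'_def)
    then have rR: "r n \<le> \<theta> / 2 * R'"
      using \<sigma>(2) r[OF nJ] R' p by (intro ratio_le_of_powr_le[of _ _ p]) auto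
    then have "t \<le> \<theta> / 2" using R' by (simp add: t_def field_simps)
    then have t1: "t \<le> 1" using \<theta> by simp
    obtain e where e: "e \<in> C" "d (x n) e < r n" using n by (auto simp: I_def Gball_def)
    have "\<theta> * R' \<le> d 0 e" using d_0_in_small_ball(2)[OF _ e(2)] rR by (simp add: R'_def)
    then have "\<theta> * (\<theta> * R') \<le> R" using CR(2)[OF e(1)] mult_left_mono[of "\<theta> * R'" "d 0 e" \<theta>] \<theta> by linarith
    then have R'R: "R' \<le> R / \<theta> / \<theta>" using \<theta> by (simp add: field_simps)
    have grow: "a \<le> a / \<theta>" if "0 \<le> a" for a using that \<theta> mult_left_le_one_le[of a \<theta>] by (simp add: field_simps)
    have Rs: "R \<le> R / \<theta> / \<theta>"
      using grow[of R] grow[of "R / \<theta>"] R \<theta> by simp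
    have dz: "d (z j) (x n) \<le> R / \<theta> / \<theta> / \<theta>"
      by (rule quasi_triangle_le[of "z j" 0 "R / \<theta> / \<theta>" "x n"])
        (use Rs R'R in \<open>simp_all only: gam_sym[of "z j" 0] R_def R'_def\<close>)
    have "R' \<le> R / \<theta> / \<theta> / \<theta>" using R'R grow[of "R / \<theta> / \<theta>"] R \<theta> by simp
    then have "d (z j) y \<le> R / \<theta> / \<theta> / \<theta> / \<theta>" if "d (x n) y < R'" for y
      by (intro quasi_triangle_le[OF dz]) (use that in linarith)
    moreover have "R / \<theta> / \<theta> / \<theta> / \<theta> < 2 ^ k * (\<eta> * R)"
    proof -
      have "R / \<theta> / \<theta> / \<theta> / \<theta> = 1 / \<theta> ^ 4 * R" by (simp add: eval_nat_numeral)
      also have "\<dots> < 2 / \<theta> ^ 4 * R" using R \<theta> by (simp add: divide_strict_right_mono)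
      also have "\<dots> \<le> 2 ^ k * \<eta> * R" using k R by (intro mult_right_mono) auto
      finally show ?thesis by simp
    qed
    ultimately have "Gball \<Gamma> (x n) R' \<subseteq> Gball \<Gamma> (z j) (2 ^ k * (\<eta> * R))"
      by (fastforce simp: Gball_def)
    then have "vol (x n) R' \<le> vol (z j) (2 ^ k * (\<eta> * R))" by (rule vol_mono)
    also have "\<dots> \<le> \<beta> ^ k * vol (z j) (\<eta> * R)"
      using volume_large_ball[OF \<beta>, of "\<eta> * R"] \<eta>(1) R by simp
    finally have v: "vol (x n) R' \<le> \<beta> ^ k * vol (z j) (\<eta> * R)" .
    have "vol (x n) (r n) \<le> (2 * t) powr p * vol (x n) R'"
      unfolding t(2) p_def using \<alpha> t t1 R' by (intro volume_small_ball) auto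
    also have "\<dots> \<le> (2 * t) powr p * (\<beta> ^ k * vol (z j) (\<eta> * R))" using v by (rule mult_left_mono) simp
    also have "\<dots> = t powr p * (D * vol (z j) (\<eta> * R))" using t by (simp add: D_def powr_mult)
    finally show ?thesis by (simp add: t_def R'_def)
  qed
  have pos: "0 < vol (z j) (\<eta> * R)" using \<eta>(1) R by (intro vol_pos) simp
  have "Gball \<Gamma> (z j) (\<eta> * R) \<subseteq> (\<Union>n\<in>I. Gball \<Gamma> (x n) (r n))"
    using CI by (auto simp: C_def Gball_def)
  then have "vol (z j) (\<eta> * R) \<le> measure lebesgue (\<Union>n\<in>I. Gball \<Gamma> (x n) (r n))"
    using I(1) lmeasurable_Gball by (intro measure_mono_fmeasurable fmeasurable.finite_UN fmeasurableD) auto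
  also have "\<dots> \<le> (\<Sum>n\<in>I. vol (x n) (r n))"
    using I(1) lmeasurable_Gball by (intro measure_UNION_le fmeasurableD) auto
  also have "\<dots> \<le> (\<Sum>n\<in>I. (r n / d 0 (x n)) powr p * (D * vol (z j) (\<eta> * R)))"
    using each by (rule sum_mono)
  also have "\<dots> = (\<Sum>n\<in>I. (r n / d 0 (x n)) powr p) * (D * vol (z j) (\<eta> * R))"
    by (simp add: sum_distrib_right)
  also have "\<dots> \<le> \<sigma> * (D * vol (z j) (\<eta> * R))"
    using J0(3)[OF I] D pos by (intro mult_right_mono) auto
  also have "\<dots> = (D * \<sigma>) * vol (z j) (\<eta> * R)" by simp
  also have "\<dots> < 1 * vol (z j) (\<eta> * R)" using \<sigma>(3) pos by (rule mult_strict_right_mono)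
  finally show False by simp
qed

end

theorem theorem1p9:
  fixes V :: "real^'n::finite \<Rightarrow> real"
    and A :: "real^'n \<Rightarrow> real^'n^'n"
    and \<Gamma> :: "real^'n \<Rightarrow> real^'n \<Rightarrow> real"
    and \<Omega> :: "(real^'n) set"
  assumes "H1 V A" and "H2 A" and "H3 V A"
    and "FS V A \<Gamma>"
    and "cond_G \<Gamma>" and "cond_L V A" and "cond_D \<Gamma>"
    and "open \<Omega>"
  shows "(max_principle_set V A \<Omega> \<longleftrightarrow> large_at_infinity V A (UNIV - \<Omega>)) \<and>
    ((\<exists>p>1. p_unbounded \<Gamma> p (UNIV - \<Omega>)) \<longrightarrow> max_principle_set V A \<Omega>) \<and>
    ((\<exists>K. Gcone \<Gamma> K \<and> K \<subseteq> UNIV - \<Omega>) \<longrightarrow> max_principle_set V A \<Omega>)"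
proof -
  obtain \<theta> where \<theta>: "0 < \<theta>" "\<theta> < 1"
    and G: "\<And>x y r. r > 0 \<Longrightarrow> x \<notin> Gball \<Gamma> y r \<Longrightarrow> Gball \<Gamma> x (\<theta> * r) \<inter> Gball \<Gamma> y (\<theta> * r) = {}"
    using assms(5) unfolding cond_G_def by blast
  interpret Gamma_quasi_metric V A \<Gamma> \<theta>
    by unfold_locales (fact assms(1,2,4) \<theta> G)+
  have i: "max_principle_set V A \<Omega> \<longleftrightarrow> large_at_infinity V A (UNIV - \<Omega>)"
    using max_principle_imp_large large_imp_max_principle[OF assms(8)] by blast
  have ii: "max_principle_set V A \<Omega>" if "p > 1" "p_unbounded \<Gamma> p (UNIV - \<Omega>)" for p
    using not_max_principle_imp_p_bounded[OF assms(8) _ that(1)] that(2)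
    by (auto simp: p_unbounded_def Compl_eq_Diff_UNIV)
  have iii: "max_principle_set V A \<Omega>" if K: "Gcone \<Gamma> K" "K \<subseteq> UNIV - \<Omega>" for K
  proof -
    obtain \<alpha> \<beta> where \<alpha>: "2 < \<alpha>" "\<alpha> < \<beta>"
      and D: "\<And>x r. 0 < r \<Longrightarrow> \<alpha> * vol x r \<le> vol x (2 * r)"
        "\<And>x r. 0 < r \<Longrightarrow> vol x (2 * r) \<le> \<beta> * vol x r"
      using assms(7) unfolding cond_D_def by blast
    have "\<not> p_bounded \<Gamma> (log 2 \<alpha>) (UNIV - \<Omega>)"
      using \<alpha> by (intro cone_not_p_bounded[OF _ D(1) _ D(2) K]) auto
    moreover have "1 < log 2 \<alpha>" using \<alpha>(1) less_log_of_power[of 2 1 \<alpha>] by simp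
    ultimately show ?thesis using ii by (simp add: p_unbounded_def)
  qed
  show ?thesis using i ii iii by blast
qed

end
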